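(* Let $X=\mathcal A^{\mathbb N}$ and $Y=\mathcal D^{\mathbb N}$ be two full shifts over finite alphabets, with left shifts $T$ and $S$, and let $\pi:X\to Y$ be a one-block factor map. Let $\mathbf a=(a,b)\in\mathbb R^2$ with $a>0$ and $b\ge0$. For any $\eta\in\mathcal M(X,T)$, there exists a sequence of $\mathbf a$-weighted Gibbs measures $(\mu_n)_{n=1}^\infty\subset\mathcal M(X,T)$ converging to $\eta$ in the weak-star topology such that $$a h_{\mu_n}(T)+b h_{\mu_n\circ\pi^{-1}}(S)\ge a h_\eta(T)+b h_{\eta\circ\pi^{-1}}(S).$$ Furthermore, $$\lim_{n\to\infty}\big(a h_{\mu_n}(T)+b h_{\mu_n\circ\pi^{-1}}(S)\big)=a h_\eta(T)+b h_{\eta\circ\pi^{-1}}(S).$$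
   Context: A one-block factor map $\pi:X\to Y$ is a continuous surjection with $\pi T=S\pi$ induced letter by letter by a map $\pi:\mathcal A\to\mathcal D$; $\pi I$ is the word obtained from $I$ letterwise. $[I]$ is the cylinder of sequences beginning with the word $I$, and $\mu(I):=\mu([I])$. $\mathcal M(X,T)$ is the set of $T$-invariant Borel probability measures; $h_\mu(T)$ is measure-theoretic entropy. $\mathcal C_{aa}(X,T)$ is the set of almost additive potentials: sequences $\Phi=(\log\phi_n)_{n\ge1}$ with each $\phi_n:X\to(0,\infty)$ continuous and some $c>0$ with $c^{-1}\phi_n(x)\phi_m(T^nx)\le\phi_{n+m}(x)\le c\,\phi_n(x)\phi_m(T^nx)$ for all $x\in X$, $n,m\in\mathbb N$. $\Phi$ has the bounded distortion property if there is $c>0$ such that $c^{-1}\phi_n(y)\le\phi_n(x)\le c\,\phi_n(y)$ for all $n$ whenever $x,y$ lie in the same $n$-th cylinder. $\Phi_*(\eta)=\lim_n\frac1n\int\log\phi_n\,d\eta$, and $P^{\mathbf a}(T,\Phi)=\sup\{\Phi_*(\eta)+a h_\eta(T)+b h_{\eta\circ\pi^{-1}}(S):\eta\in\mathcal M(X,T)\}$. A Borel probability measure $\mu$ on $X$ (not necessarily invariant) is an $\mathbf a$-weighted Gibbs measure if there is $\Phi=(\log\phi_n)\in\mathcal C_{aa}(X,T)$ with the bounded distortion property and a constant $c>0$ such that, for all $n\in\mathbb N$ and $I\in\mathcal A^n$, the ratio of $\mu(I)$ to $\exp\big(\frac{-nP^{\mathbf a}(T,\Phi)}{a+b}\big)\phi(I)^{1/a}\psi(\pi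 I)^{-b/(a+b)}$ lies in $[c^{-1},c]$, where $\phi(I)=\sup_{x\in[I]}\phi_n(x)$ for $I\in\mathcal A^n$ and $\psi(J)=\sum_{I\in\mathcal A^n:\pi I=J}\phi(I)^{1/a}$ for $J\in\mathcal D^n$. *)

theory Defs
  imports "HOL-Probability.Probability"
begin

section \<open>Measure-theoretic entropy\<close>

definition invariant_measures ::
    "('x::topological_space \<Rightarrow> 'x) \<Rightarrow> 'x measure set" where
  "invariant_measures T =
     {\<mu>. prob_space \<mu> \<and> sets \<mu> = sets borel \<and> T \<in> borel_measurable \<mu> \<and> distr \<mu> borel T = \<mu>}"

definition finite_measurable_partition :: "'x measure \<Rightarrow> 'x set set \<Rightarrow> bool" where
  "finite_measurable_partition \<mu> \<xi> \<longleftrightarrow>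
     finite \<xi> \<and> \<xi> \<subseteq> sets \<mu> \<and> partition_on (space \<mu>) \<xi>"

text \<open>Atoms of measure zero contribute \<open>0 * ln 0 = 0\<close>.\<close>

definition partition_entropy :: "'x measure \<Rightarrow> 'x set set \<Rightarrow> real" where
  "partition_entropy \<mu> \<xi> = - (\<Sum>A\<in>\<xi>. measure \<mu> A * ln (measure \<mu> A))"

definition pullback_partition ::
    "'x measure \<Rightarrow> ('x \<Rightarrow> 'x) \<Rightarrow> 'x set set \<Rightarrow> 'x set set" where
  "pullback_partition \<mu> T \<xi> = (\<lambda>A. T -` A \<inter> space \<mu>) ` \<xi> - {{}}"

definition dynamical_refinement ::
    "'x measure \<Rightarrow> ('x \<Rightarrow> 'x) \<Rightarrow> 'x set set \<Rightarrow> nat \<Rightarrow> 'x set set" where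
  "dynamical_refinement \<mu> T \<xi> n =
     common_refinement ((\<lambda>i. pullback_partition \<mu> (T ^^ i) \<xi>) ` {..<n})"

text \<open>For a \<open>T\<close>-invariant probability measure the limit exists, by subadditivity.\<close>

definition partition_entropy_rate ::
    "'x measure \<Rightarrow> ('x \<Rightarrow> 'x) \<Rightarrow> 'x set set \<Rightarrow> real" where
  "partition_entropy_rate \<mu> T \<xi> =
     lim (\<lambda>n. partition_entropy \<mu> (dynamical_refinement \<mu> T \<xi> n) / real n)"

definition measure_entropy :: "'x measure \<Rightarrow> ('x \<Rightarrow> 'x) \<Rightarrow> ereal" where
  "measure_entropy \<mu> T =
     (SUP \<xi> \<in> {\<xi>. finite_measurable_partition \<mu> \<xi>}. ereal (partition_entropy_rate \<mu> T \<xi>))"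

definition weak_star_tendsto ::
    "(nat \<Rightarrow> 'x::topological_space measure) \<Rightarrow> 'x measure \<Rightarrow> bool" where
  "weak_star_tendsto \<mu> \<eta> \<longleftrightarrow>
     (\<forall>f::'x \<Rightarrow> real. continuous_on UNIV f \<longrightarrow>
        (\<lambda>n. integral\<^sup>L (\<mu> n) f) \<longlonglongrightarrow> integral\<^sup>L \<eta> f)"

section \<open>Full shifts and one-block factor maps\<close>

text \<open>An alphabet is a finite type with the discrete topology, the one-sided full shift
  over \<open>'a\<close> is the whole type \<open>nat \<Rightarrow> 'a\<close> with the product topology, and a word of length \<open>n\<close>
  is a list of length \<open>n\<close>.\<close>

definition shift_map :: "(nat \<Rightarrow> 'a) \<Rightarrow> (nat \<Rightarrow> 'a)" where
  "shift_map x = (\<lambda>i. x (Suc i))"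

definition cylinder :: "'a list \<Rightarrow> (nat \<Rightarrow> 'a) set" where
  "cylinder I = {x. \<forall>i<length I. x i = I ! i}"

definition block_map :: "('a \<Rightarrow> 'd) \<Rightarrow> (nat \<Rightarrow> 'a) \<Rightarrow> (nat \<Rightarrow> 'd)" where
  "block_map \<pi> x = (\<lambda>i. \<pi> (x i))"

definition one_block_factor_map ::
    "('a::{finite,discrete_topology} \<Rightarrow> 'd::{finite,discrete_topology}) \<Rightarrow> bool" where
  "one_block_factor_map \<pi> \<longleftrightarrow>
     continuous_on UNIV (block_map \<pi>) \<and> surj (block_map \<pi>) \<and>
     block_map \<pi> \<circ> shift_map = shift_map \<circ> block_map \<pi>"

text \<open>\<open>a h\<^sub>\<eta>(T) + b h\<^bsub>\<eta>\<circ>\<pi>\<^sup>-\<^sup>1\<^esub>(S)\<close>\<close>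

definition weighted_entropy ::
    "real \<Rightarrow> real \<Rightarrow> ('a::{finite,discrete_topology} \<Rightarrow> 'd::{finite,discrete_topology}) \<Rightarrow>
     (nat \<Rightarrow> 'a) measure \<Rightarrow> ereal" where
  "weighted_entropy a b \<pi> \<eta> =
     ereal a * measure_entropy \<eta> shift_map +
     ereal b * measure_entropy (distr \<eta> borel (block_map \<pi>)) shift_map"

section \<open>Almost additive potentials and weighted Gibbs measures\<close>

text \<open>A potential \<open>(log \<phi>\<^sub>n)\<close>, indexed by \<open>n \<ge> 1\<close>, is represented by the sequence \<open>\<phi>\<close>;
  the value \<open>\<phi> 0\<close> is irrelevant.\<close>

definition almost_additive ::
    "(nat \<Rightarrow> (nat \<Rightarrow> 'a::{finite,discrete_topology}) \<Rightarrow> real) \<Rightarrow> bool" where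
  "almost_additive \<phi> \<longleftrightarrow>
     (\<forall>n\<ge>1. continuous_on UNIV (\<phi> n) \<and> (\<forall>x. \<phi> n x > 0)) \<and>
     (\<exists>c>0. \<forall>x. \<forall>n\<ge>1. \<forall>m\<ge>1.
        inverse c * \<phi> n x * \<phi> m ((shift_map ^^ n) x) \<le> \<phi> (n + m) x \<and>
        \<phi> (n + m) x \<le> c * \<phi> n x * \<phi> m ((shift_map ^^ n) x))"

definition bounded_distortion ::
    "(nat \<Rightarrow> (nat \<Rightarrow> 'a::{finite,discrete_topology}) \<Rightarrow> real) \<Rightarrow> bool" where
  "bounded_distortion \<phi> \<longleftrightarrow>
     (\<exists>c>0. \<forall>n\<ge>1. \<forall>I. length I = n \<longrightarrow> (\<forall>x\<in>cylinder I. \<forall>y\<in>cylinder I.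
        inverse c * \<phi> n y \<le> \<phi> n x \<and> \<phi> n x \<le> c * \<phi> n y))"

definition potential_average ::
    "(nat \<Rightarrow> (nat \<Rightarrow> 'a::{finite,discrete_topology}) \<Rightarrow> real) \<Rightarrow>
     (nat \<Rightarrow> 'a) measure \<Rightarrow> real" where
  "potential_average \<phi> \<eta> = lim (\<lambda>n. integral\<^sup>L \<eta> (\<lambda>x. ln (\<phi> n x)) / real n)"

definition weighted_pressure ::
    "real \<Rightarrow> real \<Rightarrow> ('a::{finite,discrete_topology} \<Rightarrow> 'd::{finite,discrete_topology}) \<Rightarrow>
     (nat \<Rightarrow> (nat \<Rightarrow> 'a) \<Rightarrow> real) \<Rightarrow> ereal" where
  "weighted_pressure a b \<pi> \<phi> =
     (SUP \<eta> \<in> invariant_measures shift_map.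
        ereal (potential_average \<phi> \<eta>) + weighted_entropy a b \<pi> \<eta>)"

definition word_weight ::
    "(nat \<Rightarrow> (nat \<Rightarrow> 'a::{finite,discrete_topology}) \<Rightarrow> real) \<Rightarrow> 'a list \<Rightarrow> real" where
  "word_weight \<phi> I = (SUP x\<in>cylinder I. \<phi> (length I) x)"

definition factor_word_weight ::
    "real \<Rightarrow> ('a::{finite,discrete_topology} \<Rightarrow> 'd::{finite,discrete_topology}) \<Rightarrow>
     (nat \<Rightarrow> (nat \<Rightarrow> 'a) \<Rightarrow> real) \<Rightarrow> 'd list \<Rightarrow> real" where
  "factor_word_weight a \<pi> \<phi> J =
     (\<Sum>I | length I = length J \<and> map \<pi> I = J. word_weight \<phi> I powr (1 / a))"

text \<open>The pressure of an almost additive potential is finite, since \<open>n\<^sup>-\<^sup>1 log \<phi>\<^sub>n\<close> is uniformly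
  bounded and the entropies are bounded by the logarithms of the alphabet sizes, so passing to
  its real value loses nothing.\<close>

definition weighted_gibbs_measure ::
    "real \<Rightarrow> real \<Rightarrow> ('a::{finite,discrete_topology} \<Rightarrow> 'd::{finite,discrete_topology}) \<Rightarrow>
     (nat \<Rightarrow> 'a) measure \<Rightarrow> bool" where
  "weighted_gibbs_measure a b \<pi> \<mu> \<longleftrightarrow>
     prob_space \<mu> \<and> sets \<mu> = sets borel \<and>
     (\<exists>\<phi>. almost_additive \<phi> \<and> bounded_distortion \<phi> \<and>
       (\<exists>c>0. \<forall>n\<ge>1. \<forall>I. length I = n \<longrightarrow>
          measure \<mu> (cylinder I) /
            (exp (- real n * real_of_ereal (weighted_pressure a b \<pi> \<phi>) / (a + b)) *
             word_weight \<phi> I powr (1 / a) *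
             factor_word_weight a \<pi> \<phi> (map \<pi> I) powr (- b / (a + b)))
          \<in> {inverse c..c}))"

end

theory Submission
  imports Defs "HOL-Real_Asymp.Real_Asymp"
begin

text \<open>An invariant measure \<open>\<mu>\<close> with \<open>\<mu>(IJ)\<close> comparable to \<open>\<mu>(I) \<mu>(J)\<close> is a weighted Gibbs measure: with
  \<open>\<nu> = \<mu> \<circ> \<pi>\<^sup>-\<^sup>1\<close> and \<open>\<phi>(I) = \<mu>(I)\<^sup>a \<nu>(\<pi> I)\<^sup>b\<close> the Gibbs ratio is identically \<open>1\<close> and, by the
  Gibbs inequality, the weighted pressure is \<open>0\<close>. Markov measures of any order with positive weights
  have this property.

  The weighted entropy is concave and has a unique maximiser, an explicit Bernoulli measure \<open>\<lambda>\<close>. If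
  \<open>\<eta> = \<lambda>\<close>, take the constant sequence. Otherwise \<open>(1 - \<epsilon>) \<eta> + \<epsilon> \<lambda>\<close> has full support and
  strictly larger weighted entropy than \<open>\<eta>\<close>, which leaves room for replacing it by its Markov
  approximation \<open>\<mu>\<^sub>k\<close> of high order \<open>k\<close>. Here \<open>h(\<mu>\<^sub>k)\<close> is at least the entropy of the approximated
  measure because \<open>\<mu>\<^sub>k\<close> maximises entropy for its \<open>(k + 1)\<close>-block marginals. The entropy of the
  factor, a hidden Markov measure, is bounded below through \<open>h(\<mu>\<^sub>k) - h(\<mu>\<^sub>k \<circ> \<pi>\<^sup>-\<^sup>1) \<le> H\<^sub>m(X | Y) / m\<close> with
  \<open>m = k + 1\<close>, whose right-hand side only depends on the common marginals. The matching upper bound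
  in the limit is upper semicontinuity of entropy.\<close>

text \<open>Entropy is only upper semicontinuous, so weak-star closeness by itself allows entropy to
  be lost. On X the Markov approximation loses none, but its image in Y need not be Markov of any
  order, and no formula gives its entropy. Only the difference of the two entropy rates is under
  control, since conditional block entropy is subadditive. The resulting lower bound reaches the
  weighted entropy of the approximated measure only as the order tends to infinity; the strict gain
  from mixing with \<lambda> pays for the deficit at finite order. Mixing also gives every cylinder
  positive measure, on which transition probabilities and comparability constants rely.

  The form of \<phi> comes from the Gibbs formula:
  \<open>\<phi>(I)^(1/a) = \<mu>(I) \<nu>(\<pi> I)^(b/a)\<close> sums over a fibre to
  \<open>\<nu>^((a+b)/a)\<close>, and the power \<open>-b/(a+b)\<close> of this cancels
  \<open>\<nu>^(b/a)\<close>. Comparability passes from \<mu> to \<nu> with the same constant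
  because the fibre over a concatenation is a product of fibres; this is how a hidden Markov measure
  can enter the potential.\<close>

section \<open>Subadditive sequences and the Gibbs inequality\<close>

text \<open>Fekete's lemma: the limit is the infimum of \<open>f n / n\<close>, approached by
  dividing n with remainder by a nearly optimal m. That the limit lies below every term is what
  later turns finite block entropies into upper bounds for entropy rates.\<close>

lemma subadditive_div_convergent:
  fixes f :: "nat \<Rightarrow> real"
  assumes sub: "\<And>m n. f (m + n) \<le> f m + f n"
    and bd: "\<And>n. n \<ge> 1 \<Longrightarrow> K \<le> f n / real n"
  obtains L where "(\<lambda>n. f n / real n) \<longlonglongrightarrow> L" "\<And>n. n \<ge> 1 \<Longrightarrow> L \<le> f n / real n"
proof -
  define L where "L = (INF n\<in>{1..}. f n / real n)"
  have bdd: "bdd_below ((\<lambda>n. f n / real n) ` {1..})"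
    using bd by (intro bdd_belowI2) auto
  have lower: "L \<le> f n / real n" if "n \<ge> 1" for n
    unfolding L_def using that by (intro cINF_lower[OF bdd]) auto
  have mult: "f (q * m + r) \<le> real q * f m + f r" for q m r
  proof (induction q)
    case (Suc q)
    have "f (Suc q * m + r) \<le> f m + f (q * m + r)"
      using sub[of m "q * m + r"] by (simp add: algebra_simps)
    with Suc show ?case by (simp add: algebra_simps)
  qed simp
  have "(\<lambda>n. f n / real n) \<longlonglongrightarrow> L"
  proof (rule LIMSEQ_I)
    fix e :: real assume e: "e > 0"
    have "\<exists>m\<in>{1..}. f m / real m < L + e / 2"
      using cINF_less_iff[OF _ bdd, of "L + e/2"] e unfolding L_def by (auto simp del: atLeast_iff)
    then obtain m where m: "m \<ge> 1" "f m / real m < L + e / 2" by auto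
    \<comment> \<open>The first summand bounds the remainder term \<open>f (n mod m)\<close>, the
      second the error made by replacing \<open>(n div m) * m\<close> by n.\<close>
    define B where "B = (\<Sum>r<m. \<bar>f r\<bar>) + real m * \<bar>f m / real m\<bar>"
    have B: "\<bar>f r\<bar> \<le> (\<Sum>r<m. \<bar>f r\<bar>)" if "r < m" for r
      using that by (intro member_le_sum) auto
    have upper: "f n / real n \<le> f m / real m + B / real n" if n: "n \<ge> 1" for n
    proof -
      define s where "s = f m / real m"
      have fm: "f m = real m * s" using m by (simp add: s_def)
      have div_eq: "real (n div m) * real m = real n - real (n mod m)"
        by (metis add_diff_cancel_right' div_mult_mod_eq of_nat_add of_nat_mult)
      have "f n \<le> real (n div m) * f m + f (n mod m)"
        using mult[of "n div m" m "n mod m"] by simp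
      also have "real (n div m) * f m = (real n - real (n mod m)) * s"
        unfolding fm div_eq[symmetric] by simp
      also have "\<dots> = real n * s + - (real (n mod m) * s)"
        by (simp add: left_diff_distrib)
      also have "- (real (n mod m) * s) \<le> real m * \<bar>s\<bar>"
      proof -
        have "- (real (n mod m) * s) \<le> real (n mod m) * \<bar>s\<bar>"
          using abs_ge_minus_self[of "real (n mod m) * s"] by (simp add: abs_mult)
        also have "\<dots> \<le> real m * \<bar>s\<bar>"
          using m by (intro mult_right_mono) (auto intro: less_imp_le)
        finally show ?thesis .
      qed
      also have "f (n mod m) \<le> (\<Sum>r<m. \<bar>f r\<bar>)"
        using B[of "n mod m"] m by simp
      finally have "f n \<le> real n * s + B" unfolding B_def s_def by simp
      then have "f n / real n \<le> (real n * s + B) / real n"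
        by (intro divide_right_mono) auto
      also have "\<dots> = s + B / real n" using n by (simp add: add_divide_distrib)
      finally show ?thesis unfolding s_def .
    qed
    have "(\<lambda>n. B / real n) \<longlonglongrightarrow> 0" by real_asymp
    then have "\<forall>\<^sub>F n in sequentially. B / real n < e / 2"
      using e by (intro order_tendstoD) auto
    then obtain N where N: "\<And>n. n \<ge> N \<Longrightarrow> B / real n < e / 2"
      by (auto simp: eventually_sequentially)
    show "\<exists>N. \<forall>n\<ge>N. norm (f n / real n - L) < e"
    proof (intro exI allI impI)
      fix n assume "n \<ge> max N 1"
      then have n: "n \<ge> N" "n \<ge> 1" by auto
      have "f n / real n < L + e"
        using upper[OF n(2)] N[OF n(1)] m(2) by linarith
      then show "norm (f n / real n - L) < e"
        using lower[OF n(2)] by (simp add: abs_less_iff)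
    qed
  qed
  with lower show ?thesis using that by blast
qed

section \<open>The entropy function and the Gibbs inequality\<close>

definition ent :: "real \<Rightarrow> real" where
  "ent t = - (t * ln t)"

lemma ent_0 [simp]: "ent 0 = 0" and ent_1 [simp]: "ent 1 = 0"
  by (simp_all add: ent_def)

lemma ent_nonneg: "0 \<le> t \<Longrightarrow> t \<le> 1 \<Longrightarrow> 0 \<le> ent t"
  unfolding ent_def by (cases "t = 0") (auto simp: mult_nonneg_nonpos)

lemma continuous_on_ent: "continuous_on {0..} ent"
proof -
  have "isCont ent t" if "t > 0" for t
    unfolding ent_def using that by (intro continuous_intros) auto
  moreover have "(ent \<longlongrightarrow> 0) (at 0 within {0..})"
  proof -
    have "((\<lambda>t::real. - (t * ln t)) \<longlongrightarrow> 0) (at_right 0)" by real_asymp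
    moreover have "at (0::real) within {0..} = at_right 0"
    proof -
      have "{0..} - {0} = {0<..} - {0::real}" by auto
      then show ?thesis unfolding at_within_def by (simp only:)
    qed
    ultimately show ?thesis by (simp add: ent_def[abs_def])
  qed
  ultimately show ?thesis
    unfolding continuous_on_def
    by (metis atLeast_iff ent_0 isContD less_eq_real_def subset_UNIV tendsto_within_subset)
qed

text \<open>This is \<open>ln t \<le> t - 1\<close> at \<open>t = q / p\<close>, multiplied by p.
  The equality case \<open>t = 1\<close> yields the uniqueness of the maximising measure.\<close>

lemma gibbs_term:
  fixes p q :: real
  assumes "p \<ge> 0" "q \<ge> 0" "p > 0 \<Longrightarrow> q > 0"
  shows "p * ln q - p * ln p \<le> q - p"
    and "p * ln q - p * ln p = q - p \<Longrightarrow> p = q"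
proof -
  have *: "p * ln q - p * ln p = p * ln (q / p)" if "p > 0"
    using that assms by (simp add: ln_div algebra_simps)
  show "p * ln q - p * ln p \<le> q - p"
  proof (cases "p = 0")
    case False
    then have p: "p > 0" "q > 0" using assms by auto
    have "p * ln (q / p) \<le> p * (q / p - 1)"
      using p by (intro mult_left_mono ln_le_minus_one) auto
    then show ?thesis using * p by (simp add: algebra_simps)
  qed (use assms in auto)
  show "p = q" if eq: "p * ln q - p * ln p = q - p"
  proof (cases "p = 0")
    case False
    then have p: "p > 0" "q > 0" using assms by auto
    have "p * ln (q / p) = p * (q / p - 1)"
      using * p eq by (simp add: algebra_simps)
    then have "ln (q / p) = q / p - 1" using p by simp
    then have "q / p = 1" using p by (intro ln_eq_minus_one) auto
    then show ?thesis using p by simp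
  qed (use eq in auto)
qed

text \<open>The sums are compared by an inequality so that q may have total mass below that of p, as
  happens in strong subadditivity.\<close>

lemma gibbs_inequality:
  fixes p q :: "'i \<Rightarrow> real"
  assumes "\<And>i. i \<in> S \<Longrightarrow> p i \<ge> 0" "\<And>i. i \<in> S \<Longrightarrow> q i \<ge> 0"
    "\<And>i. i \<in> S \<Longrightarrow> p i > 0 \<Longrightarrow> q i > 0" "sum q S \<le> sum p S"
  shows "(\<Sum>i\<in>S. p i * ln (q i)) \<le> (\<Sum>i\<in>S. p i * ln (p i))"
proof -
  have "(\<Sum>i\<in>S. p i * ln (q i) - p i * ln (p i)) \<le> (\<Sum>i\<in>S. q i - p i)"
    using assms by (intro sum_mono gibbs_term) auto
  with assms(4) show ?thesis by (simp add: sum_subtractf)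
qed

lemma gibbs_equality:
  fixes p q :: "'i \<Rightarrow> real"
  assumes "finite S" "\<And>i. i \<in> S \<Longrightarrow> p i \<ge> 0" "\<And>i. i \<in> S \<Longrightarrow> q i \<ge> 0"
    "\<And>i. i \<in> S \<Longrightarrow> p i > 0 \<Longrightarrow> q i > 0" "sum q S \<le> sum p S"
    and eq: "(\<Sum>i\<in>S. p i * ln (p i)) \<le> (\<Sum>i\<in>S. p i * ln (q i))" and "i \<in> S"
  shows "p i = q i"
proof -
  define d where "d i = (q i - p i) - (p i * ln (q i) - p i * ln (p i))" for i
  have nonneg: "d i \<ge> 0" if "i \<in> S" for i
    using gibbs_term(1)[of "p i" "q i"] assms that unfolding d_def by simp
  have "sum d S \<le> 0"
    using assms(5) eq by (simp add: d_def sum_subtractf)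
  then have "sum d S = 0" using nonneg by (meson order_antisym sum_nonneg)
  then have "d i = 0"
    using sum_nonneg_eq_0_iff[of S d] nonneg assms by auto
  then show ?thesis
    using gibbs_term(2)[of "p i" "q i"] assms unfolding d_def by simp
qed

text \<open>Comparing s and t with their mixture by \<open>gibbs_term\<close> and averaging makes
  the linear right-hand sides cancel.\<close>

lemma ent_concave:
  assumes "0 \<le> s" "0 \<le> t" "0 \<le> e" "e \<le> 1"
  shows "(1 - e) * ent s + e * ent t \<le> ent ((1 - e) * s + e * t)"
proof -
  let ?u = "(1 - e) * s + e * t"
  have u: "?u \<ge> 0" using assms by simp
  have *: "(1 - e) * (s * ln ?u - s * ln s) \<le> (1 - e) * (?u - s)"
  proof (cases "e = 1")
    case False
    then show ?thesis
      using assms u by (intro mult_left_mono gibbs_term) (auto intro!: add_pos_nonneg)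
  qed simp
  have **: "e * (t * ln ?u - t * ln t) \<le> e * (?u - t)"
  proof (cases "e = 0")
    case False
    then show ?thesis
      using assms u by (intro mult_left_mono gibbs_term) (auto intro!: add_nonneg_pos)
  qed simp
  have "(1 - e) * (?u - s) + e * (?u - t) = 0" by (simp add: algebra_simps)
  then have "(1 - e) * (s * ln ?u - s * ln s) + e * (t * ln ?u - t * ln t) \<le> 0"
    using * ** by linarith
  then show ?thesis unfolding ent_def by (simp add: algebra_simps)
qed

section \<open>Entropy of finite-valued random variables\<close>

text \<open>Random variables replace partitions: a join becomes a pair and refinement becomes
  functional dependence. Only the partition into level sets matters, not the type of the
  values.\<close>

definition law :: "'m measure \<Rightarrow> ('m \<Rightarrow> 'v) \<Rightarrow> 'v \<Rightarrow> real" where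
  "law M X v = measure M (X -` {v} \<inter> space M)"

definition var_entropy :: "'m measure \<Rightarrow> ('m \<Rightarrow> 'v) \<Rightarrow> real" where
  "var_entropy M X = (\<Sum>v\<in>X ` space M. ent (law M X v))"

text \<open>The chain rule serves as the definition, so that no conditional probabilities have to be
  handled.\<close>

definition cond_entropy :: "'m measure \<Rightarrow> ('m \<Rightarrow> 'v) \<Rightarrow> ('m \<Rightarrow> 'w) \<Rightarrow> real" where
  "cond_entropy M X Y = var_entropy M (\<lambda>x. (X x, Y x)) - var_entropy M Y"

lemma law_nonneg [simp]: "0 \<le> law M X v"
  by (simp add: law_def)

lemma law_outside: "v \<notin> X ` space M \<Longrightarrow> law M X v = 0"
proof -
  assume "v \<notin> X ` space M"
  then have "X -` {v} \<inter> space M = {}" by auto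
  then show ?thesis by (simp add: law_def)
qed

lemma var_entropy_superset:
  assumes "finite S" "X ` space M \<subseteq> S"
  shows "var_entropy M X = (\<Sum>v\<in>S. ent (law M X v))"
  unfolding var_entropy_def
  using assms by (intro sum.mono_neutral_left) (auto simp: law_outside)

lemma simple_function_comp: "simple_function M X \<Longrightarrow> simple_function M (\<lambda>x. f (X x))"
  using simple_function_compose[of M X f] by (simp add: comp_def)

lemma simple_function_mp:
  assumes X: "simple_function M X" and T: "T \<in> measurable M M"
  shows "simple_function M (\<lambda>x. X (T x))"
proof -
  have sub: "(\<lambda>x. X (T x)) ` space M \<subseteq> X ` space M"
    using measurable_space[OF T] by auto
  have "(\<lambda>x. X (T x)) -` {v} \<inter> space M \<in> sets M" for v
  proof -
    have "(\<lambda>x. X (T x)) -` {v} \<inter> space M = T -` (X -` {v} \<inter> space M) \<inter> space M"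
      using measurable_space[OF T] by auto
    then show ?thesis
      using measurable_sets[OF T simple_functionD(2)[OF X]] by simp
  qed
  then show ?thesis
    using finite_subset[OF sub] X by (simp add: simple_function_def)
qed

section \<open>Shannon inequalities\<close>

context prob_space
begin

lemma law_le_1: "law M X v \<le> 1"
  by (simp add: law_def)

lemma law_comp:
  assumes X: "simple_function M X"
  shows "law M (\<lambda>x. f (X x)) u = (\<Sum>v\<in>{v\<in>X ` space M. f v = u}. law M X v)"
proof -
  have fin: "finite (X ` space M)" using X by (simp add: simple_function_def)
  have "(\<lambda>x. f (X x)) -` {u} \<inter> space M = (\<Union>v\<in>{v\<in>X ` space M. f v = u}. X -` {v} \<inter> space M)"
    by auto
  then show ?thesis
    unfolding law_def using fin simple_functionD(2)[OF X]
    by (simp only:) (intro finite_measure_finite_Union, auto simp: disjoint_family_on_def)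
qed

lemma sum_law_comp:
  assumes X: "simple_function M X"
  shows "(\<Sum>v\<in>X ` space M. law M X v * g (f v)) =
         (\<Sum>u\<in>(\<lambda>x. f (X x)) ` space M. law M (\<lambda>x. f (X x)) u * g u)"
proof -
  have fin: "finite (X ` space M)" using X by (simp add: simple_function_def)
  have "(\<Sum>v\<in>X ` space M. law M X v * g (f v)) =
        (\<Sum>u\<in>f ` X ` space M. \<Sum>v\<in>{v\<in>X ` space M. f v = u}. law M X v * g (f v))"
    by (rule sum.image_gen[OF fin])
  also have "\<dots> = (\<Sum>u\<in>(\<lambda>x. f (X x)) ` space M. law M (\<lambda>x. f (X x)) u * g u)"
    by (intro sum.cong) (auto simp: law_comp[OF X] sum_distrib_right image_image)
  finally show ?thesis .
qed

lemma sum_law: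
  assumes X: "simple_function M X"
  shows "(\<Sum>v\<in>X ` space M. law M X v) = 1"
proof -
  have "law M (\<lambda>x. ()) () = 1"
    using prob_space by (simp add: law_def)
  moreover have "law M (\<lambda>x. ()) () = (\<Sum>v\<in>X ` space M. law M X v)"
    using law_comp[OF X, of "\<lambda>_. ()" "()"] by simp
  ultimately show ?thesis by simp
qed

lemma law_le_comp:
  assumes X: "simple_function M X"
  shows "law M X v \<le> law M (\<lambda>x. f (X x)) (f v)"
  unfolding law_def using simple_functionD(2)[OF simple_function_comp[OF X, of f]]
  by (intro finite_measure_mono) auto

text \<open>Expressing the entropy of a function of X over the values of X itself puts the entropies
  of all marginals of a joint law on one index set, where they can be compared termwise.\<close>

lemma var_entropy_comp:
  assumes X: "simple_function M X"
  shows "var_entropy M (\<lambda>x. f (X x)) =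
    - (\<Sum>v\<in>X ` space M. law M X v * ln (law M (\<lambda>x. f (X x)) (f v)))"
  unfolding sum_law_comp[OF X, of "\<lambda>u. ln (law M (\<lambda>x. f (X x)) u)" f] var_entropy_def ent_def
  by (simp add: sum_negf)

lemma var_entropy_mono:
  assumes X: "simple_function M X"
    and det: "\<And>x y. x \<in> space M \<Longrightarrow> y \<in> space M \<Longrightarrow> X x = X y \<Longrightarrow> Y x = Y y"
  shows "var_entropy M Y \<le> var_entropy M X"
proof -
  \<comment> \<open>Y factors through X: its value is read off at an arbitrary representative of the
    level set of X.\<close>
  define f where "f v = Y (inv_into (space M) X v)" for v
  have Y: "f (X x) = Y x" if "x \<in> space M" for x
    unfolding f_def using that by (intro det) (auto intro: inv_into_into f_inv_into_f)
  have "law M (\<lambda>x. f (X x)) v = law M Y v" for v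
    unfolding law_def using Y by (intro arg_cong[where f="measure M"]) auto
  moreover have "(\<lambda>x. f (X x)) ` space M = Y ` space M" using Y by auto
  ultimately have "var_entropy M Y = var_entropy M (\<lambda>x. f (X x))"
    by (simp add: var_entropy_def)
  also have "\<dots> = - (\<Sum>v\<in>X ` space M. law M X v * ln (law M (\<lambda>x. f (X x)) (f v)))"
    by (rule var_entropy_comp[OF X])
  also have "\<dots> \<le> - (\<Sum>v\<in>X ` space M. law M X v * ln (law M X v))"
  proof -
    have "law M X v * ln (law M X v) \<le> law M X v * ln (law M (\<lambda>x. f (X x)) (f v))" for v
    proof (cases "law M X v = 0")
      case False
      then have "law M X v > 0" using law_nonneg[of M X v] by linarith
      then show ?thesis using law_le_comp[OF X, of v f] by (intro mult_left_mono) auto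
    qed simp
    then show ?thesis by (simp add: sum_mono)
  qed
  also have "\<dots> = var_entropy M X"
    by (simp add: var_entropy_def ent_def sum_negf)
  finally show ?thesis .
qed

lemma var_entropy_cong:
  assumes "simple_function M X" "simple_function M Y"
    and "\<And>x y. x \<in> space M \<Longrightarrow> y \<in> space M \<Longrightarrow> X x = X y \<longleftrightarrow> Y x = Y y"
  shows "var_entropy M X = var_entropy M Y"
  using assms by (intro antisym var_entropy_mono) auto

lemma sum_law_pair:
  assumes X: "simple_function M X" and Z: "simple_function M Z"
  shows "(\<Sum>x\<in>X ` space M. law M (\<lambda>w. (X w, Z w)) (x, z)) = law M Z z"
proof -
  let ?V = "\<lambda>w. (X w, Z w)"
  have V: "simple_function M ?V" using simple_function_Pair[OF X Z] .
  have fin: "finite (X ` space M)" using X by (simp add: simple_function_def)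
  have "law M Z z = (\<Sum>v\<in>{v\<in>?V ` space M. snd v = z}. law M ?V v)"
    using law_comp[OF V, of snd z] by simp
  also have "\<dots> = (\<Sum>v\<in>X ` space M \<times> {z}. law M ?V v)"
    using fin by (intro sum.mono_neutral_left) (auto intro!: law_outside)
  also have "\<dots> = (\<Sum>x\<in>X ` space M. law M ?V (x, z))"
  proof -
    have "X ` space M \<times> {z} = (\<lambda>x. (x, z)) ` X ` space M" by auto
    then show ?thesis by (simp only:) (simp add: sum.reindex inj_on_def)
  qed
  finally show ?thesis by simp
qed

text \<open>Gibbs inequality for the joint law against the law q under which X and Y are
  conditionally independent given Z. All inequalities for conditional entropy below come from this
  one.\<close>

lemma strong_subadditivity:
  assumes X: "simple_function M X" and Y: "simple_function M Y" and Z: "simple_function M Z"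
  shows "var_entropy M (\<lambda>w. (X w, Y w, Z w)) + var_entropy M Z
    \<le> var_entropy M (\<lambda>w. (X w, Z w)) + var_entropy M (\<lambda>w. (Y w, Z w))"
proof -
  let ?V = "\<lambda>w. (X w, Y w, Z w)" and ?XZ = "\<lambda>w. (X w, Z w)" and ?YZ = "\<lambda>w. (Y w, Z w)"
  let ?S = "?V ` space M" and ?A = "X ` space M" and ?B = "Y ` space M" and ?C = "Z ` space M"
  have V: "simple_function M ?V" by (intro simple_function_Pair X Y Z)
  have fin: "finite ?A" "finite ?B" "finite ?C" using X Y Z by (auto simp: simple_function_def)
  define q where "q = (\<lambda>(x, y, z). law M ?XZ (x, z) * law M ?YZ (y, z) / law M Z z)"
  have q_nonneg: "q v \<ge> 0" for v by (cases v) (auto simp: q_def)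
  have le: "law M ?V (x,y,z) \<le> law M ?XZ (x,z)" "law M ?V (x,y,z) \<le> law M ?YZ (y,z)"
     "law M ?V (x,y,z) \<le> law M Z z" for x y z
    using law_le_comp[OF V, of "(x,y,z)" "\<lambda>(x,y,z). (x,z)"]
      law_le_comp[OF V, of "(x,y,z)" "\<lambda>(x,y,z). (y,z)"]
      law_le_comp[OF V, of "(x,y,z)" "\<lambda>(x,y,z). z"] by simp_all
  have pos: "law M ?XZ (x,z) > 0" "law M ?YZ (y,z) > 0" "law M Z z > 0"
    if "law M ?V (x,y,z) > 0" for x y z
    using le[of x y z] that by linarith+
  \<comment> \<open>On the full product of the ranges the sum factorises for each z, and the
    marginals collapse it to total mass one; on the range of the triple q may have less
    mass.\<close>
  have "sum q ?S \<le> sum q (?A \<times> ?B \<times> ?C)"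
    using fin q_nonneg by (intro sum_mono2) auto
  also have "\<dots> = (\<Sum>x\<in>?A. \<Sum>y\<in>?B. \<Sum>z\<in>?C. law M ?XZ (x, z) * law M ?YZ (y, z) / law M Z z)"
    by (simp add: sum.cartesian_product q_def)
  also have "\<dots> = (\<Sum>z\<in>?C. \<Sum>x\<in>?A. \<Sum>y\<in>?B. law M ?XZ (x, z) * law M ?YZ (y, z) / law M Z z)"
    by (subst sum.swap[of _ ?C]) (simp add: sum.swap[of _ ?C ?A] sum.swap[of _ ?C ?B])
  also have "\<dots> = (\<Sum>z\<in>?C. (\<Sum>x\<in>?A. law M ?XZ (x, z)) * (\<Sum>y\<in>?B. law M ?YZ (y, z)) / law M Z z)"
    by (simp add: sum_product sum_divide_distrib)
  also have "\<dots> = (\<Sum>z\<in>?C. law M Z z)"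
    by (simp add: sum_law_pair X Y Z)
  also have "\<dots> = sum (law M ?V) ?S"
    by (simp add: sum_law[OF Z] sum_law[OF V])
  finally have "sum q ?S \<le> sum (law M ?V) ?S" .
  moreover have "law M ?V v > 0 \<Longrightarrow> q v > 0" for v
    using pos by (cases v) (simp add: q_def)
  ultimately have "(\<Sum>v\<in>?S. law M ?V v * ln (q v)) \<le> (\<Sum>v\<in>?S. law M ?V v * ln (law M ?V v))"
    using q_nonneg by (intro gibbs_inequality) auto
  also have "(\<Sum>v\<in>?S. law M ?V v * ln (q v)) =
     (\<Sum>v\<in>?S. law M ?V v * ln (law M ?XZ ((\<lambda>(x,y,z). (x,z)) v)) +
        law M ?V v * ln (law M ?YZ ((\<lambda>(x,y,z). (y,z)) v)) -
        law M ?V v * ln (law M Z ((\<lambda>(x,y,z). z) v)))"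
  proof (intro sum.cong refl)
    fix v :: "'b \<times> 'c \<times> 'd"
    obtain x y z where v: "v = (x, y, z)" by (cases v)
    show "law M ?V v * ln (q v) = law M ?V v * ln (law M ?XZ ((\<lambda>(x,y,z). (x,z)) v)) +
        law M ?V v * ln (law M ?YZ ((\<lambda>(x,y,z). (y,z)) v)) -
        law M ?V v * ln (law M Z ((\<lambda>(x,y,z). z) v))"
    proof (cases "law M ?V v = 0")
      case False
      then have "law M ?V (x,y,z) > 0" using v by (metis law_nonneg less_eq_real_def)
      note p = pos[OF this]
      have "ln (q v) = ln (law M ?XZ (x,z)) + ln (law M ?YZ (y,z)) - ln (law M Z z)"
        unfolding v q_def using p by (simp add: ln_mult ln_div)
      then show ?thesis by (simp only:) (simp add: v algebra_simps)
    qed simp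
  qed
  also have "\<dots> = - var_entropy M ?XZ - var_entropy M ?YZ + var_entropy M Z"
    using var_entropy_comp[OF V, of "\<lambda>(x,y,z). (x,z)"]
      var_entropy_comp[OF V, of "\<lambda>(x,y,z). (y,z)"] var_entropy_comp[OF V, of "\<lambda>(x,y,z). z"]
    by (simp add: sum.distrib sum_subtractf)
  also have "(\<Sum>v\<in>?S. law M ?V v * ln (law M ?V v)) = - var_entropy M ?V"
    by (simp add: var_entropy_def ent_def sum_negf)
  finally show ?thesis by linarith
qed

lemma cond_entropy_antimono:
  assumes X: "simple_function M X" and Y: "simple_function M Y" and Z: "simple_function M Z"
    and det: "\<And>x y. x \<in> space M \<Longrightarrow> y \<in> space M \<Longrightarrow> Y x = Y y \<Longrightarrow> Z x = Z y"
  shows "cond_entropy M X Y \<le> cond_entropy M X Z"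
proof -
  have "var_entropy M (\<lambda>w. (X w, Y w, Z w)) = var_entropy M (\<lambda>w. (X w, Y w))"
    by (rule var_entropy_cong[OF simple_function_Pair[OF X simple_function_Pair[OF Y Z]]
        simple_function_Pair[OF X Y]]) (auto intro: det)
  moreover have "var_entropy M (\<lambda>w. (Y w, Z w)) = var_entropy M Y"
    by (rule var_entropy_cong[OF simple_function_Pair[OF Y Z] Y]) (auto intro: det)
  ultimately show ?thesis
    using strong_subadditivity[OF X Y Z] by (simp add: cond_entropy_def)
qed

lemma cond_entropy_pair:
  assumes X: "simple_function M X" and Y: "simple_function M Y" and Z: "simple_function M Z"
  shows "cond_entropy M (\<lambda>w. (X w, Y w)) Z \<le> cond_entropy M X Z + cond_entropy M Y Z"
proof -
  have "var_entropy M (\<lambda>w. (X w, Y w, Z w)) = var_entropy M (\<lambda>w. ((X w, Y w), Z w))"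
    by (intro var_entropy_cong simple_function_Pair X Y Z) auto
  then show ?thesis
    using strong_subadditivity[OF X Y Z] by (simp add: cond_entropy_def)
qed

lemma var_entropy_const: "var_entropy M (\<lambda>w. c) = 0"
proof -
  have "law M (\<lambda>w. c) c = 1" using prob_space by (simp add: law_def)
  moreover have "var_entropy M (\<lambda>w. c) = (\<Sum>v\<in>{c}. ent (law M (\<lambda>w. c) v))"
    by (rule var_entropy_superset) auto
  ultimately show ?thesis by simp
qed

lemma var_entropy_nonneg: "0 \<le> var_entropy M X"
  unfolding var_entropy_def by (intro sum_nonneg ent_nonneg law_nonneg law_le_1)

lemma cond_entropy_cong:
  assumes X: "simple_function M X" and X': "simple_function M X'" and Y: "simple_function M Y"
    and det: "\<And>x y. x \<in> space M \<Longrightarrow> y \<in> space M \<Longrightarrow> X x = X y \<longleftrightarrow> X' x = X' y"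
  shows "cond_entropy M X Y = cond_entropy M X' Y"
proof -
  have "var_entropy M (\<lambda>x. (X x, Y x)) = var_entropy M (\<lambda>x. (X' x, Y x))"
    using det by (intro var_entropy_cong simple_function_Pair X X' Y) auto
  then show ?thesis by (simp add: cond_entropy_def)
qed

lemma simple_function_list:
  "(\<And>X. X \<in> set Xs \<Longrightarrow> simple_function M X) \<Longrightarrow> simple_function M (\<lambda>w. map (\<lambda>X. X w) Xs)"
proof (induction Xs)
  case (Cons X Xs)
  have "simple_function M (\<lambda>w. (X w, map (\<lambda>X. X w) Xs))"
    using Cons by (auto intro: simple_function_Pair)
  from simple_function_comp[OF this, of "\<lambda>(a, l). a # l"]
  have "simple_function M (\<lambda>w. X w # map (\<lambda>X. X w) Xs)" by simp
  then show ?case by simp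
qed simp

lemma cond_entropy_list:
  fixes Xs :: "('a \<Rightarrow> 'v) list"
  assumes Xs: "\<And>X. X \<in> set Xs \<Longrightarrow> simple_function M X" and Z: "simple_function M Z"
  shows "cond_entropy M (\<lambda>w. map (\<lambda>X. X w) Xs) Z \<le> (\<Sum>X\<leftarrow>Xs. cond_entropy M X Z)"
  using Xs
proof (induction Xs)
  case Nil
  have "var_entropy M (\<lambda>w. ([] :: 'v list, Z w)) = var_entropy M Z"
    by (intro var_entropy_cong simple_function_Pair Z) auto
  then show ?case by (simp add: cond_entropy_def)
next
  case (Cons X Xs)
  let ?L = "\<lambda>w. map (\<lambda>X. X w) Xs"
  have L: "simple_function M ?L" and X: "simple_function M X"
    using Cons.prems by (auto intro: simple_function_list)
  have "cond_entropy M (\<lambda>w. map (\<lambda>X. X w) (X # Xs)) Z = cond_entropy M (\<lambda>w. (X w, ?L w)) Z"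
    using Cons.prems by (intro cond_entropy_cong simple_function_Pair simple_function_list X Z) auto
  also have "\<dots> \<le> cond_entropy M X Z + cond_entropy M ?L Z"
    by (rule cond_entropy_pair[OF X L Z])
  finally show ?case using Cons by simp
qed

lemma var_entropy_pair:
  assumes X: "simple_function M X" and Y: "simple_function M Y"
  shows "var_entropy M (\<lambda>w. (X w, Y w)) \<le> var_entropy M X + var_entropy M Y"
proof -
  have "var_entropy M (\<lambda>w. (X w, Y w)) = var_entropy M (\<lambda>w. (X w, Y w, ()))"
    "var_entropy M (\<lambda>w. (X w, ())) = var_entropy M X"
    "var_entropy M (\<lambda>w. (Y w, ())) = var_entropy M Y"
    by (intro var_entropy_cong simple_function_Pair X Y simple_function_const; simp)+
  then show ?thesis
    using strong_subadditivity[OF X Y simple_function_const[of M "()"]]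
    by (simp add: var_entropy_const)
qed

lemma var_entropy_le_cond:
  assumes X: "simple_function M X" and Y: "simple_function M Y"
  shows "var_entropy M X \<le> var_entropy M Y + cond_entropy M X Y"
  using var_entropy_mono[OF simple_function_Pair[OF X Y], of X] by (simp add: cond_entropy_def)

section \<open>Entropy under measure-preserving maps\<close>

lemma law_mp:
  assumes X: "simple_function M X" and T: "T \<in> measurable M M" and inv: "distr M M T = M"
  shows "law M (\<lambda>x. X (T x)) v = law M X v"
proof -
  have "law M X v = measure (distr M M T) (X -` {v} \<inter> space M)"
    by (simp add: law_def inv)
  also have "\<dots> = measure M (T -` (X -` {v} \<inter> space M) \<inter> space M)"
    by (rule measure_distr[OF T simple_functionD(2)[OF X]])
  also have "T -` (X -` {v} \<inter> space M) \<inter> space M = (\<lambda>x. X (T x)) -` {v} \<inter> space M"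
    using measurable_space[OF T] by auto
  finally show ?thesis by (simp add: law_def)
qed

lemma var_entropy_mp:
  assumes X: "simple_function M X" and T: "T \<in> measurable M M" and inv: "distr M M T = M"
  shows "var_entropy M (\<lambda>x. X (T x)) = var_entropy M X"
proof -
  have "finite (X ` space M)" using X by (simp add: simple_function_def)
  moreover have "(\<lambda>x. X (T x)) ` space M \<subseteq> X ` space M"
    using measurable_space[OF T] by auto
  ultimately have "var_entropy M (\<lambda>x. X (T x)) = (\<Sum>v\<in>X ` space M. ent (law M (\<lambda>x. X (T x)) v))"
    by (rule var_entropy_superset)
  also have "\<dots> = var_entropy M X"
    by (simp add: law_mp[OF assms] var_entropy_def)
  finally show ?thesis .
qed

lemma cond_entropy_mp:
  assumes "simple_function M X" "simple_function M Y" and T: "T \<in> measurable M M" and inv: "distr M M T = M"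
  shows "cond_entropy M (\<lambda>x. X (T x)) (\<lambda>x. Y (T x)) = cond_entropy M X Y"
  using var_entropy_mp[OF simple_function_Pair[OF assms(1,2)] T inv] var_entropy_mp[OF assms(2) T inv]
  by (simp add: cond_entropy_def)

end

section \<open>The full shift\<close>

definition word :: "nat \<Rightarrow> (nat \<Rightarrow> 'a) \<Rightarrow> 'a list" where
  "word n x = map x [0..<n]"

lemma length_word [simp]: "length (word n x) = n"
  by (simp add: word_def)

lemma nth_word [simp]: "i < n \<Longrightarrow> word n x ! i = x i"
  by (simp add: word_def)

lemma word_eq_iff: "word n x = I \<longleftrightarrow> length I = n \<and> (\<forall>i<n. x i = I ! i)"
  by (auto simp: list_eq_iff_nth_eq)

lemma word_eq_word_iff: "word n x = word n y \<longleftrightarrow> (\<forall>i<n. x i = y i)"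
  by (auto simp: word_eq_iff)

lemma word_Suc: "word (Suc n) x = word n x @ [x n]"
  by (simp add: word_def)

lemma word_0 [simp]: "word 0 x = []"
  by (simp add: word_def)

lemma take_word: "m \<le> n \<Longrightarrow> take m (word n x) = word m x"
  by (simp add: word_def take_map)

lemma shift_funpow: "(shift_map ^^ n) x i = x (i + n)"
  by (induction n arbitrary: i) (auto simp: shift_map_def)

lemma drop_word: "drop m (word n x) = word (n - m) ((shift_map ^^ m) x)"
  by (rule nth_equalityI) (auto simp: shift_funpow add.commute)

lemma word_add: "word (m + n) x = word m x @ word n ((shift_map ^^ m) x)"
  by (rule nth_equalityI) (auto simp: shift_funpow nth_append)

lemma map_word: "map \<pi> (word n x) = word n (block_map \<pi> x)"
  by (simp add: word_def block_map_def)

lemma cylinder_iff: "x \<in> cylinder I \<longleftrightarrow> word (length I) x = I"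
  by (auto simp: cylinder_def word_eq_iff)

lemma word_in_cylinder: "x \<in> cylinder (word n x)"
  by (simp add: cylinder_iff)

lemma cylinder_nonempty: "cylinder I \<noteq> {}"
proof -
  have "(\<lambda>i. I ! i) \<in> cylinder I" by (simp add: cylinder_def)
  then show ?thesis by blast
qed

lemma cylinder_Nil [simp]: "cylinder [] = UNIV"
  by (simp add: cylinder_def)

lemma cylinder_word_vimage: "cylinder I = word (length I) -` {I}"
  by (auto simp: cylinder_iff)

lemma cylinder_snoc: "x \<in> cylinder (I @ [a]) \<longleftrightarrow> x \<in> cylinder I \<and> x (length I) = a"
  by (auto simp: cylinder_iff word_Suc)

lemma cylinder_Cons: "x \<in> cylinder (a # I) \<longleftrightarrow> x 0 = a \<and> shift_map x \<in> cylinder I"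
  by (auto simp: cylinder_def shift_map_def nth_Cons split: nat.splits)

lemma finite_words [simp]: "finite {I :: 'a::finite list. length I = n}"
  using finite_lists_length_eq[of "UNIV :: 'a set" n] by simp

section \<open>Topology and Borel sets of the full shift\<close>

lemma open_contains_cylinder:
  fixes U :: "(nat \<Rightarrow> 'a::topological_space) set"
  assumes "open U" "x \<in> U"
  obtains n where "\<And>y. word n y = word n x \<Longrightarrow> y \<in> U"
proof -
  have "openin (product_topology (\<lambda>i. euclidean) UNIV) U"
    using assms(1) by (simp add: open_fun_def)
  from product_topology_open_contains_basis[OF this assms(2)]
  obtain X where X: "x \<in> (\<Pi>\<^sub>E i\<in>UNIV. X i)" "finite {i. X i \<noteq> UNIV}" "(\<Pi>\<^sub>E i\<in>UNIV. X i) \<subseteq> U"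
    by auto
  obtain n where n: "{i. X i \<noteq> UNIV} \<subseteq> {..<n}"
    using finite_nat_bounded[OF X(2)] by auto
  show ?thesis
  proof (rule that)
    fix y assume y: "word n y = word n x"
    have "y i \<in> X i" for i
    proof (cases "X i = UNIV")
      case False
      then have "i < n" using n by auto
      then have "y i = x i" using y by (simp add: word_eq_word_iff)
      then show ?thesis using X(1) by auto
    qed simp
    then have "y \<in> (\<Pi>\<^sub>E i\<in>UNIV. X i)" by auto
    then show "y \<in> U" using X(3) by blast
  qed
qed

lemma open_cylinder: "open (cylinder (I :: 'a::discrete_topology list))"
proof -
  have "open ((\<lambda>x :: nat \<Rightarrow> 'a. x i) -` {a})" for i a
    by (rule open_vimage[OF Topological_Spaces.open_discrete continuous_on_product_coordinates])
  moreover have "cylinder I = (\<Inter>i<length I. (\<lambda>x. x i) -` {I ! i})"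
    by (auto simp: cylinder_def)
  ultimately show ?thesis by (auto intro: open_INT)
qed

text \<open>Such a function is locally constant: the preimage of any set whatever is a union of open
  cylinders.\<close>

lemma continuous_on_word_dependent:
  fixes f :: "(nat \<Rightarrow> 'a::discrete_topology) \<Rightarrow> 'b::topological_space"
  assumes "\<And>x y. word n x = word n y \<Longrightarrow> f x = f y"
  shows "continuous_on UNIV f"
proof -
  have "open (f -` B)" for B
  proof -
    have eq: "f -` B = (\<Union>x\<in>f -` B. cylinder (word n x))"
    proof (intro equalityI subsetI)
      fix y assume "y \<in> (\<Union>x\<in>f -` B. cylinder (word n x))"
      then obtain x where "f x \<in> B" "word n y = word n x" by (auto simp: cylinder_iff)
      then show "y \<in> f -` B" using assms[of y x] by simp
    qed (auto simp: cylinder_iff)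
    show ?thesis by (subst eq) (intro open_UN ballI open_cylinder)
  qed
  then show ?thesis by (simp add: continuous_on_open_vimage)
qed

lemma continuous_on_shift_map: "continuous_on UNIV (shift_map :: (nat \<Rightarrow> 'a::topological_space) \<Rightarrow> _)"
  unfolding shift_map_def
  by (intro continuous_on_coordinatewise_then_product continuous_on_product_coordinates)

lemma continuous_on_block_map:
  "continuous_on UNIV (block_map \<pi> :: (nat \<Rightarrow> 'a::discrete_topology) \<Rightarrow> (nat \<Rightarrow> 'd::topological_space))"
  unfolding block_map_def
proof (rule continuous_on_coordinatewise_then_product)
  show "continuous_on UNIV (\<lambda>x :: nat \<Rightarrow> 'a. \<pi> (x i))" for i
    by (rule continuous_on_word_dependent[of "Suc i"]) (simp add: word_eq_word_iff)
qed

lemma compact_shift_space: "compact (UNIV :: (nat \<Rightarrow> 'a::{finite,discrete_topology}) set)"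
proof -
  have "compact (UNIV :: 'a set)" by (simp add: finite_imp_compact)
  then have "compact_space (euclidean :: 'a topology)"
    by (simp add: compact_space_def)
  then have "compact_space (product_topology (\<lambda>i::nat. euclidean :: 'a topology) UNIV)"
    by (simp add: compact_space_product_topology)
  then show ?thesis
    by (simp add: euclidean_product_topology compact_space_def)
qed

text \<open>Uniform continuity expressed by words: finitely many cylinders of small oscillation
  cover the compact space, and N is a bound for their lengths.\<close>

lemma uniformly_word_approximable:
  fixes f :: "(nat \<Rightarrow> 'a::{finite,discrete_topology}) \<Rightarrow> real"
  assumes f: "continuous_on UNIV f" and e: "e > 0"
  obtains N where "\<And>x y. word N x = word N y \<Longrightarrow> \<bar>f x - f y\<bar> < e"
proof -
  have "\<exists>n. \<forall>y. word n y = word n x \<longrightarrow> \<bar>f y - f x\<bar> < e / 2" for x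
  proof -
    have "open (f -` ball (f x) (e / 2))" by (rule open_vimage[OF open_ball f])
    then obtain n where "\<And>y. word n y = word n x \<Longrightarrow> y \<in> f -` ball (f x) (e / 2)"
      using e by (elim open_contains_cylinder[of _ x]) auto
    then have "\<forall>y. word n y = word n x \<longrightarrow> \<bar>f y - f x\<bar> < e / 2"
      by (auto simp: dist_real_def abs_minus_commute)
    then show ?thesis ..
  qed
  then obtain m where m: "\<And>x y. word (m x) y = word (m x) x \<Longrightarrow> \<bar>f y - f x\<bar> < e / 2"
    by metis
  have cover: "UNIV \<subseteq> (\<Union>x\<in>UNIV. cylinder (word (m x) x))"
    using word_in_cylinder by blast
  obtain C where C: "C \<subseteq> UNIV" "finite C" "UNIV \<subseteq> (\<Union>x\<in>C. cylinder (word (m x) x))"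
    by (rule compactE_image[OF compact_shift_space open_cylinder cover])
  obtain N where N: "\<And>z. z \<in> C \<Longrightarrow> m z \<le> N"
    using C(2) by (metis Max_ge finite_imageI imageI)
  show ?thesis
  proof (rule that)
    fix x y :: "nat \<Rightarrow> 'a" assume xy: "word N x = word N y"
    obtain z where z: "z \<in> C" "word (m z) x = word (m z) z"
      using C(3) by (auto simp: cylinder_iff subset_iff)
    have "word (m z) y = word (m z) x"
      using arg_cong[OF xy, of "take (m z)"] N[OF z(1)] by (simp add: take_word)
    then have "\<bar>f y - f z\<bar> < e / 2" "\<bar>f x - f z\<bar> < e / 2" using z m by auto
    then show "\<bar>f x - f y\<bar> < e" by linarith
  qed
qed

text \<open>There are only countably many words, so every open set is a countable union of
  cylinders.\<close>

lemma borel_eq_sigma_cylinders: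
  "(borel :: (nat \<Rightarrow> 'a::{finite,discrete_topology}) measure) = sigma UNIV (range cylinder)"
proof (rule borel_eq_sigmaI1[OF borel_def])
  fix U :: "(nat \<Rightarrow> 'a) set" assume "U \<in> {S. open S}"
  then have U: "open U" by simp
  have "U = (\<Union>I\<in>{I. cylinder I \<subseteq> U}. cylinder I)"
  proof (intro equalityI subsetI)
    fix x assume "x \<in> U"
    then obtain n where "\<And>y. word n y = word n x \<Longrightarrow> y \<in> U"
      using open_contains_cylinder[OF U] by metis
    then have "cylinder (word n x) \<subseteq> U" by (auto simp: cylinder_iff)
    then show "x \<in> (\<Union>I\<in>{I. cylinder I \<subseteq> U}. cylinder I)"
      using word_in_cylinder by blast
  qed auto
  moreover have "(\<Union>I\<in>{I. cylinder I \<subseteq> U}. cylinder I) \<in> sets (sigma UNIV (range cylinder))"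
    by (intro sets.countable_UN') auto
  ultimately show "U \<in> sets (sigma UNIV (range cylinder))" by simp
qed (auto intro: borel_open open_cylinder)

lemma sigma_sets_cylinders:
  "sets (borel :: (nat \<Rightarrow> 'a::{finite,discrete_topology}) measure) = sigma_sets UNIV (range cylinder)"
  by (subst borel_eq_sigma_cylinders) simp

lemma cylinder_borel [measurable]:
  "cylinder (I :: 'a::{finite,discrete_topology} list) \<in> sets borel"
  by (intro borel_open open_cylinder)

lemma cylinder_Int:
  "cylinder I \<inter> cylinder J \<in> insert {} (range cylinder)"
proof -
  have *: "cylinder I \<inter> cylinder J \<in> insert {} (range cylinder)" if "length I \<le> length J" for I J :: "'a list"
  proof (cases "take (length I) J = I")
    case True
    then have "cylinder J \<subseteq> cylinder I"
      using that by (auto simp: cylinder_iff) (metis take_word)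
    then have "cylinder I \<inter> cylinder J = cylinder J" by auto
    then show ?thesis by auto
  next
    case False
    then have "cylinder I \<inter> cylinder J = {}"
      using that by (auto simp: cylinder_iff) (metis take_word)
    then show ?thesis by auto
  qed
  show ?thesis
    using *[of I J] *[of J I] by (cases "length I \<le> length J") (auto simp: Int_commute)
qed

section \<open>Probability measures on the full shift\<close>

locale shift_measure = prob_space M
  for M :: "(nat \<Rightarrow> 'a::{finite,discrete_topology}) measure" +
  assumes sets_M: "sets M = sets borel"
begin

lemma space_M [simp]: "space M = UNIV"
  using sets_eq_imp_space_eq[OF sets_M] by simp

lemma cylinder_sets [measurable, simp]: "cylinder I \<in> sets M"
  by (simp add: sets_M)

lemma simple_function_word: "simple_function M (word n)"
  unfolding simple_function_def
proof safe
  show "finite (word n ` space M)"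
    by (rule finite_subset[OF _ finite_words[of n]]) auto
next
  fix x :: "nat \<Rightarrow> 'a"
  have "word n -` {word n x} = cylinder (word n x)" by (auto simp: cylinder_iff)
  then show "word n -` {word n x} \<inter> space M \<in> sets M" by simp
qed

lemma simple_function_word_comp: "simple_function M (\<lambda>x. f (word n x))"
  by (rule simple_function_comp[OF simple_function_word])

lemma law_word: "length I = n \<Longrightarrow> law M (word n) I = measure M (cylinder I)"
  by (auto simp: law_def cylinder_word_vimage)

lemma var_entropy_word:
  "var_entropy M (word n) = (\<Sum>I | length I = n. ent (measure M (cylinder I)))"
proof -
  have "var_entropy M (word n) = (\<Sum>I | length I = n. ent (law M (word n) I))"
    by (intro var_entropy_superset) auto
  then show ?thesis by (simp add: law_word)
qed

lemma
  fixes g :: "'a list \<Rightarrow> real"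
  shows integral_word: "(\<integral>x. g (word n x) \<partial>M) = (\<Sum>I | length I = n. measure M (cylinder I) * g I)"
    and integrable_word: "integrable M (\<lambda>x. g (word n x))"
proof -
  have eq: "g (word n x) = (\<Sum>I | length I = n. indicator (cylinder I) x * g I)" for x
  proof -
    have "(\<Sum>I | length I = n. indicator (cylinder I) x * g I) =
          (\<Sum>I | length I = n. if I = word n x then g I else 0)"
      by (intro sum.cong) (auto simp: cylinder_iff indicator_def)
    then show ?thesis by simp
  qed
  show "(\<integral>x. g (word n x) \<partial>M) = (\<Sum>I | length I = n. measure M (cylinder I) * g I)"
    unfolding eq by (subst Bochner_Integration.integral_sum) (auto intro!: integrable_real_mult_indicator simp: less_top[symmetric])
  show "integrable M (\<lambda>x. g (word n x))"
    unfolding eq by (intro Bochner_Integration.integrable_sum) (auto simp: less_top[symmetric])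
qed

lemma measure_cylinder_snoc:
  "(\<Sum>a\<in>UNIV. measure M (cylinder (I @ [a]))) = measure M (cylinder I)"
proof -
  have "cylinder I = (\<Union>a\<in>UNIV. cylinder (I @ [a]))"
    by (auto simp: cylinder_snoc)
  moreover have "disjoint_family_on (\<lambda>a. cylinder (I @ [a])) UNIV"
    by (auto simp: disjoint_family_on_def cylinder_snoc)
  then have "measure M (\<Union>a\<in>UNIV. cylinder (I @ [a])) = (\<Sum>a\<in>UNIV. measure M (cylinder (I @ [a])))"
    by (intro finite_measure_finite_Union) auto
  ultimately show ?thesis by (simp only:)
qed

lemma sum_measure_cylinder: "(\<Sum>I | length I = n. measure M (cylinder I)) = 1"
  using integral_word[of "\<lambda>_. 1" n] prob_space by simp

lemma measure_shift_vimage_cylinder: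
  "measure M (shift_map -` cylinder I) = (\<Sum>a\<in>UNIV. measure M (cylinder (a # I)))"
proof -
  have "shift_map -` cylinder I = (\<Union>a\<in>UNIV. cylinder (a # I))"
    by (auto simp: cylinder_Cons)
  moreover have "disjoint_family_on (\<lambda>a. cylinder (a # I)) UNIV"
    by (auto simp: disjoint_family_on_def cylinder_Cons)
  then have "measure M (\<Union>a\<in>UNIV. cylinder (a # I)) = (\<Sum>a\<in>UNIV. measure M (cylinder (a # I)))"
    by (intro finite_measure_finite_Union) auto
  ultimately show ?thesis by (simp only:)
qed

lemma measurable_continuous: "continuous_on UNIV f \<Longrightarrow> f \<in> borel_measurable M"
  using borel_measurable_continuous_onI measurable_cong_sets[OF sets_M refl] by blast

lemma measurable_shift [measurable]: "shift_map \<in> measurable M M"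
  using measurable_continuous[OF continuous_on_shift_map] measurable_cong_sets[OF refl sets_M] by blast

lemma shift_measure_factor:
  "shift_measure (distr M borel (block_map \<pi> :: _ \<Rightarrow> nat \<Rightarrow> 'd::{finite,discrete_topology}))"
  unfolding shift_measure_def shift_measure_axioms_def
  by (auto intro!: prob_space_distr measurable_continuous continuous_on_block_map)

lemma measure_factor:
  fixes \<pi> :: "'a \<Rightarrow> 'd::{finite,discrete_topology}"
  assumes "A \<in> sets borel"
  shows "measure (distr M borel (block_map \<pi>)) A = measure M (block_map \<pi> -` A)"
  using assms by (subst measure_distr) (auto intro!: measurable_continuous continuous_on_block_map)

lemma measure_factor_cylinder:
  fixes \<pi> :: "'a \<Rightarrow> 'd::{finite,discrete_topology}"
  shows "measure (distr M borel (block_map \<pi>)) (cylinder J) =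
    (\<Sum>I | length I = length J \<and> map \<pi> I = J. measure M (cylinder I))"
proof -
  have "block_map \<pi> -` cylinder J = (\<Union>I\<in>{I. length I = length J \<and> map \<pi> I = J}. cylinder I)"
  proof (intro equalityI subsetI)
    fix x assume "x \<in> block_map \<pi> -` cylinder J"
    then have "map \<pi> (word (length J) x) = J" by (simp add: cylinder_iff map_word)
    then show "x \<in> (\<Union>I\<in>{I. length I = length J \<and> map \<pi> I = J}. cylinder I)"
      by (auto simp: cylinder_iff)
  next
    fix x assume "x \<in> (\<Union>I\<in>{I. length I = length J \<and> map \<pi> I = J}. cylinder I)"
    then obtain I where "map \<pi> I = J" "x \<in> cylinder I" by blast
    then show "x \<in> block_map \<pi> -` cylinder J"
      by (auto simp: cylinder_iff map_word[symmetric])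
  qed
  moreover have "disjoint_family_on cylinder {I. length I = length J \<and> map \<pi> I = J}"
    by (auto simp: disjoint_family_on_def cylinder_iff)
  moreover have "finite {I. length I = length J \<and> map \<pi> I = J}"
    by (rule finite_subset[OF _ finite_words[of "length J"]]) auto
  ultimately show ?thesis
    using finite_measure_finite_Union[of "{I. length I = length J \<and> map \<pi> I = J}" cylinder]
    by (simp add: measure_factor image_subset_iff)
qed

end

section \<open>Uniqueness, invariance and weak-star convergence in terms of cylinders\<close>

lemma measure_eqI_cylinders:
  assumes "shift_measure M" "shift_measure N"
    and eq: "\<And>I. measure M (cylinder I) = measure N (cylinder I)"
  shows "M = N"
proof -
  interpret M: shift_measure M by fact
  interpret N: shift_measure N by fact
  show ?thesis
  \<comment> \<open>Two cylinders are nested or disjoint, so adding the empty set makes them an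
    intersection-stable generator; the whole space is the cylinder of the empty word.\<close>
  proof (rule measure_eqI_generator_eq[where E = "insert {} (range cylinder)" and \<Omega> = UNIV and A = "\<lambda>_. UNIV"])
    show "Int_stable (insert {} (range (cylinder :: 'a list \<Rightarrow> _)))"
      using cylinder_Int by (auto simp: Int_stable_def)
    show "emeasure M X = emeasure N X" if "X \<in> insert {} (range cylinder)" for X
      using that eq by (auto simp: M.emeasure_eq_measure N.emeasure_eq_measure)
    have "sigma_sets UNIV (insert {} (range (cylinder :: 'a list \<Rightarrow> _))) = sigma_sets UNIV (range cylinder)"
      by (intro sigma_sets_eqI) (auto intro: sigma_sets.intros)
    then show "sets M = sigma_sets UNIV (insert {} (range cylinder))"
      "sets N = sigma_sets UNIV (insert {} (range cylinder))"
      by (simp_all add: M.sets_M N.sets_M sigma_sets_cylinders)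
    show "range (\<lambda>_. UNIV) \<subseteq> insert {} (range (cylinder :: 'a list \<Rightarrow> _))"
      using rangeI[of cylinder "[] :: 'a list"] by auto
  qed auto
qed

locale invariant_shift_measure = shift_measure +
  assumes distr_shift: "distr M M shift_map = M"
begin

lemma
  shows measurable_shift_funpow: "shift_map ^^ n \<in> measurable M M"
    and distr_shift_funpow: "distr M M (shift_map ^^ n) = M"
proof (induction n)
  case (Suc n)
  {
    case 1
    show ?case using Suc(1) measurable_shift by (auto intro: measurable_comp)
  next
    case 2
    have "distr M M (shift_map ^^ Suc n) = distr (distr M M (shift_map ^^ n)) M shift_map"
      by (subst distr_distr[OF measurable_shift Suc(1)]) simp
    then show ?case using Suc(2) distr_shift by (simp only:)
  }
qed (simp_all add: id_def)

lemma integral_word_shift: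
  fixes g :: "'a list \<Rightarrow> real"
  shows "(\<integral>x. g (word n ((shift_map ^^ m) x)) \<partial>M) = (\<integral>x. g (word n x) \<partial>M)"
proof -
  have "(\<integral>x. g (word n x) \<partial>M) = (\<integral>x. g (word n x) \<partial>distr M M (shift_map ^^ m))"
    by (simp add: distr_shift_funpow)
  also have "\<dots> = (\<integral>x. g (word n ((shift_map ^^ m) x)) \<partial>M)"
    by (rule integral_distr[OF measurable_shift_funpow borel_measurable_integrable[OF integrable_word]])
  finally show ?thesis by simp
qed

lemma integrable_word_shift:
  fixes g :: "'a list \<Rightarrow> real"
  shows "integrable M (\<lambda>x. g (word n ((shift_map ^^ m) x)))"
  by (rule integrable_distr[OF measurable_shift_funpow]) (simp add: distr_shift_funpow integrable_word)

end

lemma invariant_shift_measure_iff: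
  "invariant_shift_measure M \<longleftrightarrow> M \<in> invariant_measures shift_map"
proof
  assume "invariant_shift_measure M"
  then interpret invariant_shift_measure M .
  have "distr M borel shift_map = distr M M shift_map"
    by (intro distr_cong) (simp_all add: sets_M)
  then show "M \<in> invariant_measures shift_map"
    using prob_space_axioms sets_M distr_shift measurable_continuous[OF continuous_on_shift_map]
    by (simp add: invariant_measures_def)
next
  assume M: "M \<in> invariant_measures shift_map"
  then interpret shift_measure M
    by (simp add: invariant_measures_def shift_measure_def shift_measure_axioms_def)
  have "distr M borel shift_map = distr M M shift_map"
    by (intro distr_cong) (simp_all add: sets_M)
  then show "invariant_shift_measure M"
    using M by unfold_locales (simp add: invariant_measures_def)
qed

text \<open>The sum over prepended letters is the mass of the shift preimage of the cylinder, and
  agreement on cylinders identifies the image measure.\<close>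

lemma invariant_shift_measureI:
  assumes "shift_measure M"
    and inv: "\<And>I. (\<Sum>a\<in>UNIV. measure M (cylinder (a # I))) = measure M (cylinder I)"
  shows "invariant_shift_measure M"
proof -
  interpret shift_measure M by fact
  have "distr M M shift_map = M"
  proof (rule measure_eqI_cylinders)
    show "shift_measure (distr M M shift_map)"
      by (auto simp: shift_measure_def shift_measure_axioms_def sets_M intro: prob_space_distr)
    fix I :: "'a list"
    have "measure (distr M M shift_map) (cylinder I) = measure M (shift_map -` cylinder I)"
      by (subst measure_distr) auto
    then show "measure (distr M M shift_map) (cylinder I) = measure M (cylinder I)"
      by (simp add: measure_shift_vimage_cylinder inv)
  qed fact
  then show ?thesis by unfold_locales
qed

lemma (in invariant_shift_measure) measure_cylinder_Cons:
  "(\<Sum>a\<in>UNIV. measure M (cylinder (a # I))) = measure M (cylinder I)"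
proof -
  have "measure M (cylinder I) = measure (distr M M shift_map) (cylinder I)"
    by (simp add: distr_shift)
  also have "\<dots> = measure M (shift_map -` cylinder I)"
    by (subst measure_distr) auto
  finally show ?thesis by (simp add: measure_shift_vimage_cylinder)
qed

lemma (in invariant_shift_measure) invariant_factor:
  "invariant_shift_measure (distr M borel (block_map \<pi> :: _ \<Rightarrow> nat \<Rightarrow> 'd::{finite,discrete_topology}))"
proof -
  let ?\<pi> = "block_map \<pi> :: _ \<Rightarrow> nat \<Rightarrow> 'd" and ?N = "distr M borel (block_map \<pi> :: _ \<Rightarrow> nat \<Rightarrow> 'd)"
  interpret N: shift_measure ?N by (rule shift_measure_factor)
  have \<pi>: "?\<pi> \<in> borel_measurable M"
    by (intro measurable_continuous continuous_on_block_map)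
  have s: "shift_map \<in> borel_measurable (borel :: (nat \<Rightarrow> 'd) measure)"
    using continuous_on_shift_map by (rule borel_measurable_continuous_onI)
  have "distr ?N ?N shift_map = distr ?N borel shift_map"
    by (intro distr_cong) simp_all
  also have "\<dots> = distr M borel (shift_map \<circ> ?\<pi>)"
    by (rule distr_distr[OF s \<pi>])
  also have "shift_map \<circ> ?\<pi> = ?\<pi> \<circ> shift_map"
    by (auto simp: block_map_def shift_map_def)
  also have "distr M borel (?\<pi> \<circ> shift_map) = distr (distr M M shift_map) borel ?\<pi>"
    by (rule distr_distr[OF \<pi> measurable_shift, symmetric])
  finally show ?thesis by unfold_locales (simp add: distr_shift)
qed

text \<open>A continuous function is uniformly close to a function of a word of fixed length, whose
  integral is a finite linear combination of cylinder weights.\<close>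

lemma weak_star_tendsto_cylinders:
  assumes \<mu>: "\<And>n. shift_measure (\<mu> n)" and \<eta>: "shift_measure \<eta>"
    and lim: "\<And>I. (\<lambda>n. measure (\<mu> n) (cylinder I)) \<longlonglongrightarrow> measure \<eta> (cylinder I)"
  shows "weak_star_tendsto \<mu> \<eta>"
  unfolding weak_star_tendsto_def
proof (intro allI impI)
  fix f :: "(nat \<Rightarrow> 'a) \<Rightarrow> real" assume f: "continuous_on UNIV f"
  have "bounded (range f)"
    using compact_continuous_image[OF f compact_shift_space] by (rule compact_imp_bounded)
  then obtain B where B: "\<And>x. norm (f x) \<le> B" by (auto simp: bounded_iff)
  have approx: "\<bar>(\<integral>x. f x \<partial>M) - (\<integral>x. g (word N x) \<partial>M)\<bar> \<le> e"
    if "shift_measure M" "\<And>x. \<bar>f x - g (word N x)\<bar> \<le> e" for M g N e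
  proof -
    interpret shift_measure M by fact
    have int: "integrable M f"
      using measurable_continuous[OF f] B by (intro integrable_const_bound[of _ B]) auto
    have "(\<integral>x. f x \<partial>M) - (\<integral>x. g (word N x) \<partial>M) = (\<integral>x. f x - g (word N x) \<partial>M)"
      by (rule Bochner_Integration.integral_diff[symmetric, OF int integrable_word])
    also have "\<bar>\<dots>\<bar> \<le> (\<integral>x. \<bar>f x - g (word N x)\<bar> \<partial>M)"
      by (rule integral_abs_bound)
    also have "\<dots> \<le> (\<integral>x. e \<partial>M)"
      using that(2) by (intro integral_mono integrable_abs Bochner_Integration.integrable_diff int integrable_word) auto
    finally show ?thesis using prob_space by simp
  qed
  show "(\<lambda>n. integral\<^sup>L (\<mu> n) f) \<longlonglongrightarrow> integral\<^sup>L \<eta> f"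
  proof (rule LIMSEQ_I)
    fix r :: real assume r: "r > 0"
    obtain N where N: "\<And>x y. word N x = word N y \<Longrightarrow> \<bar>f x - f y\<bar> < r / 3"
      using uniformly_word_approximable[OF f, of "r / 3"] r by auto
    \<comment> \<open>The word is continued by an arbitrary fixed letter; any continuation would do,
      because f varies by less than \<open>r / 3\<close> on a cylinder of length N.\<close>
    define g where "g I = f (\<lambda>i. if i < N then I ! i else undefined)" for I
    have "word N x = word N (\<lambda>i. if i < N then word N x ! i else undefined)" for x :: "nat \<Rightarrow> 'a"
      by (auto simp: word_eq_word_iff)
    then have g: "\<bar>f x - g (word N x)\<bar> \<le> r / 3" for x
      unfolding g_def using N less_imp_le by blast
    have "(\<lambda>n. \<integral>x. g (word N x) \<partial>\<mu> n) \<longlonglongrightarrow> (\<integral>x. g (word N x) \<partial>\<eta>)"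
      unfolding shift_measure.integral_word[OF \<mu>] shift_measure.integral_word[OF \<eta>]
      by (intro tendsto_intros lim)
    then obtain n0 where n0: "\<And>n. n \<ge> n0 \<Longrightarrow> norm ((\<integral>x. g (word N x) \<partial>\<mu> n) - (\<integral>x. g (word N x) \<partial>\<eta>)) < r / 3"
      using LIMSEQ_D[of _ _ "r / 3"] r by (metis divide_pos_pos zero_less_numeral)
    show "\<exists>n0. \<forall>n\<ge>n0. norm (integral\<^sup>L (\<mu> n) f - integral\<^sup>L \<eta> f) < r"
    proof (intro exI allI impI)
      fix n assume "n \<ge> n0"
      from n0[OF this] approx[OF \<mu>[of n] g] approx[OF \<eta> g]
      show "norm (integral\<^sup>L (\<mu> n) f - integral\<^sup>L \<eta> f) < r"
        unfolding real_norm_def by argo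
    qed
  qed
qed

section \<open>Entropy rate and the generator theorem\<close>

definition block_entropy :: "(nat \<Rightarrow> 'a) measure \<Rightarrow> nat \<Rightarrow> real" where
  "block_entropy M n = var_entropy M (word n)"

definition entropy_rate :: "(nat \<Rightarrow> 'a) measure \<Rightarrow> real" where
  "entropy_rate M = lim (\<lambda>n. block_entropy M n / real n)"

text \<open>Random-variable counterpart of \<open>dynamical_refinement\<close>: for X naming the
  atoms of a partition, the level sets of the itinerary are the atoms of the refinement.\<close>

definition itinerary :: "((nat \<Rightarrow> 'a) \<Rightarrow> 'v) \<Rightarrow> nat \<Rightarrow> (nat \<Rightarrow> 'a) \<Rightarrow> 'v list" where
  "itinerary X n x = map (\<lambda>i. X ((shift_map ^^ i) x)) [0..<n]"

lemma word_eq_itinerary: "word n = itinerary (\<lambda>x. x 0) n"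
  by (auto simp: itinerary_def word_def shift_funpow)

lemma itinerary_eq_iff:
  "itinerary X n x = itinerary X n y \<longleftrightarrow> (\<forall>i<n. X ((shift_map ^^ i) x) = X ((shift_map ^^ i) y))"
  by (auto simp: itinerary_def)

lemma itinerary_add: "itinerary X (m + n) x = itinerary X m x @ itinerary X n ((shift_map ^^ m) x)"
  by (rule nth_equalityI) (auto simp: itinerary_def nth_append funpow_add[symmetric]
      simp flip: comp_apply[of "shift_map ^^ _" "shift_map ^^ _"])

section \<open>From dynamical partitions to itineraries\<close>

lemma partition_entropy_eq_var_entropy:
  assumes P: "partition_on (space M) P"
    and V: "\<And>x y. x \<in> space M \<Longrightarrow> y \<in> space M \<Longrightarrow> V x = V y \<longleftrightarrow> (\<exists>B\<in>P. x \<in> B \<and> y \<in> B)"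
  shows "partition_entropy M P = var_entropy M V"
proof -
  have disj: "B = C" if "B \<in> P" "C \<in> P" "x \<in> B" "x \<in> C" for B C x
    using P that by (auto simp: partition_on_def disjoint_def)
  have sub: "B \<subseteq> space M" "B \<noteq> {}" if "B \<in> P" for B
    using P that by (auto simp: partition_on_def)
  have fibre: "V -` {V x} \<inter> space M = B" if "B \<in> P" "x \<in> B" for x B
    using that V disj sub by blast
  \<comment> \<open>Values of V correspond to atoms of P by taking level sets, so the two entropy
    sums agree after reindexing.\<close>
  have bij: "bij_betw (\<lambda>v. V -` {v} \<inter> space M) (V ` space M) P"
  proof (rule bij_betw_imageI)
    show "inj_on (\<lambda>v. V -` {v} \<inter> space M) (V ` space M)"
      by (rule inj_onI) blast
    show "(\<lambda>v. V -` {v} \<inter> space M) ` V ` space M = P"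
    proof (intro equalityI subsetI)
      fix B assume "B \<in> (\<lambda>v. V -` {v} \<inter> space M) ` V ` space M"
      then obtain x where x: "x \<in> space M" "B = V -` {V x} \<inter> space M" by auto
      then obtain C where "C \<in> P" "x \<in> C" using P by (auto simp: partition_on_def)
      then show "B \<in> P" using fibre x by simp
    next
      fix B assume B: "B \<in> P"
      then obtain x where x: "x \<in> B" using sub(2) by blast
      then have "x \<in> space M" "B = V -` {V x} \<inter> space M" using fibre[OF B x] sub(1)[OF B] by auto
      then show "B \<in> (\<lambda>v. V -` {v} \<inter> space M) ` V ` space M" by blast
    qed
  qed
  show ?thesis
    unfolding partition_entropy_def var_entropy_def law_def ent_def
      sum.reindex_bij_betw[OF bij, symmetric] by (simp add: sum_negf)
qed

lemma partition_on_pullback: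
  assumes "partition_on UNIV \<xi>" "space M = UNIV"
  shows "partition_on UNIV (pullback_partition M T \<xi>)"
proof (rule partition_onI)
  fix P Q assume "P \<in> pullback_partition M T \<xi>" "Q \<in> pullback_partition M T \<xi>" "P \<noteq> Q"
  then obtain A B where AB: "A \<in> \<xi>" "B \<in> \<xi>" "P = T -` A" "Q = T -` B"
    using assms(2) by (auto simp: pullback_partition_def)
  moreover have "A \<noteq> B" using AB \<open>P \<noteq> Q\<close> by auto
  ultimately show "disjnt P Q"
    using assms(1) by (auto simp: partition_on_def disjoint_def disjnt_def)
next
  have "x \<in> \<Union> (pullback_partition M T \<xi>)" for x
  proof -
    obtain A where "A \<in> \<xi>" "T x \<in> A" using assms(1) by (auto simp: partition_on_def)
    then have "T -` A \<in> pullback_partition M T \<xi>"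
      using assms(2) by (auto simp: pullback_partition_def)
    then show ?thesis using \<open>T x \<in> A\<close> by blast
  qed
  then show "\<Union> (pullback_partition M T \<xi>) = UNIV" by blast
qed (auto simp: pullback_partition_def)

text \<open>The second claim translates the choice functions of \<open>common_refinement\<close>
  into a statement on orbits, which for a suitable variable says that the itineraries of x and y
  coincide.\<close>

lemma dynamical_refinement_properties:
  assumes \<xi>: "partition_on UNIV \<xi>" and sp: "space M = UNIV" and n: "n \<ge> 1"
  shows "partition_on UNIV (dynamical_refinement M T \<xi> n)"
    and "(\<exists>B\<in>dynamical_refinement M T \<xi> n. x \<in> B \<and> y \<in> B) \<longleftrightarrow>
      (\<forall>i<n. \<exists>A\<in>\<xi>. (T ^^ i) x \<in> A \<and> (T ^^ i) y \<in> A)"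
proof -
  let ?P = "(\<lambda>i. pullback_partition M (T ^^ i) \<xi>) ` {..<n}"
  show D: "partition_on UNIV (dynamical_refinement M T \<xi> n)"
    unfolding dynamical_refinement_def using n partition_on_pullback[OF \<xi> sp]
    by (intro partition_on_common_refinement) (auto simp: lessThan_empty_iff)
  show "(\<exists>B\<in>dynamical_refinement M T \<xi> n. x \<in> B \<and> y \<in> B) \<longleftrightarrow>
      (\<forall>i<n. \<exists>A\<in>\<xi>. (T ^^ i) x \<in> A \<and> (T ^^ i) y \<in> A)" (is "?L \<longleftrightarrow> ?R")
  proof
    assume ?L
    then obtain B where B: "B \<in> common_refinement ?P" "x \<in> B" "y \<in> B"
      by (auto simp: dynamical_refinement_def)
    show ?R
    proof (intro allI impI)
      fix i assume "i < n"
      then have "pullback_partition M (T ^^ i) \<xi> \<in> ?P" by auto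
      from common_refinement_exists[OF B(1) this] obtain R where
        R: "R \<in> pullback_partition M (T ^^ i) \<xi>" "B \<subseteq> R" by auto
      then obtain A where "A \<in> \<xi>" "R = (T ^^ i) -` A"
        using sp by (auto simp: pullback_partition_def)
      then show "\<exists>A\<in>\<xi>. (T ^^ i) x \<in> A \<and> (T ^^ i) y \<in> A"
        using R B by auto
    qed
  next
    assume R: ?R
    obtain B where B: "B \<in> dynamical_refinement M T \<xi> n" "x \<in> B"
      using D by (auto simp: partition_on_def)
    then obtain f where f: "f \<in> (\<Pi> P\<in>?P. P)" "B = \<Inter> (f ` ?P)"
      by (auto simp: dynamical_refinement_def common_refinement)
    have "y \<in> f (pullback_partition M (T ^^ i) \<xi>)" if i: "i < n" for i
    proof -
      have fi: "f (pullback_partition M (T ^^ i) \<xi>) \<in> pullback_partition M (T ^^ i) \<xi>"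
        "x \<in> f (pullback_partition M (T ^^ i) \<xi>)"
        using f B i by auto
      then obtain A where A: "A \<in> \<xi>" "f (pullback_partition M (T ^^ i) \<xi>) = (T ^^ i) -` A"
        using sp by (auto simp: pullback_partition_def)
      obtain A' where A': "A' \<in> \<xi>" "(T ^^ i) x \<in> A'" "(T ^^ i) y \<in> A'"
        using R i by blast
      have "A = A'"
        using A A' fi(2) \<xi> by (metis IntI disjointD emptyE partition_on_def vimageD)
      then show ?thesis using A A' by simp
    qed
    then have "y \<in> B" using f by auto
    with B show ?L by blast
  qed
qed

context shift_measure
begin

lemma simple_function_indicator: "A \<in> sets M \<Longrightarrow> simple_function M (\<lambda>x. x \<in> A)"
proof -
  assume A: "A \<in> sets M"
  have "(\<lambda>x. x \<in> A) -` {b} \<inter> space M = (if b then A else space M - A)" for b by auto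
  then have "(\<lambda>x. x \<in> A) -` {b} \<inter> space M \<in> sets M" for b
    using A sets.compl_sets[OF A] by simp
  then show ?thesis unfolding simple_function_def by simp
qed

lemma law_indicator: "law M (\<lambda>x. (x \<in> A, x \<in> B)) (p, q) =
    measure M ((if p then A else - A) \<inter> (if q then B else - B))"
proof -
  have "(\<lambda>x. (x \<in> A, x \<in> B)) -` {(p, q)} \<inter> space M = (if p then A else - A) \<inter> (if q then B else - B)"
    by auto
  then show ?thesis by (simp add: law_def)
qed

lemma law_indicator1: "law M (\<lambda>x. x \<in> B) q = measure M (if q then B else - B)"
proof -
  have "(\<lambda>x. x \<in> B) -` {q} \<inter> space M = (if q then B else - B)"
    by auto
  then show ?thesis by (simp add: law_def)
qed

section \<open>Approximation of measurable sets by sets of finitely many coordinates\<close>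

definition word_approximable :: "(nat \<Rightarrow> 'a) set \<Rightarrow> bool" where
  "word_approximable A \<longleftrightarrow> A \<in> sets M \<and>
     (\<forall>\<delta>>0. \<exists>k W. measure M ((A - word k -` W) \<union> (word k -` W - A)) < \<delta>)"

lemma word_vimage_sets [simp]: "word k -` W \<in> sets M"
proof -
  have "word k -` W = (\<Union>I\<in>W \<inter> {I. length I = k}. cylinder I)"
    by (auto simp: cylinder_iff)
  moreover have "\<dots> \<in> sets M" by (intro sets.countable_UN') auto
  ultimately show ?thesis by simp
qed

lemma word_vimage_extend: "k \<le> l \<Longrightarrow> word k -` W = word l -` {I. take k I \<in> W}"
  by (auto simp: take_word)

text \<open>Both approximating sets can be described by words of the larger length, and the
  symmetric difference of the unions lies in the union of the symmetric differences.\<close>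

lemma word_approximable_Un:
  assumes A: "word_approximable A" and B: "word_approximable B"
  shows "word_approximable (A \<union> B)"
  unfolding word_approximable_def
proof (intro conjI allI impI)
  show AB: "A \<union> B \<in> sets M" using A B by (auto simp: word_approximable_def)
  have sets: "A \<in> sets M" "B \<in> sets M" using A B by (auto simp: word_approximable_def)
  fix \<delta> :: real assume "\<delta> > 0"
  then have d: "\<delta> / 2 > 0" by simp
  obtain k V where V: "measure M ((A - word k -` V) \<union> (word k -` V - A)) < \<delta> / 2"
    using A d unfolding word_approximable_def by blast
  obtain l W where W: "measure M ((B - word l -` W) \<union> (word l -` W - B)) < \<delta> / 2"
    using B d unfolding word_approximable_def by blast
  let ?m = "max k l" and ?V = "word k -` V" and ?W = "word l -` W"
  let ?U = "{I. take k I \<in> V} \<union> {I. take l I \<in> W}"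
  have U: "word ?m -` ?U = ?V \<union> ?W"
    using word_vimage_extend[of k ?m V] word_vimage_extend[of l ?m W] by auto
  have "measure M ((A \<union> B - word ?m -` ?U) \<union> (word ?m -` ?U - (A \<union> B)))
     \<le> measure M (((A - ?V) \<union> (?V - A)) \<union> ((B - ?W) \<union> (?W - B)))"
    unfolding U using sets by (intro finite_measure_mono sets.Un sets.Diff) auto
  also have "\<dots> \<le> measure M ((A - ?V) \<union> (?V - A)) + measure M ((B - ?W) \<union> (?W - B))"
    using sets by (intro measure_subadditive sets.Un sets.Diff) auto
  also have "\<dots> < \<delta>" using V W by simp
  finally show "\<exists>k W. measure M ((A \<union> B - word k -` W) \<union> (word k -` W - (A \<union> B))) < \<delta>"
    by blast
qed

lemma word_approximable_cylinder: "word_approximable (cylinder I)"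
  unfolding word_approximable_def
proof (intro conjI allI impI)
  fix \<delta> :: real assume "\<delta> > 0"
  then have "measure M ((cylinder I - word (length I) -` {I}) \<union> (word (length I) -` {I} - cylinder I)) < \<delta>"
    by (simp add: cylinder_word_vimage)
  then show "\<exists>k W. measure M ((cylinder I - word k -` W) \<union> (word k -` W - cylinder I)) < \<delta>" by blast
qed simp

text \<open>Induction over the generated sigma-algebra. Complements are approximated by complements;
  a countable union is first truncated to a finite one by continuity from below, each of the two
  errors taking half of \<delta>.\<close>

lemma word_approximable_sets:
  assumes "A \<in> sets M"
  shows "word_approximable A"
proof -
  have "A \<in> sigma_sets UNIV (range cylinder)"
    using assms by (simp add: sets_M sigma_sets_cylinders)
  then show ?thesis
  proof induction
    case (Basic A)
    then show ?case by (auto simp: word_approximable_cylinder)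
  next
    case Empty
    show ?case
      unfolding word_approximable_def by (auto intro!: exI[of _ 0] exI[of _ "{}"])
  next
    case (Compl A)
    show ?case
      unfolding word_approximable_def
    proof (intro conjI allI impI)
      show "UNIV - A \<in> sets M"
        using Compl.IH sets.compl_sets[of A M] by (simp add: word_approximable_def)
      fix \<delta> :: real assume "\<delta> > 0"
      then obtain k W where "measure M ((A - word k -` W) \<union> (word k -` W - A)) < \<delta>"
        using Compl.IH unfolding word_approximable_def by blast
      moreover have "((UNIV - A) - word k -` (- W)) \<union> (word k -` (- W) - (UNIV - A))
          = (A - word k -` W) \<union> (word k -` W - A)" by auto
      ultimately show "\<exists>k W. measure M ((UNIV - A - word k -` W) \<union> (word k -` W - (UNIV - A))) < \<delta>"
        by metis
    qed
  next
    case (Union A)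
    let ?U = "\<lambda>n. \<Union>i<n. A i"
    have A: "A i \<in> sets M" for i using Union.IH by (auto simp: word_approximable_def)
    have U: "word_approximable (?U n)" for n
    proof (induction n)
      case 0
      show ?case
        unfolding word_approximable_def by (auto intro!: exI[of _ 0] exI[of _ "{}"])
    next
      case (Suc n)
      have "?U (Suc n) = ?U n \<union> A n" by (auto simp: less_Suc_eq)
      then show ?case using word_approximable_Un[OF Suc Union.IH[of n]] by simp
    qed
    have UA: "(\<Union>n. ?U n) = (\<Union>i. A i)" by auto
    have Us: "?U n \<in> sets M" for n using A by auto
    have "(\<lambda>n. measure M (?U n)) \<longlonglongrightarrow> measure M (\<Union>n. ?U n)"
      using Us by (intro finite_Lim_measure_incseq) (auto simp: incseq_def intro: less_le_trans)
    then have conv: "(\<lambda>n. measure M (?U n)) \<longlonglongrightarrow> measure M (\<Union>i. A i)" by (simp only: UA)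
    show ?case
      unfolding word_approximable_def
    proof (intro conjI allI impI)
      show Ui: "(\<Union>i. A i) \<in> sets M" using A by auto
      fix \<delta> :: real assume "\<delta> > 0"
      then have d: "\<delta> / 2 > 0" by simp
      obtain n where n: "measure M (\<Union>i. A i) - measure M (?U n) < \<delta> / 2"
        using LIMSEQ_D[OF conv d] by (metis abs_less_iff minus_diff_eq order_refl real_norm_def)
      obtain k W where W: "measure M ((?U n - word k -` W) \<union> (word k -` W - ?U n)) < \<delta> / 2"
        using U[of n] d unfolding word_approximable_def by blast
      have "measure M (((\<Union>i. A i) - word k -` W) \<union> (word k -` W - (\<Union>i. A i)))
         \<le> measure M (((\<Union>i. A i) - ?U n) \<union> ((?U n - word k -` W) \<union> (word k -` W - ?U n)))"
        using Ui Us by (intro finite_measure_mono sets.Un sets.Diff) auto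
      also have "\<dots> \<le> measure M ((\<Union>i. A i) - ?U n) + measure M ((?U n - word k -` W) \<union> (word k -` W - ?U n))"
        using Ui Us by (intro measure_subadditive sets.Un sets.Diff) auto
      also have "measure M ((\<Union>i. A i) - ?U n) = measure M (\<Union>i. A i) - measure M (?U n)"
        using Ui Us by (intro finite_measure_Diff) auto
      finally have "measure M (((\<Union>i. A i) - word k -` W) \<union> (word k -` W - (\<Union>i. A i))) < \<delta>"
        using n W by simp
      then show "\<exists>k W. measure M (((\<Union>i. A i) - word k -` W) \<union> (word k -` W - (\<Union>i. A i))) < \<delta>"
        by blast
    qed
  qed
qed

lemma cond_entropy_word_antimono:
  assumes X: "simple_function M X" and "k \<le> l"
  shows "cond_entropy M X (word l) \<le> cond_entropy M X (word k)"
  using assms by (intro cond_entropy_antimono simple_function_word) (auto simp: word_eq_word_iff)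

text \<open>A long word decides membership in an approximating set B, so it suffices to condition on
  B. The joint law of A and B is then a two-by-two table with small off-diagonal entries, and
  uniform continuity of \<open>ent\<close> bounds each of the four resulting terms by
  \<open>e / 4\<close>.\<close>

lemma cond_entropy_indicator_small:
  assumes A: "A \<in> sets M" and e: "e > 0"
  shows "\<exists>k. cond_entropy M (\<lambda>x. x \<in> A) (word k) < e"
proof -
  have "uniformly_continuous_on {0..1} ent"
    using continuous_on_ent by (intro compact_uniformly_continuous) (auto intro: continuous_on_subset)
  then obtain d where d: "d > 0" "\<And>s t. s \<in> {0..1} \<Longrightarrow> t \<in> {0..1} \<Longrightarrow> dist s t < d \<Longrightarrow> dist (ent s) (ent t) < e / 4"
    using e unfolding uniformly_continuous_on_def by (metis divide_pos_pos zero_less_numeral)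
  have ent_close: "\<bar>ent s - ent t\<bar> < e / 4" if "0 \<le> s" "s \<le> 1" "0 \<le> t" "t \<le> 1" "\<bar>s - t\<bar> < d" for s t
    using d(2)[of s t] that by (simp add: dist_real_def)
  obtain k W where W: "measure M ((A - word k -` W) \<union> (word k -` W - A)) < d"
    using word_approximable_sets[OF A] d(1) unfolding word_approximable_def by blast
  define B where "B = word k -` W"
  have B: "B \<in> sets M" by (simp add: B_def)
  have AB: "A \<inter> B \<in> sets M" "- A \<inter> B \<in> sets M" "A \<inter> - B \<in> sets M" "- A \<inter> - B \<in> sets M"
    using A B sets.compl_sets[OF A] sets.compl_sets[OF B] by (auto simp: Compl_eq_Diff_UNIV)
  have small: "measure M (- A \<inter> B) < d" "measure M (A \<inter> - B) < d"
    using W A B unfolding B_def[symmetric]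
    by (auto intro!: le_less_trans[OF finite_measure_mono[of _ "(A - B) \<union> (B - A)"]])
  have split: "measure M B = measure M (A \<inter> B) + measure M (- A \<inter> B)"
    "measure M (- B) = measure M (A \<inter> - B) + measure M (- A \<inter> - B)"
    by (subst finite_measure_Union[symmetric]; use AB in \<open>auto intro!: arg_cong[where f="measure M"]\<close>)+
  have "cond_entropy M (\<lambda>x. x \<in> A) (word k) \<le> cond_entropy M (\<lambda>x. x \<in> A) (\<lambda>x. x \<in> B)"
    by (intro cond_entropy_antimono simple_function_word simple_function_indicator A B)
      (simp add: B_def)
  also have "\<dots> = (\<Sum>v\<in>UNIV \<times> UNIV. ent (law M (\<lambda>x. (x \<in> A, x \<in> B)) v)) - (\<Sum>q\<in>UNIV. ent (law M (\<lambda>x. x \<in> B) q))"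
    unfolding cond_entropy_def
    by (subst var_entropy_superset[of "UNIV \<times> UNIV"], simp, simp, subst var_entropy_superset[of UNIV]) auto
  also have "\<dots> = (\<Sum>p\<in>UNIV. \<Sum>q\<in>UNIV. ent (law M (\<lambda>x. (x \<in> A, x \<in> B)) (p, q))) - (\<Sum>q\<in>UNIV. ent (law M (\<lambda>x. x \<in> B) q))"
    by (simp add: sum.cartesian_product case_prod_beta)
  also have "\<dots> = ent (measure M (A \<inter> B)) + ent (measure M (- A \<inter> B)) + ent (measure M (A \<inter> - B))
      + ent (measure M (- A \<inter> - B)) - ent (measure M B) - ent (measure M (- B))"
    by (simp add: UNIV_bool law_indicator law_indicator1)
  also have "\<dots> < e"
  proof -
    have "\<bar>ent (measure M (A \<inter> B)) - ent (measure M B)\<bar> < e / 4"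
      using small split prob_le_1[of B] by (intro ent_close) (auto simp del: prob_le_1)
    moreover have "\<bar>ent (measure M (- A \<inter> - B)) - ent (measure M (- B))\<bar> < e / 4"
      using small split prob_le_1[of "- B"] by (intro ent_close) (auto simp del: prob_le_1)
    moreover have "\<bar>ent (measure M (- A \<inter> B)) - ent 0\<bar> < e / 4"
      using small by (intro ent_close) auto
    moreover have "\<bar>ent (measure M (A \<inter> - B)) - ent 0\<bar> < e / 4"
      using small by (intro ent_close) auto
    ultimately show ?thesis unfolding ent_0 by argo
  qed
  finally show ?thesis by blast
qed

text \<open>X carries the same information as the indicators of its finitely many level sets, whose
  conditional entropies add up to a bound. Since longer words only help, one length N serves them
  all.\<close>

lemma cond_entropy_word_small:
  assumes X: "simple_function M X" and e: "e > 0"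
  shows "\<exists>k. cond_entropy M X (word k) < e"
proof -
  obtain vs where vs: "set vs = X ` space M" "distinct vs"
    using X finite_distinct_list[of "X ` space M"] by (auto simp: simple_function_def)
  define e' where "e' = e / (real (length vs) + 1)"
  have e': "e' > 0" using e by (simp add: e'_def)
  define A where "A v = X -` {v} \<inter> space M" for v
  have A: "A v \<in> sets M" for v
    unfolding A_def by (rule simple_functionD(2)[OF X])
  obtain k where k: "\<And>v. cond_entropy M (\<lambda>x. x \<in> A v) (word (k v)) < e'"
    using cond_entropy_indicator_small[OF A e'] by metis
  obtain N where N: "\<And>v. v \<in> set vs \<Longrightarrow> k v \<le> N"
    by (metis Max_ge finite_imageI finite_set imageI)
  define Xs where "Xs = map (\<lambda>v x. x \<in> A v) vs"
  have Xs: "simple_function M Z" if "Z \<in> set Xs" for Z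
    using that simple_function_indicator[OF A] by (auto simp: Xs_def)
  have "cond_entropy M X (word N) = cond_entropy M (\<lambda>x. map (\<lambda>Z. Z x) Xs) (word N)"
    using vs by (intro cond_entropy_cong X simple_function_list simple_function_word Xs)
      (auto simp: Xs_def A_def)
  also have "\<dots> \<le> (\<Sum>Z\<leftarrow>Xs. cond_entropy M Z (word N))"
    by (rule cond_entropy_list[OF Xs simple_function_word])
  also have "\<dots> = (\<Sum>v\<leftarrow>vs. cond_entropy M (\<lambda>x. x \<in> A v) (word N))"
    by (simp add: Xs_def comp_def)
  also have "\<dots> \<le> (\<Sum>v\<leftarrow>vs. e')"
  proof (rule sum_list_mono)
    fix v assume "v \<in> set vs"
    then show "cond_entropy M (\<lambda>x. x \<in> A v) (word N) \<le> e'"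
      using cond_entropy_word_antimono[OF simple_function_indicator[OF A] N, of v v] k[of v] by simp
  qed
  also have "\<dots> = real (length vs) * e'" by (simp add: sum_list_const_mult[symmetric] sum_list_triv)
  also have "\<dots> < (real (length vs) + 1) * e'" using e' by simp
  also have "\<dots> = e" by (simp add: e'_def)
  finally show ?thesis by blast
qed

lemma block_entropy_eq: "block_entropy M n = (\<Sum>I | length I = n. ent (measure M (cylinder I)))"
  by (simp add: block_entropy_def var_entropy_word)

end

section \<open>The Kolmogorov-Sinai generator theorem for the shift\<close>

context invariant_shift_measure
begin

lemma simple_function_shift: "simple_function M X \<Longrightarrow> simple_function M (\<lambda>x. X ((shift_map ^^ i) x))"
  by (rule simple_function_mp[OF _ measurable_shift_funpow])

lemma itinerary_eq_list:
  "itinerary X n = (\<lambda>x. map (\<lambda>Z. Z x) (map (\<lambda>i x. X ((shift_map ^^ i) x)) [0..<n]))"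
  by (auto simp: itinerary_def)

lemma simple_function_itinerary: "simple_function M X \<Longrightarrow> simple_function M (itinerary X n)"
  unfolding itinerary_eq_list by (rule simple_function_list) (auto intro: simple_function_shift)

lemma var_entropy_itinerary_subadditive:
  assumes X: "simple_function M X"
  shows "var_entropy M (itinerary X (m + n)) \<le> var_entropy M (itinerary X m) + var_entropy M (itinerary X n)"
proof -
  have sf: "simple_function M (\<lambda>x. itinerary X n ((shift_map ^^ m) x))"
    by (intro simple_function_shift simple_function_itinerary X)
  have "var_entropy M (itinerary X (m + n)) \<le> var_entropy M (\<lambda>x. (itinerary X m x, itinerary X n ((shift_map ^^ m) x)))"
    by (rule var_entropy_mono[OF simple_function_Pair[OF simple_function_itinerary[OF X] sf]])
      (simp add: itinerary_add)
  also have "\<dots> \<le> var_entropy M (itinerary X m) + var_entropy M (\<lambda>x. itinerary X n ((shift_map ^^ m) x))"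
    by (rule var_entropy_pair[OF simple_function_itinerary[OF X] sf])
  also have "var_entropy M (\<lambda>x. itinerary X n ((shift_map ^^ m) x)) = var_entropy M (itinerary X n)"
    by (rule var_entropy_mp[OF simple_function_itinerary[OF X] measurable_shift_funpow distr_shift_funpow])
  finally show ?thesis by simp
qed

lemma itinerary_entropy_convergent:
  assumes X: "simple_function M X"
  obtains L where "(\<lambda>n. var_entropy M (itinerary X n) / real n) \<longlonglongrightarrow> L"
    "\<And>n. n \<ge> 1 \<Longrightarrow> L \<le> var_entropy M (itinerary X n) / real n"
  using subadditive_div_convergent[of "\<lambda>n. var_entropy M (itinerary X n)" 0]
    var_entropy_itinerary_subadditive[OF X] var_entropy_nonneg
  by (metis divide_nonneg_nonneg of_nat_0_le_iff)

lemma block_entropy_tendsto: "(\<lambda>n. block_entropy M n / real n) \<longlonglongrightarrow> entropy_rate M"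
  and entropy_rate_le: "n \<ge> 1 \<Longrightarrow> entropy_rate M \<le> block_entropy M n / real n"
proof -
  have "simple_function M (\<lambda>x. x 0)"
    using simple_function_word_comp[of "\<lambda>I. I ! 0" 1] by simp
  then obtain L where L: "(\<lambda>n. block_entropy M n / real n) \<longlonglongrightarrow> L"
    "\<And>n. n \<ge> 1 \<Longrightarrow> L \<le> block_entropy M n / real n"
    unfolding block_entropy_def word_eq_itinerary by (rule itinerary_entropy_convergent) auto
  moreover have "entropy_rate M = L"
    unfolding entropy_rate_def by (rule limI[OF L(1)])
  ultimately show "(\<lambda>n. block_entropy M n / real n) \<longlonglongrightarrow> entropy_rate M"
    "n \<ge> 1 \<Longrightarrow> entropy_rate M \<le> block_entropy M n / real n" by auto
qed

text \<open>A word of length \<open>n + k\<close> contains the k letters read from each of the times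
  below n. By invariance every entry of the itinerary therefore costs at most the conditional
  entropy at time zero.\<close>

lemma var_entropy_itinerary_le:
  assumes X: "simple_function M X"
  shows "var_entropy M (itinerary X n) \<le> block_entropy M (n + k) + real n * cond_entropy M X (word k)"
proof -
  have "var_entropy M (itinerary X n) \<le> var_entropy M (word (n + k)) + cond_entropy M (itinerary X n) (word (n + k))"
    by (rule var_entropy_le_cond[OF simple_function_itinerary[OF X] simple_function_word])
  also have "cond_entropy M (itinerary X n) (word (n + k)) \<le>
      (\<Sum>Z\<leftarrow>map (\<lambda>i x. X ((shift_map ^^ i) x)) [0..<n]. cond_entropy M Z (word (n + k)))"
    unfolding itinerary_eq_list
    by (rule cond_entropy_list) (auto intro: simple_function_shift X simple_function_word)
  also have "\<dots> = (\<Sum>i\<leftarrow>[0..<n]. cond_entropy M (\<lambda>x. X ((shift_map ^^ i) x)) (word (n + k)))"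
    by (simp add: comp_def)
  also have "\<dots> \<le> (\<Sum>i\<leftarrow>[0..<n]. cond_entropy M X (word k))"
  proof (rule sum_list_mono)
    fix i assume "i \<in> set [0..<n]"
    then have i: "i < n" by simp
    have "cond_entropy M (\<lambda>x. X ((shift_map ^^ i) x)) (word (n + k))
       \<le> cond_entropy M (\<lambda>x. X ((shift_map ^^ i) x)) (\<lambda>x. word k ((shift_map ^^ i) x))"
      using i by (intro cond_entropy_antimono simple_function_shift simple_function_word X)
        (auto simp: word_eq_word_iff shift_funpow)
    also have "\<dots> = cond_entropy M X (word k)"
      by (rule cond_entropy_mp[OF X simple_function_word measurable_shift_funpow distr_shift_funpow])
    finally show "cond_entropy M (\<lambda>x. X ((shift_map ^^ i) x)) (word (n + k)) \<le> cond_entropy M X (word k)" .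
  qed
  also have "\<dots> = real n * cond_entropy M X (word k)"
    by (simp add: sum_list_triv)
  finally show ?thesis by (simp add: block_entropy_def)
qed

lemma block_entropy_subadditive: "block_entropy M (m + n) \<le> block_entropy M m + block_entropy M n"
proof -
  have "simple_function M (\<lambda>x. x 0)"
    using simple_function_word_comp[of "\<lambda>I. I ! 0" 1] by simp
  then show ?thesis
    unfolding block_entropy_def word_eq_itinerary by (rule var_entropy_itinerary_subadditive)
qed

text \<open>After division by n the k surplus letters contribute nothing in the limit, and the
  remaining conditional entropy is below any given e once k is large.\<close>

lemma itinerary_entropy_rate_le:
  assumes X: "simple_function M X" and L: "(\<lambda>n. var_entropy M (itinerary X n) / real n) \<longlonglongrightarrow> L"
  shows "L \<le> entropy_rate M"
proof (rule field_le_epsilon)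
  fix e :: real assume "e > 0"
  then obtain k where k: "cond_entropy M X (word k) < e"
    using cond_entropy_word_small[OF X] by blast
  have "(\<lambda>n. block_entropy M n / real n + block_entropy M k / real n + cond_entropy M X (word k))
      \<longlonglongrightarrow> entropy_rate M + 0 + cond_entropy M X (word k)"
    by (intro tendsto_intros block_entropy_tendsto lim_const_over_n)
  moreover have "var_entropy M (itinerary X n) / real n \<le>
      block_entropy M n / real n + block_entropy M k / real n + cond_entropy M X (word k)" if "n \<ge> 1" for n
  proof -
    have "var_entropy M (itinerary X n) \<le> block_entropy M n + block_entropy M k + real n * cond_entropy M X (word k)"
      using var_entropy_itinerary_le[OF X, of n k] block_entropy_subadditive[of n k] by linarith
    then have "var_entropy M (itinerary X n) / real n \<le>
        (block_entropy M n + block_entropy M k + real n * cond_entropy M X (word k)) / real n"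
      by (intro divide_right_mono) auto
    then show ?thesis using that by (simp add: add_divide_distrib)
  qed
  ultimately have "L \<le> entropy_rate M + 0 + cond_entropy M X (word k)"
    using L by (intro LIMSEQ_le) auto
  then show "L \<le> entropy_rate M + e" using k by simp
qed

lemma partition_entropy_itinerary:
  assumes \<xi>: "finite_measurable_partition M \<xi>"
    and X: "\<And>x y. X x = X y \<longleftrightarrow> (\<exists>A\<in>\<xi>. x \<in> A \<and> y \<in> A)" and "n \<ge> 1"
  shows "partition_entropy M (dynamical_refinement M shift_map \<xi> n) = var_entropy M (itinerary X n)"
proof -
  have p: "partition_on UNIV \<xi>" using \<xi> by (simp add: finite_measurable_partition_def)
  show ?thesis
    by (rule partition_entropy_eq_var_entropy)
      (simp_all add: dynamical_refinement_properties[OF p space_M \<open>n \<ge> 1\<close>] itinerary_eq_iff X)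
qed

lemma partition_entropy_rate_itinerary:
  assumes \<xi>: "finite_measurable_partition M \<xi>"
    and X: "\<And>x y. X x = X y \<longleftrightarrow> (\<exists>A\<in>\<xi>. x \<in> A \<and> y \<in> A)"
    and L: "(\<lambda>n. var_entropy M (itinerary X n) / real n) \<longlonglongrightarrow> L"
  shows "partition_entropy_rate M shift_map \<xi> = L"
  unfolding partition_entropy_rate_def
proof (rule limI, rule Lim_transform_eventually[OF L])
  show "\<forall>\<^sub>F n in sequentially. var_entropy M (itinerary X n) / real n =
      partition_entropy M (dynamical_refinement M shift_map \<xi> n) / real n"
    using eventually_ge_at_top[of 1]
    by eventually_elim (simp add: partition_entropy_itinerary[OF \<xi> X])
qed

theorem measure_entropy_eq: "measure_entropy M shift_map = ereal (entropy_rate M)"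
proof (rule antisym)
  show "measure_entropy M shift_map \<le> ereal (entropy_rate M)"
    unfolding measure_entropy_def
  proof (rule SUP_least)
    fix \<xi> assume "\<xi> \<in> {\<xi>. finite_measurable_partition M \<xi>}"
    then have \<xi>: "finite_measurable_partition M \<xi>" by simp
    then have p: "partition_on UNIV \<xi>" and fin: "finite \<xi>" and sets: "\<xi> \<subseteq> sets M"
      by (simp_all add: finite_measurable_partition_def)
    have "\<exists>A\<in>\<xi>. x \<in> A" for x using p by (auto simp: partition_on_def)
    \<comment> \<open>The random variable attached to a partition sends a point to the atom that
      contains it.\<close>
    then obtain X where X: "\<And>x. X x \<in> \<xi>" "\<And>x. x \<in> X x" by metis
    have uniq: "A = X x" if "A \<in> \<xi>" "x \<in> A" for A x
      using p X[of x] that by (auto simp: partition_on_def disjoint_def)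
    have Xeq: "X x = X y \<longleftrightarrow> (\<exists>A\<in>\<xi>. x \<in> A \<and> y \<in> A)" for x y
      using X uniq by metis
    have "X -` {X x} = X x" for x using X uniq by (metis (lifting) subsetI subset_antisym vimage_singleton_eq)
    then have "simple_function M X"
      unfolding simple_function_def using X(1) sets finite_subset[OF _ fin, of "range X"] by auto
    then obtain L where L: "(\<lambda>n. var_entropy M (itinerary X n) / real n) \<longlonglongrightarrow> L"
      and "L \<le> entropy_rate M"
      using itinerary_entropy_convergent itinerary_entropy_rate_le by metis
    then show "ereal (partition_entropy_rate M shift_map \<xi>) \<le> ereal (entropy_rate M)"
      using partition_entropy_rate_itinerary[OF \<xi> Xeq L] by simp
  qed
  \<comment> \<open>The partition by the first letter attains the supremum: its itineraries are the
    words.\<close>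
  define \<xi> where "\<xi> = range (\<lambda>a :: 'a. cylinder [a])"
  have mem: "x \<in> cylinder [a] \<longleftrightarrow> x 0 = a" for x :: "nat \<Rightarrow> 'a" and a
    by (simp add: cylinder_def)
  have "partition_on UNIV \<xi>"
    unfolding \<xi>_def by (rule partition_onI) (use cylinder_nonempty in \<open>auto simp: mem disjnt_def\<close>)
  then have \<xi>: "finite_measurable_partition M \<xi>"
    by (auto simp: finite_measurable_partition_def \<xi>_def)
  have "partition_entropy_rate M shift_map \<xi> = entropy_rate M"
    using block_entropy_tendsto
    by (intro partition_entropy_rate_itinerary[OF \<xi>, of "\<lambda>x. x 0"])
      (auto simp: \<xi>_def mem word_eq_itinerary block_entropy_def)
  then show "ereal (entropy_rate M) \<le> measure_entropy M shift_map"
    unfolding measure_entropy_def using \<xi> by (metis (mono_tags, lifting) SUP_upper mem_Collect_eq)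
qed

end

section \<open>Existence of measures with prescribed cylinder weights\<close>

text \<open>Ionescu-Tulcea construction. Right consistency says that the quotients of successive
  weights are transition probabilities, and positivity keeps these quotients meaningful.\<close>

lemma exists_shift_measure:
  fixes w :: "'a::{finite,discrete_topology} list \<Rightarrow> real"
  assumes pos: "\<And>I. w I > 0" and Nil: "w [] = 1"
    and snoc: "\<And>I. (\<Sum>a\<in>UNIV. w (I @ [a])) = w I"
  obtains M where "shift_measure M" "\<And>I. measure M (cylinder I) = w I"
proof -
  let ?M = "\<lambda>_ :: nat. count_space (UNIV :: 'a set)"
  \<comment> \<open>The law of letter i given the earlier letters; the conditional weight of a is
    \<open>w (I @ [a]) / w I\<close> for the past I.\<close>
  define P where "P i \<omega> = point_measure UNIV (\<lambda>a. ennreal (w (map \<omega> [0..<i] @ [a]) / w (map \<omega> [0..<i])))"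
    for i :: nat and \<omega> :: "nat \<Rightarrow> 'a"
  \<comment> \<open>Finite products of a finite discrete space are again discrete, which makes every
    kernel measurable and every singleton an event.\<close>
  have PiM_eq: "PiM {0..<i} ?M = count_space (PiE {0..<i} (\<lambda>_. UNIV))" for i
    by (rule count_space_PiM_finite) (auto intro: countable_finite)
  have P_single: "emeasure (P i \<omega>) {a} = ennreal (w (map \<omega> [0..<i] @ [a]) / w (map \<omega> [0..<i]))" for i \<omega> a
    unfolding P_def by (subst emeasure_point_measure_finite) auto
  have prob_P: "prob_space (P i \<omega>)" for i \<omega>
  proof (rule prob_spaceI)
    have "emeasure (P i \<omega>) UNIV = (\<Sum>a\<in>UNIV. ennreal (w (map \<omega> [0..<i] @ [a]) / w (map \<omega> [0..<i])))"
      unfolding P_def by (subst emeasure_point_measure_finite) auto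
    also have "\<dots> = ennreal (\<Sum>a\<in>UNIV. w (map \<omega> [0..<i] @ [a]) / w (map \<omega> [0..<i]))"
      using pos by (intro sum_ennreal) (simp add: less_imp_le)
    also have "(\<Sum>a\<in>UNIV. w (map \<omega> [0..<i] @ [a]) / w (map \<omega> [0..<i])) = 1"
      using pos[of "map \<omega> [0..<i]"] by (simp add: sum_divide_distrib[symmetric] snoc)
    finally show "emeasure (P i \<omega>) (space (P i \<omega>)) = 1" by (simp add: P_def space_point_measure)
  qed
  interpret IT: Ionescu_Tulcea P ?M
  proof (rule Ionescu_Tulcea.intro)
    show "P i \<in> measurable (PiM {0..<i} ?M) (subprob_algebra (count_space UNIV))" for i
      unfolding PiM_eq measurable_count_space_eq1
      using prob_P by (auto simp: space_subprob_algebra prob_space_imp_subprob_space P_def sets_point_measure)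
  qed (rule prob_P)
  have C_single: "emeasure (IT.C 0 n (\<lambda>_. undefined)) {f} = ennreal (w (map f [0..<n]))"
    if "f \<in> PiE {0..<n} (\<lambda>_. UNIV)" for n f
    using that
  proof (induction n arbitrary: f)
    case 0
    then have f: "f = (\<lambda>_. undefined)" by simp
    have "{f} \<in> sets (PiM {0..<0} ?M)" unfolding PiM_eq by (simp add: f)
    then show ?case unfolding IT.C.simps by (subst emeasure_return) (auto simp: f Nil)
  next
    case (Suc n)
    let ?f = "restrict f {0..<n}" and ?C = "IT.C 0 n (\<lambda>_. undefined)"
    have sp: "space ?C = PiE {0..<n} (\<lambda>_. UNIV)"
      by (subst IT.space_C) (simp_all add: PiM_eq)
    have setsC: "sets ?C = sets (PiM {0..<n} ?M)"
      using IT.sets_C[of "\<lambda>_. undefined" 0 n] by simp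
    have f': "?f \<in> PiE {0..<n} (\<lambda>_. UNIV)" by simp
    \<comment> \<open>Appending one letter can produce f only from the restriction of f, so the
      integral over the past reduces to one point and the quotients telescope to
      \<open>w\<close>.\<close>
    have eP: "emeasure (IT.eP n \<omega>) {f} = emeasure (P n ?f) {f n} * indicator {?f} \<omega>"
      if \<omega>: "\<omega> \<in> space ?C" for \<omega>
    proof -
      have "fun_upd \<omega> n x = f \<longleftrightarrow> \<omega> = ?f \<and> x = f n" for x
      proof
        assume eq: "fun_upd \<omega> n x = f"
        have "\<omega> i = ?f i" for i
          using fun_cong[OF eq, of i] \<omega> by (cases "i < n") (auto simp: sp PiE_iff extensional_def)
        then show "\<omega> = ?f \<and> x = f n" using fun_cong[OF eq, of n] by auto
      next
        assume eq: "\<omega> = ?f \<and> x = f n"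
        have "f i = undefined" if "i > n" for i
          using Suc.prems that by (auto simp: PiE_iff extensional_def)
        then have "fun_upd ?f n (f n) i = f i" for i
          by (cases i n rule: linorder_cases) simp_all
        then have "fun_upd ?f n (f n) = f" by (rule ext)
        then show "fun_upd \<omega> n x = f" using eq by simp
      qed
      then have "(\<lambda>x. fun_upd \<omega> n x) -` {f} = {x. \<omega> = ?f \<and> x = f n}"
        unfolding vimage_def singleton_iff by (simp only:)
      also have "\<dots> = (if \<omega> = ?f then {f n} else {})" by simp
      finally have "(\<lambda>x. fun_upd \<omega> n x) -` {f} = (if \<omega> = ?f then {f n} else {})" .
      moreover have "emeasure (IT.eP n \<omega>) {f} = emeasure (P n \<omega>) ((\<lambda>x. fun_upd \<omega> n x) -` {f} \<inter> UNIV)"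
        using \<omega> Suc.prems by (subst IT.emeasure_eP) (auto simp: sp PiM_eq)
      ultimately show ?thesis by simp
    qed
    have "emeasure (IT.C 0 (Suc n) (\<lambda>_. undefined)) {f} = (\<integral>\<^sup>+\<omega>. emeasure (IT.eP n \<omega>) {f} \<partial>?C)"
      unfolding IT.C.simps
    proof (subst emeasure_bind)
      show "space ?C \<noteq> {}" using f' by (subst sp) blast
      show "IT.eP (0 + n) \<in> measurable ?C (subprob_algebra (PiM {0..<Suc n} ?M))"
        unfolding measurable_cong_sets[OF setsC refl] by simp
      show "{f} \<in> sets (PiM {0..<Suc n} ?M)" using Suc.prems by (simp add: PiM_eq)
    qed simp
    also have "\<dots> = (\<integral>\<^sup>+\<omega>. emeasure (P n ?f) {f n} * indicator {?f} \<omega> \<partial>?C)"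
      by (rule nn_integral_cong) (rule eP)
    also have "\<dots> = emeasure (P n ?f) {f n} * emeasure ?C {?f}"
      by (rule nn_integral_cmult_indicator) (simp add: setsC PiM_eq)
    also have "\<dots> = ennreal (w (map f [0..<n] @ [f n]) / w (map f [0..<n])) * ennreal (w (map f [0..<n]))"
    proof -
      have "map ?f [0..<n] = map f [0..<n]" by simp
      then show ?thesis unfolding P_single Suc.IH[OF f'] by (simp only:)
    qed
    also have "\<dots> = ennreal (w (map f [0..<Suc n]))"
      using pos[of "map f [0..<n]"] pos[of "map f [0..<n] @ [f n]"]
      by (subst ennreal_mult[symmetric]) (auto simp: less_imp_le)
    finally show ?case .
  qed
  let ?L = "IT.PF.lim"
  have space_L: "space ?L = UNIV" by (simp add: space_PiM)
  have cyl: "cylinder I = prod_emb UNIV ?M {0..<length I} {restrict (\<lambda>i. I ! i) {0..<length I}}"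
    for I :: "'a list"
  proof -
    have "restrict x {0..<length I} = restrict (\<lambda>i. I ! i) {0..<length I} \<longleftrightarrow> x \<in> cylinder I" for x
    proof
      assume eq: "restrict x {0..<length I} = restrict (\<lambda>i. I ! i) {0..<length I}"
      have "x i = I ! i" if "i < length I" for i
        using fun_cong[OF eq, of i] that by simp
      then show "x \<in> cylinder I" by (simp add: cylinder_def)
    qed (auto simp: cylinder_def intro: restrict_ext)
    then show ?thesis unfolding prod_emb_def space_PiM by auto
  qed
  have single: "{restrict (\<lambda>i. I ! i) {0..<length I}} \<in> sets (PiM {0..<length I} ?M)" for I :: "'a list"
    by (simp add: PiM_eq)
  have sets_L: "cylinder I \<in> sets ?L" for I :: "'a list"
    unfolding cyl by (auto intro!: measurable_prod_emb single)
  have L: "emeasure ?L (cylinder I) = ennreal (w I)" for I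
  proof -
    let ?n = "length I" and ?f = "restrict (\<lambda>i. I ! i) {0..<length I}"
    have "emeasure ?L (cylinder I) = emeasure (IT.CI {0..<?n}) {?f}"
      unfolding cyl by (rule IT.lim[OF _ single]) simp
    also have "\<dots> = emeasure (IT.C 0 ?n (\<lambda>_. undefined)) (prod_emb {0..<?n} ?M {0..<?n} {?f})"
      by (rule IT.emeasure_CI[OF _ single]) simp
    also have "prod_emb {0..<?n} ?M {0..<?n} {?f} = {?f}"
      by (rule prod_emb_id) auto
    also have "emeasure (IT.C 0 ?n (\<lambda>_. undefined)) {?f} = ennreal (w (map ?f [0..<?n]))"
      by (rule C_single) simp
    also have "map ?f [0..<?n] = I" by (rule nth_equalityI) auto
    finally show ?thesis .
  qed
  have meas: "(\<lambda>x. x) \<in> measurable ?L borel"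
  proof (rule measurable_sigma_sets[OF sigma_sets_cylinders])
    show "(\<lambda>x. x) -` A \<inter> space ?L \<in> sets ?L" if "A \<in> range cylinder" for A
      using that sets_L unfolding space_L by auto
  qed auto
  \<comment> \<open>The projective limit lives on the product sigma-algebra of the count spaces; the
    identity map transports it to the Borel sigma-algebra.\<close>
  let ?D = "distr ?L borel (\<lambda>x. x)"
  have D: "emeasure ?D (cylinder I) = ennreal (w I)" for I
    unfolding emeasure_distr[OF meas cylinder_borel] space_L by (simp add: L)
  have "prob_space ?D"
    using D[of "[]"] Nil by (intro prob_spaceI) simp
  then have "shift_measure ?D"
    by (simp add: shift_measure_def shift_measure_axioms_def)
  moreover have "measure ?D (cylinder I) = w I" for I
    using D[of I] pos[of I] by (simp add: measure_def)
  ultimately show ?thesis by (rule that)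
qed

text \<open>Consistency on the right yields the measure, consistency on the left its
  invariance.\<close>

lemma exists_invariant_shift_measure:
  fixes w :: "'a::{finite,discrete_topology} list \<Rightarrow> real"
  assumes "\<And>I. w I > 0" "w [] = 1"
    "\<And>I. (\<Sum>a\<in>UNIV. w (I @ [a])) = w I" "\<And>I. (\<Sum>a\<in>UNIV. w (a # I)) = w I"
  obtains M where "invariant_shift_measure M" "\<And>I. measure M (cylinder I) = w I"
proof -
  obtain M where "shift_measure M" "\<And>I. measure M (cylinder I) = w I"
    using exists_shift_measure[of w] assms by metis
  then show ?thesis using that invariant_shift_measureI[of M] assms(4) by simp
qed

section \<open>Quasi-Bernoulli measures are weighted Gibbs measures\<close>

abbreviation factor_measure ::
    "('a::{finite,discrete_topology} \<Rightarrow> 'd::{finite,discrete_topology}) \<Rightarrow> (nat \<Rightarrow> 'a) measure \<Rightarrow> (nat \<Rightarrow> 'd) measure" where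
  "factor_measure \<pi> M \<equiv> distr M borel (block_map \<pi>)"

definition weighted_rate ::
    "real \<Rightarrow> real \<Rightarrow> ('a::{finite,discrete_topology} \<Rightarrow> 'd::{finite,discrete_topology}) \<Rightarrow> (nat \<Rightarrow> 'a) measure \<Rightarrow> real" where
  "weighted_rate a b \<pi> M = a * entropy_rate M + b * entropy_rate (factor_measure \<pi> M)"

definition weighted_block_entropy ::
    "real \<Rightarrow> real \<Rightarrow> ('a::{finite,discrete_topology} \<Rightarrow> 'd::{finite,discrete_topology}) \<Rightarrow> (nat \<Rightarrow> 'a) measure \<Rightarrow> nat \<Rightarrow> real" where
  "weighted_block_entropy a b \<pi> M n = a * block_entropy M n + b * block_entropy (factor_measure \<pi> M) n"

lemma (in shift_measure) integral_factor_word: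
  fixes \<pi> :: "'a \<Rightarrow> 'd::{finite,discrete_topology}" and g :: "'d list \<Rightarrow> real"
  shows "(\<Sum>I | length I = n. measure M (cylinder I) * g (map \<pi> I)) =
    (\<Sum>J | length J = n. measure (factor_measure \<pi> M) (cylinder J) * g J)"
proof -
  interpret N: shift_measure "factor_measure \<pi> M" by (rule shift_measure_factor)
  have "(\<Sum>J | length J = n. measure (factor_measure \<pi> M) (cylinder J) * g J) = (\<integral>y. g (word n y) \<partial>factor_measure \<pi> M)"
    by (rule N.integral_word[symmetric])
  also have "\<dots> = (\<integral>x. g (word n (block_map \<pi> x)) \<partial>M)"
    by (rule integral_distr)
      (auto intro!: measurable_continuous continuous_on_block_map borel_measurable_continuous_onI
         continuous_on_word_dependent[of n])
  also have "\<dots> = (\<integral>x. g (map \<pi> (word n x)) \<partial>M)" by (simp add: map_word)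
  also have "\<dots> = (\<Sum>I | length I = n. measure M (cylinder I) * g (map \<pi> I))"
    by (rule integral_word)
  finally show ?thesis by simp
qed

context invariant_shift_measure
begin

lemma weighted_entropy_eq: "weighted_entropy a b \<pi> M = ereal (weighted_rate a b \<pi> M)"
  using measure_entropy_eq invariant_shift_measure.measure_entropy_eq[OF invariant_factor[of \<pi>]]
  by (simp add: weighted_entropy_def weighted_rate_def)

lemma weighted_block_entropy_tendsto:
  "(\<lambda>n. weighted_block_entropy a b \<pi> M n / real n) \<longlonglongrightarrow> weighted_rate a b \<pi> M"
proof -
  have "(\<lambda>n. a * (block_entropy M n / real n) + b * (block_entropy (factor_measure \<pi> M) n / real n))
    \<longlonglongrightarrow> weighted_rate a b \<pi> M"
    unfolding weighted_rate_def
    by (intro tendsto_intros block_entropy_tendsto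
        invariant_shift_measure.block_entropy_tendsto[OF invariant_factor])
  then show ?thesis by (simp add: weighted_block_entropy_def add_divide_distrib)
qed

lemma weighted_rate_le:
  assumes "a \<ge> 0" "b \<ge> 0" "n \<ge> 1"
  shows "weighted_rate a b \<pi> M \<le> weighted_block_entropy a b \<pi> M n / real n"
proof -
  have "a * entropy_rate M \<le> a * (block_entropy M n / real n)"
    "b * entropy_rate (factor_measure \<pi> M) \<le> b * (block_entropy (factor_measure \<pi> M) n / real n)"
    using assms entropy_rate_le invariant_shift_measure.entropy_rate_le[OF invariant_factor]
    by (intro mult_left_mono; simp)+
  then show ?thesis by (simp add: weighted_rate_def weighted_block_entropy_def add_divide_distrib)
qed

text \<open>Adding K to the averages makes them exactly subadditive, and \<open>K / n\<close>
  disappears in the limit. The lower estimate supplies the linear bound that keeps the infimum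
  finite.\<close>

lemma almost_additive_average_convergent:
  fixes g :: "'a list \<Rightarrow> real"
  assumes up: "\<And>I J. g (I @ J) \<le> g I + g J + K" and low: "\<And>I J. g I + g J - K \<le> g (I @ J)"
  obtains L where "(\<lambda>n. (\<integral>x. g (word n x) \<partial>M) / real n) \<longlonglongrightarrow> L"
proof -
  define A where "A n = (\<integral>x. g (word n x) \<partial>M)" for n
  have sum: "A m + A n + c = (\<integral>x. g (word m x) + g (word n ((shift_map ^^ m) x)) + c \<partial>M)" for m n c
    using prob_space
    by (simp add: A_def integral_word_shift integrable_word integrable_word_shift)
  have upA: "A (m + n) \<le> A m + A n + K" for m n
    unfolding sum unfolding A_def word_add[of m n]
    by (intro integral_mono up)
      (use integrable_word[of g "m + n"] in \<open>simp_all add: word_add integrable_word integrable_word_shift\<close>)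
  have lowA: "A m + A n - K \<le> A (m + n)" for m n
  proof -
    have "A m + A n + (- K) \<le> A (m + n)"
      unfolding sum unfolding A_def word_add[of m n]
      by (intro integral_mono)
        (use integrable_word[of g "m + n"] low in \<open>simp_all add: word_add integrable_word integrable_word_shift\<close>)
    then show ?thesis by simp
  qed
  have nonneg: "K \<ge> 0" using up[of "[]" "[]"] low[of "[]" "[]"] by simp
  \<comment> \<open>Almost additivity at the empty word bounds \<open>g []\<close> by K in absolute
    value, which starts the induction.\<close>
  have lin: "real n * (A 1 - K) - K \<le> A n" for n
  proof (induction n)
    case 0
    show ?case using low[of "[]" "[]"] prob_space up[of "[]" "[]"] by (simp add: A_def)
  next
    case (Suc n)
    then show ?case using lowA[of n 1] by (simp add: algebra_simps)
  qed
  have sub: "A (m + n) + K \<le> (A m + K) + (A n + K)" for m n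
    using upA[of m n] by simp
  have bd: "A 1 - K \<le> (A n + K) / real n" if "n \<ge> 1" for n
    using lin[of n] that by (simp add: field_simps)
  obtain L where L: "(\<lambda>n. (A n + K) / real n) \<longlonglongrightarrow> L"
    using subadditive_div_convergent[OF sub bd] by metis
  have "(\<lambda>n. (A n + K) / real n - K / real n) \<longlonglongrightarrow> L - 0"
    by (intro tendsto_intros L lim_const_over_n)
  then have "(\<lambda>n. A n / real n) \<longlonglongrightarrow> L" by (simp add: diff_divide_distrib[symmetric])
  then show ?thesis using that by (simp add: A_def)
qed

end

locale quasi_bernoulli_measure = invariant_shift_measure M
  for M :: "(nat \<Rightarrow> 'a::{finite,discrete_topology}) measure" +
  fixes C :: real and \<pi> :: "'a \<Rightarrow> 'd::{finite,discrete_topology}" and a b :: real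
  assumes pos: "measure M (cylinder I) > 0"
    and qb_upper: "measure M (cylinder (I @ J)) \<le> C * (measure M (cylinder I) * measure M (cylinder J))"
    and qb_lower: "measure M (cylinder I) * measure M (cylinder J) \<le> C * measure M (cylinder (I @ J))"
    and a_pos: "a > 0" and b_nonneg: "b \<ge> 0"
begin

abbreviation p :: "'a list \<Rightarrow> real" where "p I \<equiv> measure M (cylinder I)"
abbreviation r :: "'d list \<Rightarrow> real" where "r J \<equiv> measure (factor_measure \<pi> M) (cylinder J)"

lemma C_pos: "C > 0"
  using qb_lower[of "[]" "[]"] prob_space by simp

text \<open>A word over a concatenation splits uniquely into words over the two parts. The mass of
  the concatenation and the product of masses thus become sums over the same product of fibres, and
  the constant C carries over to the factor termwise.\<close>

lemma r_append: "r (J @ K) =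
    (\<Sum>(I, I')\<in>{I. length I = length J \<and> map \<pi> I = J} \<times> {I. length I = length K \<and> map \<pi> I = K}. p (I @ I'))"
  unfolding measure_factor_cylinder
  by (rule sum.reindex_bij_witness[of _ "\<lambda>(I, I'). I @ I'" "\<lambda>I. (take (length J) I, drop (length J) I)"])
    (auto simp: take_map[symmetric] drop_map[symmetric])

lemma r_mult: "r J * r K =
    (\<Sum>(I, I')\<in>{I. length I = length J \<and> map \<pi> I = J} \<times> {I. length I = length K \<and> map \<pi> I = K}. p I * p I')"
  unfolding measure_factor_cylinder by (simp add: sum_product sum.cartesian_product)

lemma r_upper: "r (J @ K) \<le> C * (r J * r K)"
  unfolding r_append r_mult sum_distrib_left using qb_upper by (intro sum_mono) auto

lemma r_lower: "r J * r K \<le> C * r (J @ K)"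
  unfolding r_append r_mult sum_distrib_left using qb_lower by (intro sum_mono) auto

lemma r_pos: "r (map \<pi> I) > 0"
proof -
  have "finite {I'. length I' = length (map \<pi> I) \<and> map \<pi> I' = map \<pi> I}"
    by (rule finite_subset[OF _ finite_words[of "length I"]]) auto
  then have "p I \<le> r (map \<pi> I)"
    unfolding measure_factor_cylinder by (intro member_le_sum) auto
  then show ?thesis using pos[of I] by simp
qed

section \<open>The potential of a quasi-Bernoulli measure and its pressure\<close>

definition log_weight :: "'a list \<Rightarrow> real" where
  "log_weight I = a * ln (p I) + b * ln (r (map \<pi> I))"

text \<open>Dependence on the word alone makes each function locally constant, gives distortion
  constant one and trivialises the supremum in \<open>word_weight\<close>.\<close>

definition gibbs_potential :: "nat \<Rightarrow> (nat \<Rightarrow> 'a) \<Rightarrow> real" where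
  "gibbs_potential n x = exp (log_weight (word n x))"

text \<open>The measure and its factor each contribute \<open>ln C\<close>, with weights a and b;
  hence the constant \<open>(a + b) * ln C\<close>.\<close>

lemma log_weight_append_upper: "log_weight (I @ J) \<le> log_weight I + log_weight J + (a + b) * ln C"
proof -
  have "ln (p (I @ J)) \<le> ln (C * (p I * p J))"
    using qb_upper pos C_pos by (subst ln_le_cancel_iff) auto
  then have "ln (p (I @ J)) \<le> ln C + ln (p I) + ln (p J)"
    using pos[of I] pos[of J] C_pos by (simp add: ln_mult)
  moreover have "ln (r (map \<pi> I @ map \<pi> J)) \<le> ln (C * (r (map \<pi> I) * r (map \<pi> J)))"
    using r_upper r_pos[of I] r_pos[of J] r_pos[of "I @ J"] C_pos by (subst ln_le_cancel_iff) auto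
  then have "ln (r (map \<pi> I @ map \<pi> J)) \<le> ln C + ln (r (map \<pi> I)) + ln (r (map \<pi> J))"
    using r_pos[of I] r_pos[of J] C_pos by (simp add: ln_mult)
  ultimately have "a * ln (p (I @ J)) + b * ln (r (map \<pi> I @ map \<pi> J))
    \<le> a * (ln C + ln (p I) + ln (p J)) + b * (ln C + ln (r (map \<pi> I)) + ln (r (map \<pi> J)))"
    using a_pos b_nonneg by (intro add_mono mult_left_mono) auto
  then show ?thesis by (simp add: log_weight_def algebra_simps)
qed

lemma log_weight_append_lower: "log_weight I + log_weight J - (a + b) * ln C \<le> log_weight (I @ J)"
proof -
  have "ln (p I * p J) \<le> ln (C * p (I @ J))"
    using qb_lower pos C_pos by (subst ln_le_cancel_iff) auto
  then have "ln (p I) + ln (p J) - ln C \<le> ln (p (I @ J))"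
    using pos[of I] pos[of J] pos[of "I @ J"] C_pos by (simp add: ln_mult)
  moreover have "ln (r (map \<pi> I) * r (map \<pi> J)) \<le> ln (C * r (map \<pi> I @ map \<pi> J))"
    using r_lower r_pos[of I] r_pos[of J] r_pos[of "I @ J"] C_pos by (subst ln_le_cancel_iff) auto
  then have "ln (r (map \<pi> I)) + ln (r (map \<pi> J)) - ln C \<le> ln (r (map \<pi> I @ map \<pi> J))"
    using r_pos[of I] r_pos[of J] r_pos[of "I @ J"] C_pos by (simp add: ln_mult)
  ultimately have "a * (ln (p I) + ln (p J) - ln C) + b * (ln (r (map \<pi> I)) + ln (r (map \<pi> J)) - ln C)
    \<le> a * ln (p (I @ J)) + b * ln (r (map \<pi> I @ map \<pi> J))"
    using a_pos b_nonneg by (intro add_mono mult_left_mono) auto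
  then show ?thesis by (simp add: log_weight_def algebra_simps)
qed

lemma almost_additive_gibbs_potential: "almost_additive gibbs_potential"
  unfolding almost_additive_def
proof (intro conjI allI impI exI[of _ "exp ((a + b) * ln C)"])
  fix n m :: nat and x :: "nat \<Rightarrow> 'a"
  show "continuous_on UNIV (gibbs_potential n)"
    by (rule continuous_on_word_dependent[of n]) (simp add: gibbs_potential_def)
  show "gibbs_potential n x > 0" by (simp add: gibbs_potential_def)
  define I J where "I = word n x" and "J = word m ((shift_map ^^ n) x)"
  have IJ: "gibbs_potential n x = exp (log_weight I)" "gibbs_potential m ((shift_map ^^ n) x) = exp (log_weight J)"
    "gibbs_potential (n + m) x = exp (log_weight (I @ J))"
    by (simp_all add: gibbs_potential_def I_def J_def word_add)
  show "inverse (exp ((a + b) * ln C)) * gibbs_potential n x * gibbs_potential m ((shift_map ^^ n) x)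
      \<le> gibbs_potential (n + m) x"
    using log_weight_append_lower[of I J] unfolding IJ exp_minus[symmetric] exp_add[symmetric] by simp
  show "gibbs_potential (n + m) x \<le>
      exp ((a + b) * ln C) * gibbs_potential n x * gibbs_potential m ((shift_map ^^ n) x)"
    using log_weight_append_upper[of I J] unfolding IJ exp_add[symmetric] by simp
qed simp

lemma bounded_distortion_gibbs_potential: "bounded_distortion gibbs_potential"
  unfolding bounded_distortion_def
  by (intro exI[of _ 1]) (auto simp: cylinder_iff gibbs_potential_def)

lemma word_weight_gibbs_potential: "word_weight gibbs_potential I = exp (log_weight I)"
proof -
  have "word_weight gibbs_potential I = (SUP x\<in>cylinder I. exp (log_weight I))"
    unfolding word_weight_def by (intro SUP_cong refl) (simp add: gibbs_potential_def cylinder_iff)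
  then show ?thesis using cylinder_nonempty[of I] by simp
qed

lemma exp_log_weight_powr: "exp (log_weight I) powr (1 / a) = p I * r (map \<pi> I) powr (b / a)"
proof -
  have "exp (log_weight I) powr (1 / a) = exp (ln (p I) + b / a * ln (r (map \<pi> I)))"
    using a_pos by (simp add: powr_def log_weight_def field_simps)
  also have "\<dots> = p I * r (map \<pi> I) powr (b / a)"
    using pos[of I] r_pos[of I] by (simp add: exp_add powr_def)
  finally show ?thesis .
qed

text \<open>On a fibre the power of \<open>r\<close> is constant, and the remaining weights
  \<open>p\<close> add up to \<open>r\<close>.\<close>

lemma factor_word_weight_gibbs_potential:
  "factor_word_weight a \<pi> gibbs_potential (map \<pi> I) = r (map \<pi> I) powr ((a + b) / a)"
proof -
  let ?J = "map \<pi> I"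
  have "factor_word_weight a \<pi> gibbs_potential ?J =
      (\<Sum>I | length I = length ?J \<and> map \<pi> I = ?J. p I * r ?J powr (b / a))"
    unfolding factor_word_weight_def word_weight_gibbs_potential exp_log_weight_powr by (rule sum.cong) auto
  also have "\<dots> = r ?J * r ?J powr (b / a)"
    by (simp add: sum_distrib_right[symmetric] measure_factor_cylinder)
  also have "\<dots> = r ?J powr 1 * r ?J powr (b / a)" using r_pos[of I] by simp
  also have "\<dots> = r ?J powr ((a + b) / a)"
    unfolding powr_add[symmetric] using a_pos by (simp add: add_divide_distrib)
  finally show ?thesis .
qed

lemma integral_log_weight:
  assumes "invariant_shift_measure N"
  shows "(\<integral>x. log_weight (word n x) \<partial>N) =
    a * (\<Sum>I | length I = n. measure N (cylinder I) * ln (p I)) +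
    b * (\<Sum>J | length J = n. measure (factor_measure \<pi> N) (cylinder J) * ln (r J))"
proof -
  interpret N: invariant_shift_measure N by fact
  have "(\<integral>x. log_weight (word n x) \<partial>N) = (\<Sum>I | length I = n. measure N (cylinder I) * log_weight I)"
    by (rule N.integral_word)
  also have "\<dots> = a * (\<Sum>I | length I = n. measure N (cylinder I) * ln (p I)) +
    b * (\<Sum>I | length I = n. measure N (cylinder I) * ln (r (map \<pi> I)))"
    unfolding log_weight_def by (simp add: algebra_simps sum.distrib sum_distrib_left)
  finally show ?thesis
    using N.integral_factor_word[where n = n and \<pi> = \<pi> and g = "\<lambda>J. ln (r J)"] by simp
qed

text \<open>Gibbs inequality for N against M, upstairs and in the factor. In the factor, a word that
  N charges has a nonempty fibre, and \<open>r\<close> is positive there.\<close>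

lemma cross_entropy_bounds:
  assumes "invariant_shift_measure N"
  shows "(\<Sum>I | length I = n. measure N (cylinder I) * ln (p I)) \<le> - block_entropy N n"
    and "(\<Sum>J | length J = n. measure (factor_measure \<pi> N) (cylinder J) * ln (r J))
      \<le> - block_entropy (factor_measure \<pi> N) n"
proof -
  interpret N: invariant_shift_measure N by fact
  interpret N': invariant_shift_measure "factor_measure \<pi> N" by (rule N.invariant_factor)
  interpret F: invariant_shift_measure "factor_measure \<pi> M" by (rule invariant_factor)
  show "(\<Sum>I | length I = n. measure N (cylinder I) * ln (p I)) \<le> - block_entropy N n"
    unfolding N.block_entropy_eq ent_def sum_negf minus_minus using pos
    by (intro gibbs_inequality) (auto simp: sum_measure_cylinder N.sum_measure_cylinder)
  show "(\<Sum>J | length J = n. measure (factor_measure \<pi> N) (cylinder J) * ln (r J))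
     \<le> - block_entropy (factor_measure \<pi> N) n"
    unfolding N'.block_entropy_eq ent_def sum_negf minus_minus
  proof (intro gibbs_inequality)
    fix J :: "'d list"
    assume "measure (factor_measure \<pi> N) (cylinder J) > 0"
    then have "{I. length I = length J \<and> map \<pi> I = J} \<noteq> {}"
      unfolding N.measure_factor_cylinder by (metis (no_types, lifting) less_irrefl sum.empty)
    then show "r J > 0" using r_pos by auto
  qed (auto simp: F.sum_measure_cylinder N'.sum_measure_cylinder)
qed

lemma potential_entropy_bound:
  assumes "invariant_shift_measure N"
  shows "(\<integral>x. log_weight (word n x) \<partial>N) + weighted_block_entropy a b \<pi> N n \<le> 0"
  using mult_left_mono[OF cross_entropy_bounds(1)[OF assms, of n], of a]
    mult_left_mono[OF cross_entropy_bounds(2)[OF assms, of n], of b] a_pos b_nonneg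
  unfolding integral_log_weight[OF assms] by (simp add: weighted_block_entropy_def)

text \<open>The sum of the two Gibbs bounds can be nonnegative only if the bound upstairs is sharp,
  where \<open>a > 0\<close> enters; the equality case then identifies the cylinder weights of this
  length.\<close>

lemma potential_entropy_equality:
  assumes N: "invariant_shift_measure N"
    and ge: "(\<integral>x. log_weight (word (length I) x) \<partial>N) + weighted_block_entropy a b \<pi> N (length I) \<ge> 0"
  shows "measure N (cylinder I) = p I"
proof -
  interpret N: invariant_shift_measure N by fact
  let ?n = "length I"
  have "a * (\<Sum>I | length I = ?n. measure N (cylinder I) * ln (p I)) \<ge> a * - block_entropy N ?n"
    using ge mult_left_mono[OF cross_entropy_bounds(2)[OF N, of ?n] b_nonneg]
    unfolding integral_log_weight[OF N] by (simp add: weighted_block_entropy_def)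
  then have "(\<Sum>I | length I = ?n. measure N (cylinder I) * ln (p I)) \<ge> - block_entropy N ?n"
    using a_pos by (simp only: mult_le_cancel_left_pos)
  then have "(\<Sum>I | length I = ?n. measure N (cylinder I) * ln (measure N (cylinder I)))
      \<le> (\<Sum>I | length I = ?n. measure N (cylinder I) * ln (p I))"
    by (simp add: N.block_entropy_eq ent_def sum_negf)
  then show ?thesis
    using pos by (intro gibbs_equality[where S = "{I. length I = ?n}"])
      (auto simp: sum_measure_cylinder N.sum_measure_cylinder)
qed

lemma potential_entropy_eq:
  "(\<integral>x. log_weight (word n x) \<partial>M) + weighted_block_entropy a b \<pi> M n = 0"
proof -
  interpret F: invariant_shift_measure "factor_measure \<pi> M" by (rule invariant_factor)
  have "invariant_shift_measure M" by unfold_locales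
  from integral_log_weight[OF this] show ?thesis
    by (simp add: weighted_block_entropy_def block_entropy_eq F.block_entropy_eq ent_def sum_negf)
qed

lemma potential_average_tendsto:
  assumes "invariant_shift_measure N"
  shows "(\<lambda>n. (\<integral>x. log_weight (word n x) \<partial>N) / real n) \<longlonglongrightarrow> potential_average gibbs_potential N"
proof -
  interpret N: invariant_shift_measure N by fact
  obtain L where L: "(\<lambda>n. (\<integral>x. log_weight (word n x) \<partial>N) / real n) \<longlonglongrightarrow> L"
    using N.almost_additive_average_convergent[OF log_weight_append_upper log_weight_append_lower] by metis
  then have "potential_average gibbs_potential N = L"
    unfolding potential_average_def gibbs_potential_def by (simp add: limI)
  with L show ?thesis by simp
qed

text \<open>The potential term and the weighted block entropy add up to at most zero at every
  length, and to exactly zero for M itself. Both facts survive division by n and passage to the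
  limit, so M attains the supremum.\<close>

lemma weighted_pressure_gibbs_potential: "weighted_pressure a b \<pi> gibbs_potential = 0"
proof (rule antisym)
  have tends: "(\<lambda>n. ((\<integral>x. log_weight (word n x) \<partial>N) + weighted_block_entropy a b \<pi> N n) / real n)
      \<longlonglongrightarrow> potential_average gibbs_potential N + weighted_rate a b \<pi> N"
    if "invariant_shift_measure N" for N
    unfolding add_divide_distrib
    by (intro tendsto_add potential_average_tendsto that
        invariant_shift_measure.weighted_block_entropy_tendsto)
  show "weighted_pressure a b \<pi> gibbs_potential \<le> 0"
    unfolding weighted_pressure_def
  proof (rule SUP_least)
    fix N :: "(nat \<Rightarrow> 'a) measure" assume "N \<in> invariant_measures shift_map"
    then have N: "invariant_shift_measure N" by (simp add: invariant_shift_measure_iff)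
    have "potential_average gibbs_potential N + weighted_rate a b \<pi> N \<le> 0"
      by (rule LIMSEQ_le_const2[OF tends[OF N]])
        (auto intro!: exI[of _ 0] divide_nonpos_nonneg potential_entropy_bound N)
    then show "ereal (potential_average gibbs_potential N) + weighted_entropy a b \<pi> N \<le> 0"
      by (simp add: invariant_shift_measure.weighted_entropy_eq[OF N])
  qed
  have M: "invariant_shift_measure M" by unfold_locales
  have "potential_average gibbs_potential M + weighted_rate a b \<pi> M = 0"
    using tends[OF M] by (simp add: potential_entropy_eq LIMSEQ_const_iff)
  then have "0 = ereal (potential_average gibbs_potential M) + weighted_entropy a b \<pi> M"
    by (simp add: weighted_entropy_eq zero_ereal_def)
  also have "\<dots> \<le> weighted_pressure a b \<pi> gibbs_potential"
    unfolding weighted_pressure_def using M by (intro SUP_upper) (simp add: invariant_shift_measure_iff)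
  finally show "0 \<le> weighted_pressure a b \<pi> gibbs_potential" .
qed

theorem weighted_gibbs: "weighted_gibbs_measure a b \<pi> M"
  unfolding weighted_gibbs_measure_def
proof (intro conjI exI[of _ gibbs_potential] exI[of _ 1] allI impI)
  fix n and I :: "'a list"
  have "a + b \<noteq> 0" using a_pos b_nonneg by simp
  then have "(a + b) / a * (- b / (a + b)) = - (b / a)" by simp
  then have "p I / (exp (- real n * real_of_ereal (weighted_pressure a b \<pi> gibbs_potential) / (a + b)) *
       word_weight gibbs_potential I powr (1 / a) *
       factor_word_weight a \<pi> gibbs_potential (map \<pi> I) powr (- b / (a + b)))
     = p I / (p I * r (map \<pi> I) powr (b / a) * r (map \<pi> I) powr (- (b / a)))"
    unfolding weighted_pressure_gibbs_potential word_weight_gibbs_potential exp_log_weight_powr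
      factor_word_weight_gibbs_potential powr_powr by simp
  also have "\<dots> = 1"
    using pos[of I] r_pos[of I] by (simp add: powr_minus field_simps)
  finally show "p I / (exp (- real n * real_of_ereal (weighted_pressure a b \<pi> gibbs_potential) / (a + b)) *
       word_weight gibbs_potential I powr (1 / a) *
       factor_word_weight a \<pi> gibbs_potential (map \<pi> I) powr (- b / (a + b))) \<in> {inverse 1..1}"
    by (simp only: inverse_1 atLeastAtMost_iff order_refl simp_thms)
qed (auto simp: sets_M intro: prob_space_axioms almost_additive_gibbs_potential bounded_distortion_gibbs_potential)

end

section \<open>Markov approximation\<close>

text \<open>The conditional entropies \<open>H\<^sub>n(X | Y)\<close> are subadditive, so \<open>h(X | Y)\<close> is their infimum.\<close>

lemma (in invariant_shift_measure) relative_entropy_rate_le: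
  fixes \<pi> :: "'a \<Rightarrow> 'd::{finite,discrete_topology}"
  assumes "m \<ge> 1"
  shows "entropy_rate M - entropy_rate (factor_measure \<pi> M) \<le>
    (block_entropy M m - block_entropy (factor_measure \<pi> M) m) / real m"
proof -
  interpret F: invariant_shift_measure "factor_measure \<pi> M" by (rule invariant_factor)
  define Y where "Y n x = map \<pi> (word n x)" for n and x :: "nat \<Rightarrow> 'a"
  have Y: "simple_function M (Y n)" for n
    unfolding Y_def[abs_def] by (rule simple_function_word_comp)
  define R where "R n = cond_entropy M (word n) (Y n)" for n
  have fac: "var_entropy M (Y n) = block_entropy (factor_measure \<pi> M) n" for n
  proof -
    have "var_entropy M (Y n) = (\<Sum>J | length J = n. ent (law M (Y n) J))"
      by (rule var_entropy_superset) (auto simp: Y_def)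
    moreover have "law M (Y n) J = measure (factor_measure \<pi> M) (cylinder J)" if "length J = n" for J
      unfolding law_def measure_factor[OF cylinder_borel] using that
      by (intro arg_cong[where f = "measure M"]) (auto simp: Y_def map_word cylinder_iff)
    ultimately show ?thesis by (simp add: F.block_entropy_eq)
  qed
  \<comment> \<open>The word determines its image, so the joint entropy is the block entropy of M
    and R is a plain difference.\<close>
  have R: "R n = block_entropy M n - block_entropy (factor_measure \<pi> M) n" for n
  proof -
    have "var_entropy M (\<lambda>x. (word n x, Y n x)) = block_entropy M n"
      unfolding block_entropy_def
      by (rule var_entropy_cong[OF simple_function_Pair[OF simple_function_word Y] simple_function_word])
        (auto simp: Y_def)
    then show ?thesis by (simp add: R_def cond_entropy_def fac)
  qed
  \<comment> \<open>The two parts of the long word are separated, and the conditioning on the long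
    image is relaxed to the image of the respective part.\<close>
  have sub: "R (m + n) \<le> R m + R n" for m n
  proof -
    let ?W = "\<lambda>x. word n ((shift_map ^^ m) x)" and ?V = "\<lambda>x. Y n ((shift_map ^^ m) x)"
    have W: "simple_function M ?W" and V: "simple_function M ?V"
      by (rule simple_function_shift, rule simple_function_word) (rule simple_function_shift, rule Y)
    have Ysplit: "Y (m + n) x = Y m x @ ?V x" for x by (simp add: Y_def word_add)
    have "R (m + n) = cond_entropy M (\<lambda>x. (word m x, ?W x)) (Y (m + n))"
      unfolding R_def
      by (rule cond_entropy_cong[OF simple_function_word simple_function_Pair[OF simple_function_word W] Y])
        (simp add: word_add)
    also have "\<dots> \<le> cond_entropy M (word m) (Y (m + n)) + cond_entropy M ?W (Y (m + n))"
      by (rule cond_entropy_pair[OF simple_function_word W Y])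
    also have "cond_entropy M (word m) (Y (m + n)) \<le> R m"
      unfolding R_def
      by (rule cond_entropy_antimono[OF simple_function_word Y Y]) (auto simp: Y_def word_add)
    also have "cond_entropy M ?W (Y (m + n)) \<le> cond_entropy M ?W ?V"
      by (rule cond_entropy_antimono[OF W Y V]) (auto simp: Y_def word_add)
    also have "cond_entropy M ?W ?V = R n"
      unfolding R_def
      by (rule cond_entropy_mp[OF simple_function_word Y measurable_shift_funpow distr_shift_funpow])
    finally show ?thesis by simp
  qed
  have lim: "(\<lambda>n. R n / real n) \<longlonglongrightarrow> entropy_rate M - entropy_rate (factor_measure \<pi> M)"
    unfolding R diff_divide_distrib
    by (intro tendsto_diff block_entropy_tendsto F.block_entropy_tendsto)
  have R_nonneg: "0 \<le> R n" for n
    using var_entropy_mono[OF simple_function_word, of n "Y n"] fac[of n]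
    by (simp add: R block_entropy_def[of M] Y_def)
  obtain L where "(\<lambda>n. R n / real n) \<longlonglongrightarrow> L" "\<And>n. n \<ge> 1 \<Longrightarrow> L \<le> R n / real n"
    using subadditive_div_convergent[of R 0] sub R_nonneg by (metis divide_nonneg_nonneg of_nat_0_le_iff)
  with lim assms show ?thesis
    unfolding R[symmetric] by (metis LIMSEQ_unique)
qed

section \<open>Markov weights\<close>

locale positive_shift_measure = invariant_shift_measure +
  assumes pos: "measure M (cylinder I) > 0"
begin

abbreviation p :: "'a list \<Rightarrow> real" where "p I \<equiv> measure M (cylinder I)"

text \<open>Cylinder weights of the \<open>k\<close>-step Markov measure with the \<open>(k + 1)\<close>-block marginals of \<open>M\<close>:
  by truncated subtraction the history in the \<open>j\<close>-th factor consists of the last \<open>min j k\<close> letters.\<close>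

definition markov_weight :: "nat \<Rightarrow> 'a list \<Rightarrow> real" where
  "markov_weight k I = (\<Prod>j<length I. p (drop (j - k) (take (Suc j) I)) / p (drop (j - k) (take j I)))"

lemma markov_weight_Nil [simp]: "markov_weight k [] = 1"
  by (simp add: markov_weight_def)

lemma markov_weight_snoc:
  "markov_weight k (I @ [x]) =
     markov_weight k I * (p (drop (length I - k) I @ [x]) / p (drop (length I - k) I))"
  by (simp add: markov_weight_def)

lemma markov_weight_pos: "markov_weight k I > 0"
  unfolding markov_weight_def using pos by (intro prod_pos) simp

lemma sum_markov_weight_snoc: "(\<Sum>x\<in>UNIV. markov_weight k (I @ [x])) = markov_weight k I"
  using pos[of "drop (length I - k) I"]
  by (simp add: markov_weight_snoc sum_distrib_left[symmetric] sum_divide_distrib[symmetric] measure_cylinder_snoc)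

text \<open>Up to this length no history is truncated, and the product of transition probabilities
  telescopes.\<close>

lemma markov_weight_short: "length I \<le> Suc k \<Longrightarrow> markov_weight k I = p I"
proof (induction I rule: rev_induct)
  case Nil
  then show ?case using prob_space by simp
next
  case (snoc x I)
  then show ?case using pos[of I] by (simp add: markov_weight_snoc)
qed

text \<open>Stationarity. Short words reduce to the invariance of M. Once I has at least k letters,
  the history of the last letter lies inside I, so its factor does not see the prepended letter and
  induction applies.\<close>

lemma sum_markov_weight_Cons: "(\<Sum>y\<in>UNIV. markov_weight k (y # I)) = markov_weight k I"
proof (induction I rule: rev_induct)
  case Nil
  then show ?case
    using measure_cylinder_Cons[of "[]"] prob_space by (simp add: markov_weight_short)
next
  case (snoc x I)
  show ?case
  proof (cases "length I < k")
    case True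
    then show ?thesis by (simp add: markov_weight_short measure_cylinder_Cons)
  next
    case False
    then have "drop (length (y # I) - k) (y # I) = drop (length I - k) I" for y
      by (simp add: Suc_diff_le)
    then have "markov_weight k ((y # I) @ [x]) =
        markov_weight k (y # I) * (p (drop (length I - k) I @ [x]) / p (drop (length I - k) I))" for y
      by (simp only: markov_weight_snoc)
    then have "(\<Sum>y\<in>UNIV. markov_weight k (y # I @ [x])) =
        (\<Sum>y\<in>UNIV. markov_weight k (y # I)) * (p (drop (length I - k) I @ [x]) / p (drop (length I - k) I))"
      by (simp only: append_Cons sum_distrib_right)
    then show ?thesis by (simp only: snoc.IH markov_weight_snoc)
  qed
qed

text \<open>Placing I in front of J changes the history of at most the first k letters of J. Each
  affected transition probability lies between d and one, so it costs at most a factor d; hence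
  \<open>C = 1 / d ^ k\<close>.\<close>

lemma markov_weight_quasi_bernoulli:
  obtains C where
    "\<And>I J. markov_weight k (I @ J) \<le> C * (markov_weight k I * markov_weight k J)"
    "\<And>I J. markov_weight k I * markov_weight k J \<le> C * markov_weight k (I @ J)"
proof -
  let ?S = "{I :: 'a list. length I \<le> Suc k}"
  have fin: "finite ?S" using finite_lists_length_le[of "UNIV :: 'a set" "Suc k"] by simp
  \<comment> \<open>A lower bound for all transition probabilities with histories of at most k
    letters: the minimum runs over the finitely many words of length at most
    \<open>k + 1\<close>.\<close>
  define d where "d = Min (p ` ?S)"
  have "d \<in> p ` ?S" unfolding d_def using fin by (intro Min_in) (auto intro: exI[of _ "[]"])
  then have d_pos: "d > 0" and d_le_1: "d \<le> 1" using pos by auto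
  have d_le: "d \<le> p I" if "length I \<le> Suc k" for I
    unfolding d_def using fin that by (intro Min_le) auto
  define t where "t L x = p (L @ [x]) / p L" for L x
  have t_pos: "t L x > 0" for L x using pos by (simp add: t_def)
  have t_le: "t L x \<le> 1" for L x
    using pos[of L] by (auto simp: t_def cylinder_snoc intro!: finite_measure_mono)
  have t_ge: "d \<le> t L x" if "length L \<le> k" for L x
  proof -
    have "d \<le> p (L @ [x])" using that by (intro d_le) simp
    also have "\<dots> = t L x * p L" using pos[of L] by (simp add: t_def)
    also have "\<dots> \<le> t L x * 1" using t_pos[of L x] by (intro mult_left_mono) auto
    finally show ?thesis by simp
  qed
  have snoc: "markov_weight k (I @ [x]) = markov_weight k I * t (drop (length I - k) I) x" for I x
    by (simp add: markov_weight_snoc t_def)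
  \<comment> \<open>The exponent counts the letters of J whose history can be altered by I; beyond k
    letters it stays constant because the two transition probabilities coincide.\<close>
  have key: "d ^ min (length J) k * (markov_weight k I * markov_weight k J) \<le> markov_weight k (I @ J) \<and>
      d ^ min (length J) k * markov_weight k (I @ J) \<le> markov_weight k I * markov_weight k J" for I J
  proof (induction J rule: rev_induct)
    case (snoc x J)
    define t1 t2 u v w where "t1 = t (drop (length (I @ J) - k) (I @ J)) x"
      and "t2 = t (drop (length J - k) J) x"
      and "u = markov_weight k I" and "v = markov_weight k J" and "w = markov_weight k (I @ J)"
    have pos': "t1 > 0" "t2 > 0" "u > 0" "v > 0" "w > 0"
      by (simp_all add: t1_def t2_def u_def v_def w_def t_pos markov_weight_pos)
    have eq: "markov_weight k (I @ J @ [x]) = w * t1" "markov_weight k (J @ [x]) = v * t2"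
      using \<open>\<And>I x. markov_weight k (I @ [x]) = markov_weight k I * t (drop (length I - k) I) x\<close>[of "I @ J" x]
        \<open>\<And>I x. markov_weight k (I @ [x]) = markov_weight k I * t (drop (length I - k) I) x\<close>[of J x]
      by (simp_all add: w_def v_def t1_def t2_def)
    let ?e = "d ^ min (length J) k"
    have IH: "?e * (u * v) \<le> w" "?e * w \<le> u * v"
      using snoc.IH by (simp_all add: u_def v_def w_def)
    show ?case
    proof (cases "length J < k")
      case True
      have len: "length (drop (length L - k) L) \<le> k" for L :: "'a list" by simp
      have t: "d \<le> t1" "d \<le> t2" "t1 \<le> 1" "t2 \<le> 1"
        unfolding t1_def t2_def by (intro t_ge t_le len)+
      have dt: "d * t2 \<le> t1" "d * t1 \<le> t2"
        using t d_pos mult_left_mono[of t2 1 d] mult_left_mono[of t1 1 d] by linarith+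
      have "min (length (J @ [x])) k = Suc (min (length J) k)" using True by simp
      then have e: "d ^ min (length (J @ [x])) k = ?e * d" by simp
      have "(?e * (u * v)) * (d * t2) \<le> w * t1"
        by (rule mult_mono) (use IH dt pos' d_pos in auto)
      moreover have "(?e * w) * (d * t1) \<le> (u * v) * t2"
        by (rule mult_mono) (use IH dt pos' d_pos in auto)
      ultimately show ?thesis
        unfolding eq e u_def[symmetric] by (simp add: mult_ac)
    next
      case False
      then have "t1 = t2" by (simp add: t1_def t2_def)
      moreover have "min (length (J @ [x])) k = min (length J) k" using False by simp
      moreover have "(?e * (u * v)) * t2 \<le> w * t2" "(?e * w) * t2 \<le> (u * v) * t2"
        using IH pos' by (intro mult_right_mono; simp)+
      ultimately show ?thesis
        unfolding eq u_def[symmetric] by (simp add: mult_ac)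
    qed
  qed simp
  have weaken: "X \<le> 1 / d ^ k * Z" if "d ^ min n k * X \<le> Z" "X > 0" for X Z n
  proof -
    have "d ^ k * X \<le> d ^ min n k * X"
      using that d_pos d_le_1 by (intro mult_right_mono power_decreasing) auto
    then have "d ^ k * X \<le> Z" using that(1) by (rule order_trans)
    then show ?thesis using d_pos by (simp add: field_simps)
  qed
  show ?thesis
  proof (rule that[of "1 / d ^ k"])
    fix I J :: "'a list"
    show "markov_weight k (I @ J) \<le> 1 / d ^ k * (markov_weight k I * markov_weight k J)"
      using key[of J I] by (intro weaken[of "length J"]) (auto simp: markov_weight_pos)
    show "markov_weight k I * markov_weight k J \<le> 1 / d ^ k * markov_weight k (I @ J)"
      using key[of J I] by (intro weaken[of "length J"]) (auto simp: markov_weight_pos)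
  qed
qed

text \<open>The logarithm is a sum of functions of words of at most \<open>k + 1\<close> consecutive
  letters. Its integral against an invariant measure is therefore fixed by the marginals of that
  length, and the right-hand side no longer mentions N.\<close>

lemma integral_ln_markov_weight:
  assumes N: "invariant_shift_measure N"
    and agree: "\<And>I. length I \<le> Suc k \<Longrightarrow> measure N (cylinder I) = p I"
  shows "(\<integral>x. ln (markov_weight k (word n x)) \<partial>N) =
    (\<Sum>j<n. \<Sum>K | length K = Suc j - (j - k). p K * (ln (p K) - ln (p (butlast K))))"
proof -
  interpret N: invariant_shift_measure N by fact
  \<comment> \<open>The logarithm of the probability of the last letter of K given the preceding
    ones.\<close>
  define G where "G K = ln (p K) - ln (p (butlast K))" for K
  have p_nonzero: "p I \<noteq> 0" for I using pos[of I] by simp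
  have ln_eq: "ln (markov_weight k (word n x)) =
      (\<Sum>j<n. G (word (Suc j - (j - k)) ((shift_map ^^ (j - k)) x)))" for x
  proof -
    have "ln (markov_weight k (word n x)) =
      (\<Sum>j<n. ln (p (drop (j - k) (take (Suc j) (word n x))) / p (drop (j - k) (take j (word n x)))))"
      unfolding markov_weight_def length_word by (intro ln_prod) (auto simp: p_nonzero)
    also have "\<dots> = (\<Sum>j<n. G (word (Suc j - (j - k)) ((shift_map ^^ (j - k)) x)))"
    proof (intro sum.cong refl)
      fix j assume "j \<in> {..<n}"
      then have j: "Suc j \<le> n" "j \<le> n" by auto
      have "drop (j - k) (take j (word n x)) = butlast (drop (j - k) (take (Suc j) (word n x)))"
        using j by (simp add: take_word drop_word word_Suc Suc_diff_le)
      then have "ln (p (drop (j - k) (take (Suc j) (word n x))) / p (drop (j - k) (take j (word n x))))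
         = G (drop (j - k) (take (Suc j) (word n x)))"
        by (simp add: G_def ln_div p_nonzero)
      then show "ln (p (drop (j - k) (take (Suc j) (word n x))) / p (drop (j - k) (take j (word n x))))
         = G (word (Suc j - (j - k)) ((shift_map ^^ (j - k)) x))"
        using j by (simp only: take_word drop_word)
    qed
    finally show ?thesis .
  qed
  have "(\<integral>x. ln (markov_weight k (word n x)) \<partial>N) =
      (\<Sum>j<n. \<integral>x. G (word (Suc j - (j - k)) ((shift_map ^^ (j - k)) x)) \<partial>N)"
    unfolding ln_eq by (intro Bochner_Integration.integral_sum N.integrable_word_shift)
  also have "\<dots> = (\<Sum>j<n. \<Sum>K | length K = Suc j - (j - k). p K * G K)"
    unfolding N.integral_word_shift N.integral_word by (intro sum.cong) (auto simp: agree)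
  finally show ?thesis by (simp add: G_def)
qed

text \<open>The logarithm of the Markov weight has the same integral under N and under M. Under N
  this integral is minus the block entropy; under M it is at most minus the block entropy, by the
  Gibbs inequality.\<close>

lemma block_entropy_le_markov:
  assumes N: "invariant_shift_measure N" and N_eq: "\<And>I. measure N (cylinder I) = markov_weight k I"
  shows "block_entropy M n \<le> block_entropy N n"
proof -
  interpret N: invariant_shift_measure N by fact
  have M: "invariant_shift_measure M" by unfold_locales
  have "- block_entropy N n = (\<Sum>I | length I = n. measure N (cylinder I) * ln (markov_weight k I))"
    by (simp add: N.block_entropy_eq ent_def sum_negf N_eq)
  also have "\<dots> = (\<integral>x. ln (markov_weight k (word n x)) \<partial>N)"
    by (rule N.integral_word[symmetric])
  also have "\<dots> = (\<integral>x. ln (markov_weight k (word n x)) \<partial>M)"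
    by (subst (1 2) integral_ln_markov_weight) (auto simp: M N N_eq markov_weight_short)
  also have "\<dots> = (\<Sum>I | length I = n. p I * ln (markov_weight k I))"
    by (rule integral_word)
  also have "\<dots> \<le> (\<Sum>I | length I = n. p I * ln (p I))"
    using N.sum_measure_cylinder[of n] sum_measure_cylinder[of n]
    by (intro gibbs_inequality) (auto simp: markov_weight_pos less_imp_le N_eq)
  also have "\<dots> = - block_entropy M n" by (simp add: block_entropy_eq ent_def sum_negf)
  finally show ?thesis by simp
qed

text \<open>The lower bound combines \<open>h(N) \<ge> h(M)\<close>, used with weight a and again
  inside the factor term with weight b. Block length \<open>Suc k\<close> is the largest at which
  the marginals are known to agree, and it leaves only quantities of M on the right.\<close>

lemma exists_markov_approximation:
  fixes \<pi> :: "'a \<Rightarrow> 'd::{finite,discrete_topology}"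
  assumes "a > 0" "b \<ge> 0"
  obtains N where "invariant_shift_measure N" "weighted_gibbs_measure a b \<pi> N"
    "\<And>I. length I \<le> Suc k \<Longrightarrow> measure N (cylinder I) = p I"
    "weighted_rate a b \<pi> N \<ge> (a + b) * entropy_rate M -
       b * ((block_entropy M (Suc k) - block_entropy (factor_measure \<pi> M) (Suc k)) / real (Suc k))"
proof -
  obtain N where N: "invariant_shift_measure N" and N_eq: "\<And>I. measure N (cylinder I) = markov_weight k I"
    using exists_invariant_shift_measure[of "markov_weight k"] markov_weight_pos markov_weight_Nil
      sum_markov_weight_snoc sum_markov_weight_Cons by metis
  interpret N: invariant_shift_measure N by fact
  interpret F: invariant_shift_measure "factor_measure \<pi> M" by (rule invariant_factor)
  interpret NF: invariant_shift_measure "factor_measure \<pi> N" by (rule N.invariant_factor)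
  obtain C where C: "\<And>I J. markov_weight k (I @ J) \<le> C * (markov_weight k I * markov_weight k J)"
    "\<And>I J. markov_weight k I * markov_weight k J \<le> C * markov_weight k (I @ J)"
    using markov_weight_quasi_bernoulli by metis
  have "quasi_bernoulli_measure N C a b"
    using assms C by unfold_locales (auto simp: N_eq markov_weight_pos)
  then have gibbs: "weighted_gibbs_measure a b \<pi> N" by (rule quasi_bernoulli_measure.weighted_gibbs)
  have agree: "measure N (cylinder I) = p I" if "length I \<le> Suc k" for I
    using that by (simp add: N_eq markov_weight_short)
  have bM: "block_entropy N (Suc k) = block_entropy M (Suc k)"
    unfolding N.block_entropy_eq block_entropy_eq by (intro sum.cong) (auto simp: agree)
  have "measure (factor_measure \<pi> N) (cylinder J) = measure (factor_measure \<pi> M) (cylinder J)"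
    if "length J = Suc k" for J
    unfolding N.measure_factor_cylinder measure_factor_cylinder
    using that by (intro sum.cong) (auto simp: agree)
  then have bF: "block_entropy (factor_measure \<pi> N) (Suc k) = block_entropy (factor_measure \<pi> M) (Suc k)"
    unfolding NF.block_entropy_eq F.block_entropy_eq by (intro sum.cong) auto
  have h: "entropy_rate M \<le> entropy_rate N"
    by (rule LIMSEQ_le[OF block_entropy_tendsto N.block_entropy_tendsto])
      (auto intro!: divide_right_mono block_entropy_le_markov[OF N N_eq])
  have "entropy_rate N - entropy_rate (factor_measure \<pi> N) \<le>
      (block_entropy M (Suc k) - block_entropy (factor_measure \<pi> M) (Suc k)) / real (Suc k)"
    using N.relative_entropy_rate_le[of "Suc k" \<pi>] by (simp only: bM bF)
  then have "b * entropy_rate (factor_measure \<pi> N) \<ge> b * (entropy_rate M -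
      (block_entropy M (Suc k) - block_entropy (factor_measure \<pi> M) (Suc k)) / real (Suc k))"
    using h assms by (intro mult_left_mono) auto
  moreover have "a * entropy_rate M \<le> a * entropy_rate N" using h assms by simp
  ultimately have "weighted_rate a b \<pi> N \<ge> (a + b) * entropy_rate M -
       b * ((block_entropy M (Suc k) - block_entropy (factor_measure \<pi> M) (Suc k)) / real (Suc k))"
    by (simp add: weighted_rate_def algebra_simps)
  with N gibbs agree show ?thesis using that by blast
qed

end

section \<open>Approximation by weighted Gibbs measures\<close>

lemma sum_singleton_words:
  "(\<Sum>I | length I = Suc 0 \<and> map \<pi> I = [d]. f I) = (\<Sum>j | \<pi> j = d. f [j])"
  by (rule sum.reindex_bij_witness[of _ "\<lambda>j. [j]" hd]) (auto simp: length_Suc_conv)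

text \<open>The maximiser is the Bernoulli measure whose letter weights are constant on the fibres of \<open>\<pi>\<close>,
  with \<open>p(i) = N(\<pi> i) powr (- b / (a + b)) / Z\<close> for the fibre sizes \<open>N\<close>: this choice makes
  \<open>a ln p(i) + b ln (N(\<pi> i) p(i))\<close> independent of \<open>i\<close>.\<close>

lemma exists_maximal_bernoulli:
  fixes \<pi> :: "'a::{finite,discrete_topology} \<Rightarrow> 'd::{finite,discrete_topology}"
  assumes a: "a > 0" and b: "b \<ge> 0"
  obtains L where "positive_shift_measure L" "weighted_gibbs_measure a b \<pi> L"
    "\<And>N. invariant_shift_measure N \<Longrightarrow> weighted_rate a b \<pi> N \<le> weighted_rate a b \<pi> L"
    "\<And>N. invariant_shift_measure N \<Longrightarrow> weighted_rate a b \<pi> N = weighted_rate a b \<pi> L \<Longrightarrow> N = L"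
proof -
  define F where "F d = real (card {i. \<pi> i = d})" for d
  have F_pos: "F (\<pi> i) > 0" for i by (auto simp: F_def card_gt_0_iff)
  define u where "u i = F (\<pi> i) powr (- b / (a + b))" for i
  have u_pos: "u i > 0" for i unfolding u_def using F_pos[of i] by simp
  define Z where "Z = (\<Sum>i\<in>UNIV. u i)"
  have Z_pos: "Z > 0" unfolding Z_def using u_pos by (intro sum_pos) auto
  define lam where "lam i = u i / Z" for i
  have lam_pos: "lam i > 0" for i using u_pos Z_pos by (simp add: lam_def)
  have lam_sum: "(\<Sum>i\<in>UNIV. lam i) = 1"
    using Z_pos by (simp add: lam_def sum_divide_distrib[symmetric] Z_def[symmetric])
  define w where "w I = prod_list (map lam I)" for I
  have w_pos: "w I > 0" for I unfolding w_def by (induction I) (auto simp: lam_pos)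
  have w_append: "w (I @ J) = w I * w J" for I J by (simp add: w_def)
  obtain L where L: "invariant_shift_measure L" and L_eq: "\<And>I. measure L (cylinder I) = w I"
  proof (rule exists_invariant_shift_measure[of w])
    show "(\<Sum>x\<in>UNIV. w (I @ [x])) = w I" "(\<Sum>x\<in>UNIV. w (x # I)) = w I" for I
      by (simp_all add: w_def sum_distrib_left[symmetric] sum_distrib_right[symmetric] lam_sum)
    show "w I > 0" for I by (rule w_pos)
    show "w [] = 1" by (simp add: w_def)
  qed blast
  interpret L: invariant_shift_measure L by fact
  have "quasi_bernoulli_measure L 1 a b"
    using a b by unfold_locales (auto simp: L_eq w_pos w_append)
  then interpret Q: quasi_bernoulli_measure L 1 \<pi> a b .
  \<comment> \<open>With quasi-Bernoulli constant one, \<open>ln C\<close> vanishes and almost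
    additivity becomes additivity.\<close>
  have g_append: "Q.log_weight (I @ J) = Q.log_weight I + Q.log_weight J" for I J
    using Q.log_weight_append_upper[of I J] Q.log_weight_append_lower[of I J] by simp
  \<comment> \<open>This turns out to be the maximal weighted entropy; the normalising sum Z plays
    the part of a partition function.\<close>
  define P where "P = (a + b) * ln Z"
  have g_letter: "Q.log_weight [i] = - P" for i
  proof -
    have "measure (factor_measure \<pi> L) (cylinder [\<pi> i]) = (\<Sum>j | \<pi> j = \<pi> i. lam j)"
      unfolding L.measure_factor_cylinder L_eq by (simp add: sum_singleton_words w_def)
    also have "\<dots> = (\<Sum>j | \<pi> j = \<pi> i. lam i)"
      by (intro sum.cong) (auto simp: lam_def u_def)
    also have "\<dots> = F (\<pi> i) * lam i" by (simp add: F_def)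
    finally have "Q.log_weight [i] = a * ln (lam i) + b * ln (F (\<pi> i) * lam i)"
      by (simp add: Q.log_weight_def L_eq w_def)
    also have "\<dots> = (a + b) * ln (lam i) + b * ln (F (\<pi> i))"
      using F_pos[of i] lam_pos[of i] by (simp add: ln_mult algebra_simps)
    also have "ln (lam i) = - b / (a + b) * ln (F (\<pi> i)) - ln Z"
      using u_pos[of i] Z_pos F_pos[of i] by (simp add: lam_def ln_div u_def ln_powr)
    also have "(a + b) * (- b / (a + b) * ln (F (\<pi> i)) - ln Z) + b * ln (F (\<pi> i)) = - P"
    proof -
      have "a + b \<noteq> 0" using a b by simp
      then show ?thesis by (simp add: P_def right_diff_distrib)
    qed
    finally show ?thesis .
  qed
  have g_eq: "Q.log_weight I = - P * real (length I)" for I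
  proof (induction I)
    case Nil
    show ?case using g_append[of "[]" "[]"] by simp
  next
    case (Cons i I)
    then show ?case using g_append[of "[i]" I] g_letter[of i] by (simp add: algebra_simps)
  qed
  \<comment> \<open>The potential term is the same for every measure, so the Gibbs bound becomes a
    bound on weighted entropy alone.\<close>
  have int_g: "(\<integral>x. Q.log_weight (word n x) \<partial>N) = - P * real n" if "invariant_shift_measure N" for n N
  proof -
    interpret N: invariant_shift_measure N by fact
    show ?thesis unfolding g_eq length_word using N.prob_space by simp
  qed
  have le_P: "weighted_rate a b \<pi> N \<le> P" if N: "invariant_shift_measure N" for N
  proof -
    have "weighted_rate a b \<pi> N \<le> weighted_block_entropy a b \<pi> N 1 / real 1"
      using a b by (intro invariant_shift_measure.weighted_rate_le[OF N]) auto
    also have "\<dots> \<le> P" using Q.potential_entropy_bound[OF N, of 1] int_g[OF N, of 1] by simp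
    finally show ?thesis .
  qed
  have "weighted_block_entropy a b \<pi> L n / real n = P" if "n \<ge> 1" for n
    using Q.potential_entropy_eq[of n] int_g[OF L, of n] that by (simp add: field_simps)
  then have "(\<lambda>n. weighted_block_entropy a b \<pi> L n / real n) \<longlonglongrightarrow> P"
    by (intro tendsto_eventually eventually_sequentiallyI[of 1])
  then have L_rate: "weighted_rate a b \<pi> L = P"
    using L.weighted_block_entropy_tendsto LIMSEQ_unique by blast
  have uniq: "N = L" if N: "invariant_shift_measure N" and eq: "weighted_rate a b \<pi> N = P" for N
  proof (rule measure_eqI_cylinders)
    interpret N: invariant_shift_measure N by fact
    show "shift_measure N" "shift_measure L" by unfold_locales
    fix I :: "'a list"
    show "measure N (cylinder I) = measure L (cylinder I)"
    proof (cases "I = []")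
      case False
      then have len: "length I \<ge> 1" by (cases I) auto
      \<comment> \<open>The rate is a lower bound for every normalised block entropy, so a maximiser
        is sharp in the Gibbs bound at every single length, not merely in the limit.\<close>
      have "P \<le> weighted_block_entropy a b \<pi> N (length I) / real (length I)"
        using N.weighted_rate_le[of a b "length I" \<pi>] a b len eq by simp
      then have "P * real (length I) \<le> weighted_block_entropy a b \<pi> N (length I)"
        using len by (simp add: le_divide_eq split: if_splits)
      then show ?thesis
        using int_g[OF N, of "length I"] by (intro Q.potential_entropy_equality N) simp
    qed (use N.prob_space L.prob_space in simp)
  qed
  have "positive_shift_measure L" by unfold_locales (simp add: L_eq w_pos)
  then show ?thesis
    using that Q.weighted_gibbs le_P uniq L_rate by metis
qed

text \<open>Concavity of \<open>ent\<close> applies at each block length, to the measures and also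
  to their factors, because the factor of a mixture is the mixture of the factors. The positive
  share of L makes all cylinder weights positive.\<close>

lemma exists_mixture:
  fixes \<pi> :: "'a::{finite,discrete_topology} \<Rightarrow> 'd::{finite,discrete_topology}"
  assumes \<eta>: "invariant_shift_measure \<eta>" and L: "positive_shift_measure L"
    and e: "0 < e" "e \<le> 1" and a: "a \<ge> 0" and b: "b \<ge> 0"
  obtains M where "positive_shift_measure M"
    "\<And>I. measure M (cylinder I) = (1 - e) * measure \<eta> (cylinder I) + e * measure L (cylinder I)"
    "weighted_rate a b \<pi> M \<ge> (1 - e) * weighted_rate a b \<pi> \<eta> + e * weighted_rate a b \<pi> L"
proof -
  interpret \<eta>: invariant_shift_measure \<eta> by fact
  interpret L: positive_shift_measure L by fact
  define w where "w I = (1 - e) * measure \<eta> (cylinder I) + e * measure L (cylinder I)" for I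
  have w_pos: "w I > 0" for I
    unfolding w_def using e L.pos[of I] by (intro add_nonneg_pos) auto
  obtain M where M: "invariant_shift_measure M" and M_eq: "\<And>I. measure M (cylinder I) = w I"
  proof (rule exists_invariant_shift_measure[of w])
    show "w [] = 1" using \<eta>.prob_space L.prob_space by (simp add: w_def)
    show "(\<Sum>x\<in>UNIV. w (I @ [x])) = w I" for I
      by (simp add: w_def sum.distrib sum_distrib_left[symmetric] \<eta>.measure_cylinder_snoc L.measure_cylinder_snoc)
    show "(\<Sum>x\<in>UNIV. w (x # I)) = w I" for I
      by (simp add: w_def sum.distrib sum_distrib_left[symmetric] \<eta>.measure_cylinder_Cons L.measure_cylinder_Cons)
  qed (auto simp: w_pos)
  interpret M: invariant_shift_measure M by fact
  interpret \<eta>F: invariant_shift_measure "factor_measure \<pi> \<eta>" by (rule \<eta>.invariant_factor)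
  interpret LF: invariant_shift_measure "factor_measure \<pi> L" by (rule L.invariant_factor)
  interpret MF: invariant_shift_measure "factor_measure \<pi> M" by (rule M.invariant_factor)
  have block: "(1 - e) * block_entropy \<eta> n + e * block_entropy L n \<le> block_entropy M n" for n
    unfolding \<eta>.block_entropy_eq L.block_entropy_eq M.block_entropy_eq M_eq w_def
      sum_distrib_left sum.distrib[symmetric]
    using e by (intro sum_mono ent_concave) auto
  have factor_eq: "measure (factor_measure \<pi> M) (cylinder J) =
      (1 - e) * measure (factor_measure \<pi> \<eta>) (cylinder J) + e * measure (factor_measure \<pi> L) (cylinder J)" for J
    unfolding M.measure_factor_cylinder \<eta>.measure_factor_cylinder L.measure_factor_cylinder M_eq w_def
    by (simp add: sum.distrib sum_distrib_left)
  have factor_block: "(1 - e) * block_entropy (factor_measure \<pi> \<eta>) n + e * block_entropy (factor_measure \<pi> L) n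
      \<le> block_entropy (factor_measure \<pi> M) n" for n
    unfolding \<eta>F.block_entropy_eq LF.block_entropy_eq MF.block_entropy_eq factor_eq
      sum_distrib_left sum.distrib[symmetric]
    using e by (intro sum_mono ent_concave) auto
  have "(1 - e) * weighted_block_entropy a b \<pi> \<eta> n + e * weighted_block_entropy a b \<pi> L n
      \<le> weighted_block_entropy a b \<pi> M n" for n
    using mult_left_mono[OF block[of n] a] mult_left_mono[OF factor_block[of n] b]
    by (simp add: weighted_block_entropy_def algebra_simps)
  then have le: "(1 - e) * (weighted_block_entropy a b \<pi> \<eta> n / real n) + e * (weighted_block_entropy a b \<pi> L n / real n)
      \<le> weighted_block_entropy a b \<pi> M n / real n" for n
    using divide_right_mono[of _ _ "real n"] by (fastforce simp: add_divide_distrib)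
  have "(1 - e) * weighted_rate a b \<pi> \<eta> + e * weighted_rate a b \<pi> L \<le> weighted_rate a b \<pi> M"
    by (rule LIMSEQ_le[OF tendsto_add[OF tendsto_mult_left[OF \<eta>.weighted_block_entropy_tendsto]
            tendsto_mult_left[OF L.weighted_block_entropy_tendsto]] M.weighted_block_entropy_tendsto])
      (use le in blast)
  moreover have "positive_shift_measure M" by unfold_locales (simp add: M_eq w_pos)
  ultimately show ?thesis using that M_eq w_def by metis
qed

text \<open>The bound for the Markov approximation tends to \<open>(a + b) h - b (h - h')\<close>,
  with h' the rate of the factor, which is the weighted rate of M. It thus passes any smaller c for
  large order, and taking the order at least n secures the exact agreement on short
  cylinders.\<close>

lemma exists_gibbs_close:
  fixes \<pi> :: "'a::{finite,discrete_topology} \<Rightarrow> 'd::{finite,discrete_topology}"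
  assumes M: "positive_shift_measure M" and a: "a > 0" and b: "b \<ge> 0" and c: "c < weighted_rate a b \<pi> M"
  obtains N where "invariant_shift_measure N" "weighted_gibbs_measure a b \<pi> N"
    "\<And>I. length I \<le> n \<Longrightarrow> measure N (cylinder I) = measure M (cylinder I)"
    "c \<le> weighted_rate a b \<pi> N"
proof -
  interpret M: positive_shift_measure M by fact
  interpret F: invariant_shift_measure "factor_measure \<pi> M" by (rule M.invariant_factor)
  define bound where "bound k = (a + b) * entropy_rate M -
       b * ((block_entropy M k - block_entropy (factor_measure \<pi> M) k) / real k)" for k
  have "bound \<longlonglongrightarrow> (a + b) * entropy_rate M - b * (entropy_rate M - entropy_rate (factor_measure \<pi> M))"
    unfolding bound_def diff_divide_distrib
    by (intro tendsto_intros M.block_entropy_tendsto F.block_entropy_tendsto)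
  also have "(a + b) * entropy_rate M - b * (entropy_rate M - entropy_rate (factor_measure \<pi> M)) = weighted_rate a b \<pi> M"
    by (simp add: weighted_rate_def algebra_simps)
  finally have "\<forall>\<^sub>F k in sequentially. c < bound k" using c by (rule order_tendstoD)
  then obtain k0 where k0: "\<And>k. k \<ge> k0 \<Longrightarrow> c < bound k" by (auto simp: eventually_sequentially)
  obtain N where "invariant_shift_measure N" "weighted_gibbs_measure a b \<pi> N"
    "\<And>I. length I \<le> Suc (max k0 n) \<Longrightarrow> measure N (cylinder I) = measure M (cylinder I)"
    "weighted_rate a b \<pi> N \<ge> bound (Suc (max k0 n))"
    using M.exists_markov_approximation[OF a b, of \<pi> "max k0 n"] unfolding bound_def by metis
  moreover have "c < bound (Suc (max k0 n))" by (rule k0) simp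
  ultimately show ?thesis by (intro that[of N]) auto
qed

text \<open>The upper bound holds because block entropies are weak-star continuous and, divided by the block
  length, bound the entropy rate from above.\<close>

lemma weighted_rate_tendsto:
  fixes \<pi> :: "'a::{finite,discrete_topology} \<Rightarrow> 'd::{finite,discrete_topology}"
  assumes \<mu>: "\<And>n. invariant_shift_measure (\<mu> n)" and \<eta>: "invariant_shift_measure \<eta>"
    and a: "a \<ge> 0" and b: "b \<ge> 0"
    and lim: "\<And>I. (\<lambda>n. measure (\<mu> n) (cylinder I)) \<longlonglongrightarrow> measure \<eta> (cylinder I)"
    and ge: "\<And>n. weighted_rate a b \<pi> \<eta> \<le> weighted_rate a b \<pi> (\<mu> n)"
  shows "(\<lambda>n. weighted_rate a b \<pi> (\<mu> n)) \<longlonglongrightarrow> weighted_rate a b \<pi> \<eta>"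
proof (rule order_tendstoI)
  fix c assume "c < weighted_rate a b \<pi> \<eta>"
  then show "\<forall>\<^sub>F n in sequentially. c < weighted_rate a b \<pi> (\<mu> n)"
    by (intro always_eventually allI less_le_trans[OF _ ge])
next
  fix c assume c: "weighted_rate a b \<pi> \<eta> < c"
  interpret \<eta>: invariant_shift_measure \<eta> by fact
  have sm: "shift_measure (\<mu> n)" for n using \<mu>[of n] by (rule invariant_shift_measure.axioms)
  have ent_lim: "(\<lambda>n. ent (f n)) \<longlonglongrightarrow> ent t" if "f \<longlonglongrightarrow> t" "\<And>n. f n \<ge> 0" "t \<ge> 0" for f t
    using that by (intro continuous_on_tendsto_compose[OF continuous_on_ent]) auto
  have block: "(\<lambda>n. block_entropy (\<mu> n) m) \<longlonglongrightarrow> block_entropy \<eta> m" for m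
    unfolding shift_measure.block_entropy_eq[OF sm] \<eta>.block_entropy_eq
    by (intro tendsto_sum ent_lim lim) auto
  have factor_lim: "(\<lambda>n. measure (factor_measure \<pi> (\<mu> n)) (cylinder J)) \<longlonglongrightarrow> measure (factor_measure \<pi> \<eta>) (cylinder J)" for J
    unfolding shift_measure.measure_factor_cylinder[OF sm] \<eta>.measure_factor_cylinder
    by (intro tendsto_sum lim)
  have factor_block: "(\<lambda>n. block_entropy (factor_measure \<pi> (\<mu> n)) m) \<longlonglongrightarrow> block_entropy (factor_measure \<pi> \<eta>) m" for m
    unfolding shift_measure.block_entropy_eq[OF shift_measure.shift_measure_factor[OF sm]]
      shift_measure.block_entropy_eq[OF \<eta>.shift_measure_factor]
    by (intro tendsto_sum ent_lim factor_lim) auto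
  have "\<forall>\<^sub>F m in sequentially. weighted_block_entropy a b \<pi> \<eta> m / real m < c"
    using \<eta>.weighted_block_entropy_tendsto c by (rule order_tendstoD)
  then obtain m0 where "\<And>m. m \<ge> m0 \<Longrightarrow> weighted_block_entropy a b \<pi> \<eta> m / real m < c"
    by (auto simp: eventually_sequentially)
  \<comment> \<open>One fixed block length suffices: its normalised entropy bounds every rate in the
    sequence and depends continuously on the cylinder weights.\<close>
  then obtain m where m: "m \<ge> 1" "weighted_block_entropy a b \<pi> \<eta> m / real m < c"
    using max.cobounded1[of 1 m0] max.cobounded2[of m0 1] by blast
  have "(\<lambda>n. weighted_block_entropy a b \<pi> (\<mu> n) m / real m) \<longlonglongrightarrow> weighted_block_entropy a b \<pi> \<eta> m / real m"
    unfolding weighted_block_entropy_def using m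
    by (intro tendsto_intros block factor_block) auto
  then have "\<forall>\<^sub>F n in sequentially. weighted_block_entropy a b \<pi> (\<mu> n) m / real m < c"
    using m(2) by (rule order_tendstoD)
  then show "\<forall>\<^sub>F n in sequentially. weighted_rate a b \<pi> (\<mu> n) < c"
    by eventually_elim (rule le_less_trans[OF invariant_shift_measure.weighted_rate_le[OF \<mu> a b m(1)]])
qed

lemma exists_gibbs_approximation:
  fixes \<pi> :: "'a::{finite,discrete_topology} \<Rightarrow> 'd::{finite,discrete_topology}"
  assumes \<eta>: "invariant_shift_measure \<eta>" and a: "a > 0" and b: "b \<ge> 0"
  obtains \<mu> where "\<And>n. invariant_shift_measure (\<mu> n)" "\<And>n. weighted_gibbs_measure a b \<pi> (\<mu> n)"
    "\<And>I. (\<lambda>n. measure (\<mu> n) (cylinder I)) \<longlonglongrightarrow> measure \<eta> (cylinder I)"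
    "\<And>n. weighted_rate a b \<pi> \<eta> \<le> weighted_rate a b \<pi> (\<mu> n)"
proof -
  obtain L where L: "positive_shift_measure L" "weighted_gibbs_measure a b \<pi> L"
    and L_max: "weighted_rate a b \<pi> \<eta> \<le> weighted_rate a b \<pi> L"
    and L_uniq: "weighted_rate a b \<pi> \<eta> = weighted_rate a b \<pi> L \<Longrightarrow> \<eta> = L"
    using exists_maximal_bernoulli[OF a b, of \<pi>] \<eta> by metis
  show ?thesis
  proof (cases "weighted_rate a b \<pi> \<eta> = weighted_rate a b \<pi> L")
    case True
    then show ?thesis
      using that[of "\<lambda>_. L"] L L_uniq \<eta> by simp
  next
    case False
    then have less: "weighted_rate a b \<pi> \<eta> < weighted_rate a b \<pi> L" using L_max by simp
    \<comment> \<open>Any null sequence of proportions in the interval from zero (excluded) to one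
      would serve; positivity gives the gain, convergence to zero the limit \<eta>.\<close>
    define e where "e n = 1 / real (Suc n)" for n
    have e: "0 < e n" "e n \<le> 1" for n by (simp_all add: e_def)
    have "\<exists>N. invariant_shift_measure N \<and> weighted_gibbs_measure a b \<pi> N \<and>
        (\<forall>I. length I \<le> n \<longrightarrow> measure N (cylinder I) =
           (1 - e n) * measure \<eta> (cylinder I) + e n * measure L (cylinder I)) \<and>
        weighted_rate a b \<pi> \<eta> \<le> weighted_rate a b \<pi> N" for n
    proof -
      obtain M where M: "positive_shift_measure M"
        "\<And>I. measure M (cylinder I) = (1 - e n) * measure \<eta> (cylinder I) + e n * measure L (cylinder I)"
        "weighted_rate a b \<pi> M \<ge> (1 - e n) * weighted_rate a b \<pi> \<eta> + e n * weighted_rate a b \<pi> L"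
        using exists_mixture[OF \<eta> L(1) e less_imp_le[OF a] b] by metis
      have "e n * weighted_rate a b \<pi> \<eta> < e n * weighted_rate a b \<pi> L"
        using less e(1) by (rule mult_strict_left_mono)
      \<comment> \<open>This strict gain allows the weighted rate of \<eta> itself to be the
        threshold c in \<open>exists_gibbs_close\<close>.\<close>
      then have "weighted_rate a b \<pi> \<eta> < weighted_rate a b \<pi> M"
        using M(3) by (simp add: algebra_simps)
      then show ?thesis
        using exists_gibbs_close[OF M(1) a b] M(2) by metis
    qed
    then obtain \<mu> where \<mu>: "\<And>n. invariant_shift_measure (\<mu> n)" "\<And>n. weighted_gibbs_measure a b \<pi> (\<mu> n)"
      "\<And>n I. length I \<le> n \<Longrightarrow> measure (\<mu> n) (cylinder I) =
         (1 - e n) * measure \<eta> (cylinder I) + e n * measure L (cylinder I)"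
      "\<And>n. weighted_rate a b \<pi> \<eta> \<le> weighted_rate a b \<pi> (\<mu> n)"
      by metis
    have "(\<lambda>n. measure (\<mu> n) (cylinder I)) \<longlonglongrightarrow> measure \<eta> (cylinder I)" for I
    proof -
      have "e \<longlonglongrightarrow> 0" unfolding e_def by real_asymp
      then have "(\<lambda>n. (1 - e n) * measure \<eta> (cylinder I) + e n * measure L (cylinder I))
          \<longlonglongrightarrow> (1 - 0) * measure \<eta> (cylinder I) + 0 * measure L (cylinder I)"
        by (intro tendsto_intros)
      moreover have "\<forall>\<^sub>F n in sequentially. (1 - e n) * measure \<eta> (cylinder I) + e n * measure L (cylinder I)
          = measure (\<mu> n) (cylinder I)"
        using eventually_ge_at_top[of "length I"] by eventually_elim (simp add: \<mu>(3))
      ultimately show ?thesis by (auto intro: Lim_transform_eventually)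
    qed
    with \<mu> show ?thesis using that by blast
  qed
qed

theorem theorem1p5:
  fixes \<pi> :: "'a::{finite,discrete_topology} \<Rightarrow> 'd::{finite,discrete_topology}"
    and a b :: real
    and \<eta> :: "(nat \<Rightarrow> 'a) measure"
  assumes "one_block_factor_map \<pi>"
    and "a > 0" and "b \<ge> 0"
    and "\<eta> \<in> invariant_measures shift_map"
  shows "\<exists>\<mu> :: nat \<Rightarrow> (nat \<Rightarrow> 'a) measure.
           (\<forall>n\<ge>1. weighted_gibbs_measure a b \<pi> (\<mu> n) \<and> \<mu> n \<in> invariant_measures shift_map) \<and>
           weak_star_tendsto \<mu> \<eta> \<and>
           (\<forall>n\<ge>1. weighted_entropy a b \<pi> (\<mu> n) \<ge> weighted_entropy a b \<pi> \<eta>) \<and>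
           (\<lambda>n. weighted_entropy a b \<pi> (\<mu> n)) \<longlonglongrightarrow> weighted_entropy a b \<pi> \<eta>"
proof -
  have \<eta>: "invariant_shift_measure \<eta>"
    using assms(4) by (simp add: invariant_shift_measure_iff)
  obtain \<mu> where inv: "\<And>n. invariant_shift_measure (\<mu> n)"
    and gibbs: "\<And>n. weighted_gibbs_measure a b \<pi> (\<mu> n)"
    and lim: "\<And>I. (\<lambda>n. measure (\<mu> n) (cylinder I)) \<longlonglongrightarrow> measure \<eta> (cylinder I)"
    and ge: "\<And>n. weighted_rate a b \<pi> \<eta> \<le> weighted_rate a b \<pi> (\<mu> n)"
    using exists_gibbs_approximation[OF \<eta> assms(2,3), of \<pi>] by metis
  \<comment> \<open>All weighted entropies involved are finite, so the claims about extended reals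
    reduce to claims about real rates.\<close>
  have rate: "weighted_entropy a b \<pi> (\<mu> n) = ereal (weighted_rate a b \<pi> (\<mu> n))"
    "weighted_entropy a b \<pi> \<eta> = ereal (weighted_rate a b \<pi> \<eta>)" for n
    using inv \<eta> by (auto intro: invariant_shift_measure.weighted_entropy_eq)
  have "weak_star_tendsto \<mu> \<eta>"
    using inv \<eta> by (intro weak_star_tendsto_cylinders lim) (auto intro: invariant_shift_measure.axioms)
  moreover have "(\<lambda>n. weighted_rate a b \<pi> (\<mu> n)) \<longlonglongrightarrow> weighted_rate a b \<pi> \<eta>"
    using assms by (intro weighted_rate_tendsto inv \<eta> lim ge) auto
  ultimately show ?thesis
    using gibbs inv ge by (intro exI[of _ \<mu>]) (auto simp: rate invariant_shift_measure_iff)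
qed

end
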